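(* Let $G$ be an analytic Moufang loop of dimension $r$ with unit $e$ and let $(S,T)$ be a differentiable birepresentation of $G$ in $GL_n$. Then the integrability conditions of the generalized Lie equations of $(S,T)$ can be written, for all $g$ in the coordinate neighbourhood of $e$ and all $x,y\in T_e(G)$, as \[ [S_x(g),S_y(g)]=2Y_g(x;y)+\tfrac13 S_{[x,y]_g}(g)+\tfrac23 T_{[x,y]_g}(g),\tag{1} \] \[ [S_x(g),T_y(g)]=-Y_g(x;y)+\tfrac13 S_{[x,y]_g}(g)-\tfrac13 T_{[x,y]_g}(g),\tag{2} \] \[ [T_x(g),T_y(g)]=2Y_g(x;y)-\tfrac23 S_{[x,y]_g}(g)-\tfrac13 T_{[x,y]_g}(g).\tag{3} \] Moreover, for all $x,y,z,w\in T_e(G)$ the reductivity conditions \[ 6[Y_g(x;y),S_z(g)]=S_{[x,y,z]_g}(g),\tag{4} \] \[ 6[Y_g(x;y),T_z(g)]=T_{[x,y,z]_g}(g)\tag{5} \] hold, and the Yamagutian obeys \[ 6[Y_g(x;y),Y_g(z;w)]=Y_g([x,y,z]_g;w)+Y_g(z;[x,y,w]_g).\tag{6} \] Thus the commutation relations for the derivative generators of $(S,T)$ take the closed Lie algebra form (1)–(6), and the dimension of this Lie algebra does not exceed $2r+r(r-1)/2$. For $g=e$, the commutation relations (1)–(6) give the Lie algebra of the multiplication group of the birepresentation $(S,T)$.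
   Context: A Moufang loop is a quasigroup $G$ with unit element $e$ satisfying $(ag)(ha)=a(gh)a$ for all $a,g,h\in G$. It is analytic if $G$ is also a real analytic manifold and the multiplication and the inversion $g\mapsto g^{-1}$ are analytic maps. Let $r=\dim G$, let $g^{i}$ ($i=1,\dots,r$) denote the local coordinates of $g$ in a neighbourhood of $e$, and let $T_e(G)$ be the tangent space at $e$, with elements $x$ having components $x^{i}$. Summation over repeated upper and lower indices from $1$ to $r$ is understood. A (linear) birepresentation of $G$ in $GL_n$ is a pair $(S,T)$ of maps $g\mapsto S_g$, $g\mapsto T_g$ from $G$ to $GL_n$ such that $S_e=T_e=\mathrm{id}$ and, for all $g,h\in G$, \[ T_gS_gS_h=S_{gh}T_g,\qquad S_gT_gT_h=T_{hg}S_g . \] It is differentiable if both maps are differentiable (as often as needed). The multiplication group of the birepresentation is the group generated by all $S_g,T_g$, $g\in G$. The generators are $S_j=\frac{\partial S_g}{\partial g^{j}}\big|_{g=e}$, $T_j=\frac{\partial T_g}{\partial g^{j}}\big|_{g=e}$, and the derivative generators are $S_j(g)=T_gS_jT_g^{-1}$, $T_j(g)=S_g^{-1}T_jS_g$ ($j=1,\dots,r$). For $x\in T_e(G)$ put $S_x(g)=x^{j}S_j(g)$ and $T_x(g)=x^{j}T_j(g)$. The auxiliary functions of $G$ are $v_j^{n}(g)=\frac{\partial (gh)^{n}}{\partial h^{j}}\big|_{h=e}$, and the structure functions $c_{jk}^{n}(g)$ of $G$ are defined by \[ v_j^{n}(g)\frac{\partial v_k^{i}(g)}{\partial g^{n}}-v_k^{n}(g)\frac{\partial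 v_j^{i}(g)}{\partial g^{n}}=c_{jk}^{n}(g)\,v_n^{i}(g). \] The generalized Lie equations of $(S,T)$ are the differential equations \[ v_j^{n}(g)\frac{\partial S_g}{\partial g^{n}}=S_g\,S_j(g),\qquad v_j^{n}(g)\frac{\partial T_g}{\partial g^{n}}=T_j(g)\,T_g, \] which $S_g,T_g$ satisfy; their integrability conditions are the relations obtained by differentiating them and using the equality of mixed second partial derivatives of $S_g$ and of $T_g$. For $x,y\in T_e(G)$ the bracket $[x,y]_g\in T_e(G)$ is defined by $[x,y]_g^{i}=c^{i}_{jk}(g)x^{j}y^{k}$. The Yamaguti bracket is \[ [x,y,z]_g=[x,[y,z]_g]_g-[y,[x,z]_g]_g+[[x,y]_g,z]_g . \] For linear operators $A,B$, $[A,B]=AB-BA$. The Yamagutian $Y_g$ is defined by \[ 3Y_g(x;y)=[S_x(g),S_y(g)]+[S_x(g),T_y(g)]+[T_x(g),T_y(g)]. \]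
   Formalization: The last claim fails for disconnected G (e.g. Chein's double of SU(2)); it is proved for the group generated by S_g, T_g with g in the connected component of e, and for the whole multiplication group when G is connected. *)

theory Defs
  imports "HOL-Analysis.Analysis" "HOL-Algebra.Generated_Groups"
begin

section \<open>Real analytic and smooth maps between Euclidean spaces\<close>

text \<open>
  Local expansion into a power series in several variables. A multi-index is a function on the
  orthonormal basis, extensional outside of it, and summation over multi-indices is unconditional.
\<close>

definition real_analytic_on ::
  "('a::euclidean_space \<Rightarrow> 'b::real_normed_vector) \<Rightarrow> 'a set \<Rightarrow> bool" where
  "real_analytic_on f X \<longleftrightarrow>
    (\<forall>p\<in>X. \<exists>(a :: ('a \<Rightarrow> nat) \<Rightarrow> 'b) \<epsilon>. \<epsilon> > 0 \<and>
      (\<forall>h. norm h < \<epsilon> \<longrightarrow>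
        ((\<lambda>\<alpha>. (\<Prod>b\<in>Basis. (h \<bullet> b) ^ \<alpha> b) *\<^sub>R a \<alpha>) has_sum f (p + h))
          (Basis \<rightarrow>\<^sub>E (UNIV :: nat set))))"

primrec Ck_on ::
  "nat \<Rightarrow> ('a::euclidean_space \<Rightarrow> 'b::real_normed_vector) \<Rightarrow> 'a set \<Rightarrow> bool" where
  "Ck_on 0 f X \<longleftrightarrow> continuous_on X f"
| "Ck_on (Suc k) f X \<longleftrightarrow>
    f differentiable_on X \<and> (\<forall>b\<in>Basis. Ck_on k (\<lambda>p. frechet_derivative f (at p) b) X)"

text \<open>Only used for open sets.\<close>

definition smooth_on ::
  "('a::euclidean_space \<Rightarrow> 'b::real_normed_vector) \<Rightarrow> 'a set \<Rightarrow> bool" where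
  "smooth_on f X \<longleftrightarrow> (\<forall>k. Ck_on k f X)"


section \<open>Real analytic manifolds\<close>

text \<open>
  A chart is a pair of an open domain and a coordinate map. The underlying spaces are Hausdorff
  and second countable by the sort constraints in the loop locale below.
\<close>

type_synonym ('g, 'e) chart = "'g set \<times> ('g \<Rightarrow> 'e)"

definition chart_inv :: "('g, 'e) chart \<Rightarrow> 'e \<Rightarrow> 'g" where
  "chart_inv c = inv_into (fst c) (snd c)"

definition is_chart :: "('g::topological_space, 'e::euclidean_space) chart \<Rightarrow> bool" where
  "is_chart c \<longleftrightarrow> open (fst c) \<and> open (snd c ` fst c) \<and>
     homeomorphism (fst c) (snd c ` fst c) (snd c) (chart_inv c)"

definition analytic_atlas :: "('g::topological_space, 'e::euclidean_space) chart set \<Rightarrow> bool" where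
  "analytic_atlas A \<longleftrightarrow>
     (\<forall>c\<in>A. is_chart c) \<and> (\<Union>c\<in>A. fst c) = UNIV \<and>
     (\<forall>c\<in>A. \<forall>d\<in>A. real_analytic_on (snd d \<circ> chart_inv c) (snd c ` (fst c \<inter> fst d)))"

definition prod_atlas ::
  "('g, 'e) chart set \<Rightarrow> ('h, 'f) chart set \<Rightarrow> ('g \<times> 'h, 'e \<times> 'f) chart set" where
  "prod_atlas A B = (\<lambda>(c, d). (fst c \<times> fst d, map_prod (snd c) (snd d))) ` (A \<times> B)"

definition analytic_map ::
  "('g::topological_space, 'e::euclidean_space) chart set \<Rightarrow>
   ('h::topological_space, 'f::euclidean_space) chart set \<Rightarrow> ('g \<Rightarrow> 'h) \<Rightarrow> bool" where
  "analytic_map A B f \<longleftrightarrow> continuous_on UNIV f \<and>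
     (\<forall>c\<in>A. \<forall>d\<in>B.
        real_analytic_on (snd d \<circ> f \<circ> chart_inv c) (snd c ` (fst c \<inter> f -` fst d)))"

definition smooth_function ::
  "('g::topological_space, 'e::euclidean_space) chart set \<Rightarrow>
   ('g \<Rightarrow> 'b::real_normed_vector) \<Rightarrow> bool" where
  "smooth_function A F \<longleftrightarrow> (\<forall>c\<in>A. smooth_on (F \<circ> chart_inv c) (snd c ` fst c))"

text \<open>The partial derivative of \<open>F\<close> with respect to the \<open>j\<close>-th local coordinate at \<open>g\<close>.\<close>

definition coord_deriv ::
  "('g, real^'r) chart \<Rightarrow> ('g \<Rightarrow> 'b::real_normed_vector) \<Rightarrow> 'r::finite \<Rightarrow> 'g \<Rightarrow> 'b" where
  "coord_deriv c F j g =
     vector_derivative (\<lambda>t. F (chart_inv c (snd c g + t *\<^sub>R axis j 1))) (at 0)"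


section \<open>Analytic Moufang loops\<close>

locale moufang_loop =
  fixes m :: "'g \<Rightarrow> 'g \<Rightarrow> 'g" (infixl "\<odot>" 70) and e :: 'g
  assumes left_division: "\<exists>!x. a \<odot> x = b"
    and right_division: "\<exists>!x. x \<odot> a = b"
    and unit_left: "e \<odot> g = g"
    and unit_right: "g \<odot> e = g"
    and moufang: "(a \<odot> g) \<odot> (h \<odot> a) = (a \<odot> (g \<odot> h)) \<odot> a"

definition loop_inverse :: "('g \<Rightarrow> 'g \<Rightarrow> 'g) \<Rightarrow> 'g \<Rightarrow> 'g \<Rightarrow> 'g" where
  "loop_inverse m e g = (THE h. m g h = e)"

locale analytic_moufang_loop = moufang_loop m e
  for m :: "'g::{t2_space, second_countable_topology} \<Rightarrow> 'g \<Rightarrow> 'g" and e :: 'g +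
  fixes A :: "('g, real^'r::finite) chart set"
  assumes atlas: "analytic_atlas A"
    and analytic_mult: "analytic_map (prod_atlas A A) A (\<lambda>(g, h). m g h)"
    and analytic_inverse: "analytic_map A A (loop_inverse m e)"

text \<open>
  In the following \<open>c\<close> is a chart around the unit \<open>e\<close>, and tangent vectors at \<open>e\<close> are given by
  their components in this chart. \<open>aux_fun m e c j n g\<close> is $v_j^n(g)$ and
  \<open>structure_fun m e c g j k n\<close> is $c_{jk}^n(g)$.
\<close>

definition aux_fun ::
  "('g \<Rightarrow> 'g \<Rightarrow> 'g) \<Rightarrow> 'g \<Rightarrow> ('g, real^'r) chart \<Rightarrow> 'r::finite \<Rightarrow> 'r \<Rightarrow> 'g \<Rightarrow> real" where
  "aux_fun m e c j n g = coord_deriv c (\<lambda>h. snd c (m g h) $ n) j e"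

definition structure_fun ::
  "('g \<Rightarrow> 'g \<Rightarrow> 'g) \<Rightarrow> 'g \<Rightarrow> ('g, real^'r) chart \<Rightarrow> 'g \<Rightarrow> 'r::finite \<Rightarrow> 'r \<Rightarrow> 'r \<Rightarrow> real" where
  "structure_fun m e c g =
    (let v = aux_fun m e c in
     THE C. \<forall>j k i.
       (\<Sum>n\<in>UNIV. v j n g * coord_deriv c (v k i) n g)
         - (\<Sum>n\<in>UNIV. v k n g * coord_deriv c (v j i) n g)
       = (\<Sum>n\<in>UNIV. C j k n * v n i g))"

definition loop_bracket ::
  "('g \<Rightarrow> 'g \<Rightarrow> 'g) \<Rightarrow> 'g \<Rightarrow> ('g, real^'r) chart \<Rightarrow> 'g \<Rightarrow>
   real^'r \<Rightarrow> real^'r \<Rightarrow> real^'r::finite" where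
  "loop_bracket m e c g x y =
     (\<chi> i. \<Sum>j\<in>UNIV. \<Sum>k\<in>UNIV. structure_fun m e c g j k i * x $ j * y $ k)"

definition yamaguti_bracket ::
  "('g \<Rightarrow> 'g \<Rightarrow> 'g) \<Rightarrow> 'g \<Rightarrow> ('g, real^'r) chart \<Rightarrow> 'g \<Rightarrow>
   real^'r \<Rightarrow> real^'r \<Rightarrow> real^'r \<Rightarrow> real^'r::finite" where
  "yamaguti_bracket m e c g x y z =
    (let br = loop_bracket m e c g in br x (br y z) - br y (br x z) + br (br x y) z)"


section \<open>Matrix Lie algebras and matrix groups\<close>

text \<open>
  The scalars are of sort \<open>{real_normed_field, euclidean_space}\<close>, which covers the real and the
  complex numbers. Lie algebras, their spans and their dimensions are real in both cases.
\<close>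

definition commutator :: "'k::ring_1^'n^'n \<Rightarrow> 'k^'n^'n \<Rightarrow> 'k^'n^'n::finite" where
  "commutator P Q = P ** Q - Q ** P"

definition lie_subalgebra ::
  "('k::{real_normed_field, euclidean_space}^'n^'n::finite) set \<Rightarrow> bool" where
  "lie_subalgebra L \<longleftrightarrow> subspace L \<and> (\<forall>P\<in>L. \<forall>Q\<in>L. commutator P Q \<in> L)"

definition GL :: "('k::field^'n^'n::finite) monoid" where
  "GL = \<lparr>carrier = {P. invertible P}, monoid.mult = (**), one = mat 1\<rparr>"

text \<open>
  The Lie algebra of an arbitrary (not necessarily closed) subgroup of the general linear group:
  the velocities at the identity of continuously differentiable curves inside the subgroup.
\<close>

definition group_lie_algebra ::
  "('k::{real_normed_field, euclidean_space}^'n^'n::finite) set \<Rightarrow> ('k^'n^'n) set" where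
  "group_lie_algebra H =
    {X. \<exists>\<gamma> \<epsilon>. \<epsilon> > 0 \<and> \<gamma> ` {-\<epsilon><..<\<epsilon>} \<subseteq> H \<and> \<gamma> C1_differentiable_on {-\<epsilon><..<\<epsilon>} \<and>
        \<gamma> 0 = mat 1 \<and> (\<gamma> has_vector_derivative X) (at (0::real))}"


section \<open>Birepresentations\<close>

locale birepresentation =
  fixes m :: "'g \<Rightarrow> 'g \<Rightarrow> 'g" and e :: 'g
    and S T :: "'g \<Rightarrow> 'k::{real_normed_field, euclidean_space}^'n^'n::finite"
  assumes invertible_S: "invertible (S g)"
    and invertible_T: "invertible (T g)"
    and S_unit: "S e = mat 1"
    and T_unit: "T e = mat 1"
    and TSS: "T g ** S g ** S h = S (m g h) ** T g"
    and STT: "S g ** T g ** T h = T (m h g) ** S g"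

text \<open>
  The group generated by the operators belonging to the elements of \<open>K\<close>. The multiplication group
  is the case \<open>K = UNIV\<close>.
  For a disconnected loop the operators of the other components can enlarge its Lie algebra (this
  happens for Chein's double of SU(2)), so \<open>K\<close> is also taken to be the component of the unit.
\<close>

definition mult_group ::
  "('g \<Rightarrow> 'k::field^'n^'n) \<Rightarrow> ('g \<Rightarrow> 'k^'n^'n) \<Rightarrow> 'g set \<Rightarrow> ('k^'n^'n::finite) set" where
  "mult_group S T K = generate GL (S ` K \<union> T ` K)"

text \<open>
  The derivative generators $S_j(g) = T_g S_j T_g^{-1}$ and $T_j(g) = S_g^{-1} T_j S_g$, and their
  linear extensions $S_x(g)$ and $T_x(g)$.
\<close>

definition dgen_S ::
  "'g \<Rightarrow> ('g, real^'r) chart \<Rightarrow> ('g \<Rightarrow> 'k::{real_normed_field, euclidean_space}^'n^'n) \<Rightarrow>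
   ('g \<Rightarrow> 'k^'n^'n) \<Rightarrow> 'r::finite \<Rightarrow> 'g \<Rightarrow> 'k^'n^'n::finite" where
  "dgen_S e c S T j g = T g ** coord_deriv c S j e ** matrix_inv (T g)"

definition dgen_T ::
  "'g \<Rightarrow> ('g, real^'r) chart \<Rightarrow> ('g \<Rightarrow> 'k::{real_normed_field, euclidean_space}^'n^'n) \<Rightarrow>
   ('g \<Rightarrow> 'k^'n^'n) \<Rightarrow> 'r::finite \<Rightarrow> 'g \<Rightarrow> 'k^'n^'n::finite" where
  "dgen_T e c S T j g = matrix_inv (S g) ** coord_deriv c T j e ** S g"

definition lin_S ::
  "'g \<Rightarrow> ('g, real^'r) chart \<Rightarrow> ('g \<Rightarrow> 'k::{real_normed_field, euclidean_space}^'n^'n) \<Rightarrow>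
   ('g \<Rightarrow> 'k^'n^'n) \<Rightarrow> 'g \<Rightarrow> real^'r::finite \<Rightarrow> 'k^'n^'n::finite" where
  "lin_S e c S T g x = (\<Sum>j\<in>UNIV. x $ j *\<^sub>R dgen_S e c S T j g)"

definition lin_T ::
  "'g \<Rightarrow> ('g, real^'r) chart \<Rightarrow> ('g \<Rightarrow> 'k::{real_normed_field, euclidean_space}^'n^'n) \<Rightarrow>
   ('g \<Rightarrow> 'k^'n^'n) \<Rightarrow> 'g \<Rightarrow> real^'r::finite \<Rightarrow> 'k^'n^'n::finite" where
  "lin_T e c S T g x = (\<Sum>j\<in>UNIV. x $ j *\<^sub>R dgen_T e c S T j g)"

definition yamagutian ::
  "'g \<Rightarrow> ('g, real^'r) chart \<Rightarrow> ('g \<Rightarrow> 'k::{real_normed_field, euclidean_space}^'n^'n) \<Rightarrow>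
   ('g \<Rightarrow> 'k^'n^'n) \<Rightarrow> 'g \<Rightarrow> real^'r::finite \<Rightarrow> real^'r \<Rightarrow> 'k^'n^'n::finite" where
  "yamagutian e c S T g x y =
    (let Sg = lin_S e c S T g; Tg = lin_T e c S T g in
     (1/3) *\<^sub>R (commutator (Sg x) (Sg y) + commutator (Sg x) (Tg y) + commutator (Tg x) (Tg y)))"

definition generalized_lie_equations ::
  "('g \<Rightarrow> 'g \<Rightarrow> 'g) \<Rightarrow> 'g \<Rightarrow> ('g, real^'r::finite) chart \<Rightarrow>
   ('g \<Rightarrow> 'k::{real_normed_field, euclidean_space}^'n^'n) \<Rightarrow> ('g \<Rightarrow> 'k^'n^'n::finite) \<Rightarrow>
   'g \<Rightarrow> bool" where
  "generalized_lie_equations m e c S T g \<longleftrightarrow>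
    (let v = aux_fun m e c in
     \<forall>j. (\<Sum>n\<in>UNIV. v j n g *\<^sub>R coord_deriv c S n g) = S g ** dgen_S e c S T j g \<and>
         (\<Sum>n\<in>UNIV. v j n g *\<^sub>R coord_deriv c T n g) = dgen_T e c S T j g ** T g)"

text \<open>
  With $D_j = v_j^n \partial_n$, equality of mixed second partial derivatives means that
  $D_j D_k F - D_k D_j F = c_{jk}^n D_n F$ for $F = S$ and $F = T$. The integrability conditions
  result from inserting the right-hand sides of the generalized Lie equations for $D_j F$,
  $D_k F$ and $D_n F$.
\<close>

definition integrability_conditions ::
  "('g \<Rightarrow> 'g \<Rightarrow> 'g) \<Rightarrow> 'g \<Rightarrow> ('g, real^'r::finite) chart \<Rightarrow>
   ('g \<Rightarrow> 'k::{real_normed_field, euclidean_space}^'n^'n) \<Rightarrow> ('g \<Rightarrow> 'k^'n^'n::finite) \<Rightarrow>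
   'g \<Rightarrow> bool" where
  "integrability_conditions m e c S T g \<longleftrightarrow>
    (let v = aux_fun m e c; C = structure_fun m e c g;
         FS = (\<lambda>j g. S g ** dgen_S e c S T j g);
         FT = (\<lambda>j g. dgen_T e c S T j g ** T g)
     in \<forall>j k.
       (\<Sum>n\<in>UNIV. v j n g *\<^sub>R coord_deriv c (FS k) n g)
         - (\<Sum>n\<in>UNIV. v k n g *\<^sub>R coord_deriv c (FS j) n g)
         = (\<Sum>n\<in>UNIV. C j k n *\<^sub>R FS n g) \<and>
       (\<Sum>n\<in>UNIV. v j n g *\<^sub>R coord_deriv c (FT k) n g)
         - (\<Sum>n\<in>UNIV. v k n g *\<^sub>R coord_deriv c (FT j) n g)
         = (\<Sum>n\<in>UNIV. C j k n *\<^sub>R FT n g))"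

definition derivative_generators ::
  "'g \<Rightarrow> ('g, real^'r) chart \<Rightarrow> ('g \<Rightarrow> 'k::{real_normed_field, euclidean_space}^'n^'n) \<Rightarrow>
   ('g \<Rightarrow> 'k^'n^'n) \<Rightarrow> 'g \<Rightarrow> ('k^'n^'n::finite) set" where
  "derivative_generators e c S T g =
     range (\<lambda>j::'r::finite. dgen_S e c S T j g) \<union> range (\<lambda>j. dgen_T e c S T j g)"

text \<open>The space on which the commutation relations close.\<close>

definition birep_lie_algebra ::
  "'g \<Rightarrow> ('g, real^'r) chart \<Rightarrow> ('g \<Rightarrow> 'k::{real_normed_field, euclidean_space}^'n^'n) \<Rightarrow>
   ('g \<Rightarrow> 'k^'n^'n) \<Rightarrow> 'g \<Rightarrow> ('k^'n^'n::finite) set" where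
  "birep_lie_algebra e c S T g =
     span (range (lin_S e c S T g) \<union> range (lin_T e c S T g) \<union>
           {yamagutian e c S T g x y | x y :: real^'r::finite. True})"

end

theory Submission
  imports Defs
begin

text \<open>
  The commutation relations come from three product formulas. Solving the two defining equations of a birepresentation gives $S_{gh} = T_g S_g S_h T_g^{-1}$ and
  $T_{gh} = S_h T_h T_g S_h^{-1}$; inverting $S_{h^{-1} g^{-1}}$ in the first one gives a second
  expression for $S_{gh}$, and comparing the two yields $T_{gh} = S_g^{-1} T_h S_g T_g$ as well
  (\<open>T_mult'\<close>). Let $D_a$ be the derivative along the vector field that left translations make out
  of a tangent vector $a$ at the unit. Differentiating the formulas in $h$ at $h = e$ gives the
  generalized Lie equations (\<open>lie_S\<close>, \<open>lie_T\<close>), and equating the two derivatives of $T_{gh}$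
  shows that $S_a(g) + T_a(g)$ is independent of $g$ (\<open>sum_const\<close>). From the Lie equations
  $D_a S_b = [T_a, S_b]$ and $D_a T_b = -[S_a, T_b]$, so that constancy turns into
  $[S_a, T_b] = [T_a, S_b]$ (\<open>mixed_swap\<close>). The structure functions are defined by
  $D_a D_b - D_b D_a = D_{[a,b]}$; inserting the Lie equations leaves
  $[S_a,S_b] + 2[S_a,T_b] = S_{[a,b]}$ and $[T_a,T_b] + 2[S_a,T_b] = -T_{[a,b]}$
  (\<open>integr_SS\<close>, \<open>integr_TT\<close>).

  Everything else at a point $g$ is algebra of these three identities, collected in the locale
  \<open>moufang_relations\<close>. The expressions for the brackets of $S$ and $T$ through $Y$ are a
  rearrangement. The Jacobi identities of the triples $SSS$, $TTT$, $SST$, $TTS$ form a linear system for the brackets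
  $[[S_x,T_y],S_z]$ and $[[S_x,T_y],T_z]$; its solution gives the reductivity conditions. By
  reductivity the Yamagutian acts as a derivation, which gives the brackets of Yamagutians, and the
  span of all $S_x$, $T_x$ and $Y(x;y)$ is closed under brackets. The dimension is bounded since $Y$ is alternating.

  For the multiplication group let $L$ be this span at the unit. Near the unit all $S_a(g)$ and
  $T_a(g)$ lie in $L$, because their components orthogonal to $L$ solve a homogeneous linear
  differential inequality along segments (\<open>SS_N_L\<close>). Hence the curves of operators over
  segments are tangent to the left invariant distribution spanned by $L$ (they are called
  horizontal), and $L$ is invariant under conjugation by the group $K$ which the operators near
  the unit generate. The velocities at the unit of horizontal curves in $K$ form a Lie algebra that
  contains the generators, hence contains $L$. Conversely, products of horizontal curves give a
  chart in which the distribution has a first integral \<open>\<omega>\<close> (\<open>first_integral\<close>), constant along horizontal curves.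
  Each element of $K$ is joined to an element of one fixed countable subset by a horizontal curve that
  stays close to it, so along any curve in $K$ through the unit the continuous function \<open>\<omega>\<close> takes
  only countably many values; it is constant and the velocity of the curve lies in $L$. A clopen
  argument identifies $K$ with the multiplication group of the component of the unit.
\<close>

section \<open>Commutators of matrices\<close>

lemma bilinear_matrix_mult:
  "bilinear ((**) :: 'k::{real_normed_field, euclidean_space}^'n^'n::finite \<Rightarrow> _)"
  unfolding bilinear_def
  by (auto intro!: linearI simp: vec_eq_iff matrix_matrix_mult_def scaleR_right.sum
        sum.distrib algebra_simps)

lemma bounded_bilinear_matrix_mult:
  "bounded_bilinear ((**) :: 'k::{real_normed_field, euclidean_space}^'n^'n::finite \<Rightarrow> _)"
  using bilinear_matrix_mult by (simp add: bilinear_conv_bounded_bilinear)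

lemmas mat_diff = bounded_bilinear.diff_left[OF bounded_bilinear_matrix_mult]
  bounded_bilinear.diff_right[OF bounded_bilinear_matrix_mult]
lemmas mat_add = bounded_bilinear.add_left[OF bounded_bilinear_matrix_mult]
  bounded_bilinear.add_right[OF bounded_bilinear_matrix_mult]
lemmas mat_minus = bounded_bilinear.minus_left[OF bounded_bilinear_matrix_mult]
  bounded_bilinear.minus_right[OF bounded_bilinear_matrix_mult]
lemmas mat_scaleR = bounded_bilinear.scaleR_left[OF bounded_bilinear_matrix_mult]
  bounded_bilinear.scaleR_right[OF bounded_bilinear_matrix_mult]
lemmas mat_zero = bounded_bilinear.zero_left[OF bounded_bilinear_matrix_mult]
  bounded_bilinear.zero_right[OF bounded_bilinear_matrix_mult]
lemmas mat_sum = bounded_bilinear.sum_left[OF bounded_bilinear_matrix_mult]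
  bounded_bilinear.sum_right[OF bounded_bilinear_matrix_mult]
lemmas mat_simps = mat_diff mat_add mat_minus mat_scaleR mat_zero matrix_mul_assoc

lemma bilinear_commutator:
  "bilinear (commutator :: 'k::{real_normed_field, euclidean_space}^'n^'n::finite \<Rightarrow> _)"
  unfolding bilinear_def commutator_def
  by (auto intro!: linearI simp: mat_simps algebra_simps)

lemma bounded_bilinear_commutator:
  "bounded_bilinear (commutator :: 'k::{real_normed_field, euclidean_space}^'n^'n::finite \<Rightarrow> _)"
  using bilinear_commutator by (simp add: bilinear_conv_bounded_bilinear)

lemmas comm_diff = bounded_bilinear.diff_left[OF bounded_bilinear_commutator]
  bounded_bilinear.diff_right[OF bounded_bilinear_commutator]
lemmas comm_add = bounded_bilinear.add_left[OF bounded_bilinear_commutator]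
  bounded_bilinear.add_right[OF bounded_bilinear_commutator]
lemmas comm_minus = bounded_bilinear.minus_left[OF bounded_bilinear_commutator]
  bounded_bilinear.minus_right[OF bounded_bilinear_commutator]
lemmas comm_scaleR = bounded_bilinear.scaleR_left[OF bounded_bilinear_commutator]
  bounded_bilinear.scaleR_right[OF bounded_bilinear_commutator]
lemmas comm_zero = bounded_bilinear.zero_left[OF bounded_bilinear_commutator]
  bounded_bilinear.zero_right[OF bounded_bilinear_commutator]
lemmas comm_simps = comm_diff comm_add comm_minus comm_scaleR comm_zero

lemma commutator_swap:
  fixes P Q :: "'k::{real_normed_field, euclidean_space}^'n^'n::finite"
  shows "commutator P Q = - commutator Q P"
  by (simp add: commutator_def)

lemma commutator_jacobi:
  fixes P Q R :: "'k::{real_normed_field, euclidean_space}^'n^'n::finite"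
  shows "commutator (commutator P Q) R + commutator (commutator Q R) P
    + commutator (commutator R P) Q = 0"
  by (simp add: commutator_def mat_simps)

lemma vec_eq_by_inner:
  fixes P Q :: "'a::real_inner"
  assumes "\<And>W. P \<bullet> W = Q \<bullet> W"
  shows "P = Q"
  using assms by (metis vector_eq_rdot)

text \<open>
  Closure of a span under brackets only has to be checked on spanning sets.
\<close>

lemma commutator_in_span:
  fixes X Y :: "('k::{real_normed_field, euclidean_space}^'n^'n::finite) set"
  assumes XY: "\<And>P Q. P \<in> X \<Longrightarrow> Q \<in> Y \<Longrightarrow> commutator P Q \<in> span Z"
    and "P \<in> span X" "Q \<in> span Y"
  shows "commutator P Q \<in> span Z"
proof -
  have 1: "commutator P Q \<in> span Z" if "P \<in> X" "Q \<in> span Y" for P Q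
    using that(2)
  proof (induction rule: span_induct_alt)
    case base
    then show ?case by (simp add: comm_simps span_zero)
  next
    case (step c x y)
    then show ?case using XY[OF that(1)] by (simp add: comm_simps span_add span_scale)
  qed
  show ?thesis
    using assms(2)
  proof (induction rule: span_induct_alt)
    case base
    then show ?case by (simp add: comm_simps span_zero)
  next
    case (step c x y)
    then show ?case using 1[OF _ assms(3)] by (simp add: comm_simps span_add span_scale)
  qed
qed

section \<open>Closure of the commutation relations\<close>

text \<open>
  The relations between derivative generators at a single point: \<open>s\<close> and \<open>t\<close> stand for
  $x \mapsto S_x(g)$ and $x \mapsto T_x(g)$, and \<open>br\<close> for $[\cdot,\cdot]_g$. All Jacobi identities
  used below are those of matrices.
\<close>

locale moufang_relations =
  fixes s t :: "'v::euclidean_space \<Rightarrow> 'k::{real_normed_field, euclidean_space}^'n^'n::finite"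
    and br :: "'v \<Rightarrow> 'v \<Rightarrow> 'v"
  assumes lin_s: "linear s" and lin_t: "linear t"
    and br_bilinear: "bilinear br"
    and br_swap: "br x y = - br y x"
    and mixed: "commutator (s x) (t y) = commutator (t x) (s y)"
    and integr_s: "commutator (s x) (s y) + 2 *\<^sub>R commutator (s x) (t y) = s (br x y)"
    and integr_t: "commutator (t x) (t y) + 2 *\<^sub>R commutator (s x) (t y) = - t (br x y)"
begin

definition yam :: "'v \<Rightarrow> 'v \<Rightarrow> 'k^'n^'n" where
  "yam x y = (1/3) *\<^sub>R (commutator (s x) (s y) + commutator (s x) (t y) + commutator (t x) (t y))"

definition ybr :: "'v \<Rightarrow> 'v \<Rightarrow> 'v \<Rightarrow> 'v" where
  "ybr x y z = br x (br y z) - br y (br x z) + br (br x y) z"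

lemma ss: "commutator (s x) (s y) = s (br x y) - 2 *\<^sub>R commutator (s x) (t y)"
  using integr_s[of x y] by (simp add: algebra_simps)

lemma tt: "commutator (t x) (t y) = - t (br x y) - 2 *\<^sub>R commutator (s x) (t y)"
  using integr_t[of x y] by (simp add: algebra_simps)

lemma yam_eq: "yam x y = (1/3) *\<^sub>R s (br x y) - (1/3) *\<^sub>R t (br x y) - commutator (s x) (t y)"
  unfolding yam_def ss tt by (simp add: algebra_simps scaleR_2)

lemma relation_ss:
  "commutator (s x) (s y) = 2 *\<^sub>R yam x y + (1/3) *\<^sub>R s (br x y) + (2/3) *\<^sub>R t (br x y)"
  by (rule vec_eq_by_inner) (simp add: ss yam_eq inner_simps algebra_simps)

lemma relation_st:
  "commutator (s x) (t y) = - yam x y + (1/3) *\<^sub>R s (br x y) - (1/3) *\<^sub>R t (br x y)"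
  by (rule vec_eq_by_inner) (simp add: yam_eq inner_simps algebra_simps)

lemma relation_tt:
  "commutator (t x) (t y) = 2 *\<^sub>R yam x y - (2/3) *\<^sub>R s (br x y) - (1/3) *\<^sub>R t (br x y)"
  by (rule vec_eq_by_inner) (simp add: tt yam_eq inner_simps algebra_simps)

text \<open>
  Written in this form the Yamaguti bracket is visibly $2[[x,y],z]$ minus the cyclic sum, which is how it
  comes out of the Jacobi identities.
\<close>

lemma ybr_cyclic: "ybr x y z = br (br x y) z - br (br y z) x - br (br z x) y"
proof -
  have "br x (br y z) = - br (br y z) x" by (rule br_swap)
  moreover have "br y (br x z) = br (br z x) y"
    by (metis br_bilinear br_swap bilinear_rneg)
  ultimately show ?thesis by (simp add: ybr_def)
qed

text \<open>
  The system below, solved in each matrix component: \<open>s1\<close>, \<open>t1\<close> stand for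
  $[[S_x,T_y],S_z]$, $[[S_x,T_y],T_z]$, \<open>b1\<close> for $[S_{[x,y]},T_z]$, the indices 2 and 3 for the cyclic
  permutations of $x,y,z$, and \<open>js\<close>, \<open>jt\<close> for $S$ and $T$ of the cyclic sum of $[[x,y],z]$.
\<close>

lemma solve_jacobi_system:
  fixes js jt b1 b2 b3 s1 s2 s3 t1 t2 t3 :: real
  assumes "js - 2 * (b1 + b2 + b3) - 2 * (s1 + s2 + s3) = 0"
    "jt + 2 * (b1 + b2 + b3) - 2 * (t1 + t2 + t3) = 0"
    "b1 - 2 * t1 + s2 + s3 = 0" "b2 - 2 * t2 + s3 + s1 = 0" "b3 - 2 * t3 + s1 + s2 = 0"
    "- b1 - 2 * s1 + t2 + t3 = 0" "- b2 - 2 * s2 + t3 + t1 = 0" "- b3 - 2 * s3 + t1 + t2 = 0"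
  shows "s1 = - b1 + 1/6 * js" "t1 = b1 + 1/6 * jt"
  using assms by argo+

context
  fixes x y z :: 'v
begin

private abbreviation "S1 \<equiv> commutator (commutator (s x) (t y)) (s z)"
private abbreviation "S2 \<equiv> commutator (commutator (s y) (t z)) (s x)"
private abbreviation "S3 \<equiv> commutator (commutator (s z) (t x)) (s y)"
private abbreviation "T1 \<equiv> commutator (commutator (s x) (t y)) (t z)"
private abbreviation "T2 \<equiv> commutator (commutator (s y) (t z)) (t x)"
private abbreviation "T3 \<equiv> commutator (commutator (s z) (t x)) (t y)"
private abbreviation "b1 \<equiv> commutator (s (br x y)) (t z)"
private abbreviation "b2 \<equiv> commutator (s (br y z)) (t x)"
private abbreviation "b3 \<equiv> commutator (s (br z x)) (t y)"
private abbreviation "j \<equiv> br (br x y) z + br (br y z) x + br (br z x) y"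

private lemma jac_sss: "s j - 2 *\<^sub>R (b1 + b2 + b3) - 2 *\<^sub>R (S1 + S2 + S3) = 0"
  using commutator_jacobi[of "s x" "s y" "s z"]
  by (simp add: ss comm_simps linear_add[OF lin_s] algebra_simps)

private lemma jac_ttt: "t j + 2 *\<^sub>R (b1 + b2 + b3) - 2 *\<^sub>R (T1 + T2 + T3) = 0"
  using commutator_jacobi[of "t x" "t y" "t z"]
  by (simp add: tt comm_simps linear_add[OF lin_t] algebra_simps)

private lemma jac_sst:
  "b1 - 2 *\<^sub>R T1 + S2 + S3 = 0" "b2 - 2 *\<^sub>R T2 + S3 + S1 = 0" "b3 - 2 *\<^sub>R T3 + S1 + S2 = 0"
  using commutator_jacobi[of "s x" "s y" "t z"] commutator_jacobi[of "s y" "s z" "t x"]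
    commutator_jacobi[of "s z" "s x" "t y"]
  by (simp_all add: ss mixed[symmetric] comm_simps algebra_simps)

private lemma jac_tts:
  "- b1 - 2 *\<^sub>R S1 + T2 + T3 = 0" "- b2 - 2 *\<^sub>R S2 + T3 + T1 = 0" "- b3 - 2 *\<^sub>R S3 + T1 + T2 = 0"
  using commutator_jacobi[of "t x" "t y" "s z"] commutator_jacobi[of "t y" "t z" "s x"]
    commutator_jacobi[of "t z" "t x" "s y"]
  by (simp_all add: tt mixed[symmetric] comm_simps algebra_simps)

private lemma inner_eqs:
  "s j \<bullet> W - 2 * (b1 \<bullet> W + b2 \<bullet> W + b3 \<bullet> W) - 2 * (S1 \<bullet> W + S2 \<bullet> W + S3 \<bullet> W) = 0"
  "t j \<bullet> W + 2 * (b1 \<bullet> W + b2 \<bullet> W + b3 \<bullet> W) - 2 * (T1 \<bullet> W + T2 \<bullet> W + T3 \<bullet> W) = 0"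
  "b1 \<bullet> W - 2 * (T1 \<bullet> W) + S2 \<bullet> W + S3 \<bullet> W = 0"
  "b2 \<bullet> W - 2 * (T2 \<bullet> W) + S3 \<bullet> W + S1 \<bullet> W = 0"
  "b3 \<bullet> W - 2 * (T3 \<bullet> W) + S1 \<bullet> W + S2 \<bullet> W = 0"
  "- (b1 \<bullet> W) - 2 * (S1 \<bullet> W) + T2 \<bullet> W + T3 \<bullet> W = 0"
  "- (b2 \<bullet> W) - 2 * (S2 \<bullet> W) + T3 \<bullet> W + T1 \<bullet> W = 0"
  "- (b3 \<bullet> W) - 2 * (S3 \<bullet> W) + T1 \<bullet> W + T2 \<bullet> W = 0"
  using jac_sss[THEN arg_cong, of "\<lambda>V. V \<bullet> W"] jac_ttt[THEN arg_cong, of "\<lambda>V. V \<bullet> W"]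
    jac_sst[THEN arg_cong, of "\<lambda>V. V \<bullet> W"] jac_tts[THEN arg_cong, of "\<lambda>V. V \<bullet> W"]
  by (simp_all only: inner_simps inner_scaleR_left inner_minus_left inner_zero_left)

lemma comm_mixed_s: "S1 = - b1 + (1/6) *\<^sub>R s j"
proof (rule vec_eq_by_inner)
  fix W
  show "S1 \<bullet> W = (- b1 + (1/6) *\<^sub>R s j) \<bullet> W"
    using solve_jacobi_system(1)[OF inner_eqs[of W]] unfolding inner_simps inner_minus_left .
qed

lemma comm_mixed_t: "T1 = b1 + (1/6) *\<^sub>R t j"
proof (rule vec_eq_by_inner)
  fix W
  show "T1 \<bullet> W = (b1 + (1/6) *\<^sub>R t j) \<bullet> W"
    using solve_jacobi_system(2)[OF inner_eqs[of W]] unfolding inner_simps inner_minus_left .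
qed

lemma reductivity_s: "6 *\<^sub>R commutator (yam x y) (s z) = s (ybr x y z)"
proof -
  have "commutator (t (br x y)) (s z) = b1" by (simp add: mixed)
  moreover have "6 *\<^sub>R commutator (yam x y) (s z) =
      2 *\<^sub>R commutator (s (br x y)) (s z) - 2 *\<^sub>R commutator (t (br x y)) (s z) - 6 *\<^sub>R S1"
    by (simp add: yam_eq comm_simps scaleR_diff_right)
  ultimately have "6 *\<^sub>R commutator (yam x y) (s z) = 2 *\<^sub>R s (br (br x y) z) - s j"
    unfolding comm_mixed_s ss[of "br x y"]
    by - (rule vec_eq_by_inner, simp add: inner_simps)
  then show ?thesis
    by (simp add: ybr_cyclic linear_add[OF lin_s] linear_diff[OF lin_s] scaleR_2)
qed

lemma reductivity_t: "6 *\<^sub>R commutator (yam x y) (t z) = t (ybr x y z)"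
proof -
  have "6 *\<^sub>R commutator (yam x y) (t z) =
      2 *\<^sub>R b1 - 2 *\<^sub>R commutator (t (br x y)) (t z) - 6 *\<^sub>R T1"
    by (simp add: yam_eq comm_simps scaleR_diff_right)
  then have "6 *\<^sub>R commutator (yam x y) (t z) = 2 *\<^sub>R t (br (br x y) z) - t j"
    unfolding comm_mixed_t tt[of "br x y"]
    by - (rule vec_eq_by_inner, simp add: inner_simps)
  then show ?thesis
    by (simp add: ybr_cyclic linear_add[OF lin_t] linear_diff[OF lin_t] scaleR_2)
qed

end

text \<open>
  A commutator with a fixed matrix is a derivation of the bracket, so reductivity on the factors of
  the three brackets that make up the Yamagutian carries over to it.
\<close>

lemma yam_derivation:
  "6 *\<^sub>R commutator (yam x y) (yam z w) = yam (ybr x y z) w + yam z (ybr x y w)"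
proof -
  let ?D = "\<lambda>P. 6 *\<^sub>R commutator (yam x y) P"
  have D: "?D (commutator P Q) = commutator (?D P) Q + commutator P (?D Q)" for P Q
    by (simp add: commutator_def mat_simps algebra_simps)
  have lin: "?D (P + Q) = ?D P + ?D Q" "?D (c *\<^sub>R P) = c *\<^sub>R ?D P" for P Q c
    by (simp_all add: comm_simps algebra_simps)
  have "?D (yam z w) = (1/3) *\<^sub>R (?D (commutator (s z) (s w)) + ?D (commutator (s z) (t w))
      + ?D (commutator (t z) (t w)))"
    unfolding yam_def[of z w] lin ..
  also have "\<dots> = yam (ybr x y z) w + yam z (ybr x y w)"
    unfolding D reductivity_s reductivity_t yam_def[of "ybr x y z"] yam_def[of z]
    by (simp add: algebra_simps)
  finally show ?thesis .
qed

definition lie :: "('k^'n^'n) set" where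
  "lie = span (range s \<union> range t \<union> {yam x y | x y. True})"

lemma lie_memI: "s x \<in> lie" "t x \<in> lie" "yam x y \<in> lie"
  unfolding lie_def by (auto intro: span_base)

lemma subspace_lie: "subspace lie"
  by (simp add: lie_def)

lemma lie_subalgebra_lie: "lie_subalgebra lie"
proof -
  note sub = subspace_add[OF subspace_lie] subspace_diff[OF subspace_lie]
    subspace_scale[OF subspace_lie] subspace_neg[OF subspace_lie] lie_memI
  have ys: "commutator (yam x y) (s z) \<in> lie" for x y z
  proof -
    have "commutator (yam x y) (s z) = (1/6) *\<^sub>R s (ybr x y z)"
      by (simp flip: reductivity_s)
    then show ?thesis by (simp add: sub)
  qed
  have yt: "commutator (yam x y) (t z) \<in> lie" for x y z
  proof -
    have "commutator (yam x y) (t z) = (1/6) *\<^sub>R t (ybr x y z)"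
      by (simp flip: reductivity_t)
    then show ?thesis by (simp add: sub)
  qed
  have yy: "commutator (yam x y) (yam z w) \<in> lie" for x y z w
  proof -
    have "commutator (yam x y) (yam z w) = (1/6) *\<^sub>R (yam (ybr x y z) w + yam z (ybr x y w))"
      by (simp flip: yam_derivation)
    then show ?thesis by (simp add: sub)
  qed
  have sy: "commutator (s z) (yam x y) \<in> lie" and ty: "commutator (t z) (yam x y) \<in> lie" for x y z
    using ys yt sub(4) commutator_swap by metis+
  have st: "commutator (s x) (t y) \<in> lie" for x y
    by (simp add: relation_st sub)
  have ss_st_ts_tt: "commutator (s x) (s y) \<in> lie" "commutator (s x) (t y) \<in> lie"
    "commutator (t x) (s y) \<in> lie" "commutator (t x) (t y) \<in> lie" for x y
    using st by (simp_all add: relation_ss relation_tt mixed[symmetric] sub)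
  have gen: "commutator P Q \<in> lie"
    if "P \<in> range s \<union> range t \<union> {yam x y | x y. True}"
      "Q \<in> range s \<union> range t \<union> {yam x y | x y. True}" for P Q
    using that
    by (auto simp: ys yt yy sy ty ss_st_ts_tt)
  then have "commutator P Q \<in> lie" if "P \<in> lie" "Q \<in> lie" for P Q
    unfolding lie_def
    by (rule commutator_in_span[OF _ that[unfolded lie_def]]) (use gen in \<open>simp add: lie_def\<close>)
  then show ?thesis
    unfolding lie_subalgebra_def using subspace_lie by blast
qed

text \<open>
  The Yamagutian is built from brackets of the generators, so the span is contained in every Lie
  algebra that contains them.
\<close>

lemma lie_hull:
  assumes "G = s ` Basis \<union> t ` Basis"
  shows "lie = lie_subalgebra hull G"
proof (rule hull_unique[symmetric])
  show "G \<subseteq> lie" using assms lie_memI by auto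
  show "lie_subalgebra lie" by (rule lie_subalgebra_lie)
  fix M :: "('k^'n^'n) set" assume M: "G \<subseteq> M" "lie_subalgebra M"
  then have sub: "subspace M" and com: "\<And>P Q. P \<in> M \<Longrightarrow> Q \<in> M \<Longrightarrow> commutator P Q \<in> M"
    by (auto simp: lie_subalgebra_def)
  have lin: "f x \<in> M" if "linear f" "f ` Basis \<subseteq> M" for f :: "'v \<Rightarrow> _" and x
  proof -
    have "f x = (\<Sum>b\<in>Basis. (x \<bullet> b) *\<^sub>R f b)"
      using linear_sum[OF that(1), of "\<lambda>b. (x \<bullet> b) *\<^sub>R b" Basis]
      by (simp add: euclidean_representation linear_scale[OF that(1)])
    then show ?thesis using that(2) sub by (auto intro!: subspace_sum subspace_scale)
  qed
  have "s x \<in> M" "t x \<in> M" for x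
    using lin[OF lin_s] lin[OF lin_t] M(1) assms by auto
  then have "range s \<union> range t \<union> {yam x y | x y. True} \<subseteq> M"
    using sub com unfolding yam_def by (auto intro!: subspace_scale subspace_add)
  then show "lie \<subseteq> M" unfolding lie_def using sub by (simp add: span_minimal)
qed

lemma yam_swap: "yam x y = - yam y x"
proof -
  have 1: "commutator (s y) (t x) = - commutator (s x) (t y)"
    using commutator_swap mixed by metis
  show ?thesis unfolding yam_eq 1 br_swap[of y x]
    by (simp add: linear_neg[OF lin_s] linear_neg[OF lin_t])
qed

lemma bilinear_yam: "bilinear yam"
  unfolding bilinear_def yam_def
  by (auto intro!: linearI simp: linear_add[OF lin_s] linear_add[OF lin_t] linear_scale[OF lin_s]
      linear_scale[OF lin_t] comm_simps algebra_simps)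

text \<open>
  Since \<open>yam\<close> is bilinear and skew-symmetric, its values are spanned by those on pairs of distinct
  basis vectors taken in one order.
\<close>

lemma dim_lie: "dim lie \<le> 2 * DIM('v) + DIM('v) * (DIM('v) - 1) div 2"
proof -
  let ?d = "DIM('v)"
  obtain f :: "nat \<Rightarrow> 'v" where f: "bij_betw f {..<?d} Basis"
    using ex_bij_betw_nat_finite[of "Basis :: 'v set"] by (auto simp: atLeast0LessThan)
  define J where "J = (SIGMA j:{..<?d}. {..<j})"
  have cardJ: "card J = ?d * (?d - 1) div 2"
  proof -
    have "card J = (\<Sum>j<?d. j)" by (simp add: J_def)
    also have "\<dots> = ?d * (?d - 1) div 2"
      by (simp add: Sum_Ico_nat flip: atLeast0LessThan)
    finally show ?thesis .
  qed
  define G where "G = s ` Basis \<union> t ` Basis \<union> (\<lambda>(j, i). yam (f i) (f j)) ` J"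
  have fin: "finite G" by (auto simp: G_def J_def)
  have rep: "h x \<in> span G" if "linear h" "\<And>b. b \<in> Basis \<Longrightarrow> h b \<in> span G" for h x
  proof -
    have "h x = (\<Sum>b\<in>Basis. (x \<bullet> b) *\<^sub>R h b)"
      using linear_sum[OF that(1), of "\<lambda>b. (x \<bullet> b) *\<^sub>R b" Basis]
      by (simp add: euclidean_representation linear_scale[OF that(1)])
    then show ?thesis using that(2) by (auto intro!: span_sum span_scale)
  qed
  have y: "yam b c \<in> span G" if bc: "b \<in> Basis" "c \<in> Basis" for b c
  proof -
    obtain i j where ij: "i < ?d" "j < ?d" "b = f i" "c = f j"
      using f bc by (auto simp: bij_betw_def image_iff) (metis bc imageE lessThan_iff)
    have G: "yam (f i) (f j) \<in> span G" if "i < j" "j < ?d" for i j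
      unfolding G_def using that by (intro span_base) (force simp: J_def)
    consider "i < j" | "i = j" | "j < i" by linarith
    then show ?thesis
    proof cases
      case 2
      have "yam b b + yam b b = 0" using yam_swap[of b b] by (metis add.right_inverse)
      then have "yam b b = 0" by (metis scaleR_2 scaleR_eq_0_iff zero_neq_numeral)
      then show ?thesis using 2 ij by (simp add: span_zero)
    next
      case 3
      then show ?thesis using G[of j i] ij yam_swap[of b c] by (simp add: span_neg)
    qed (use G ij in auto)
  qed
  have "yam x y \<in> span G" for x y
  proof -
    have "yam x b \<in> span G" if "b \<in> Basis" for b
      using rep[of "\<lambda>x. yam x b" x] y[OF _ that] bilinear_yam by (auto simp: bilinear_def)
    then show ?thesis using rep[of "yam x" y] bilinear_yam by (auto simp: bilinear_def)
  qed
  moreover have "s x \<in> span G" "t x \<in> span G" for x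
    by (rule rep[OF lin_s], simp add: G_def span_base) (rule rep[OF lin_t], simp add: G_def span_base)
  ultimately have "lie \<subseteq> span G"
    unfolding lie_def by (intro span_minimal) auto
  then have "dim lie \<le> card G" using fin by (rule dim_le_card)
  also have "card G \<le> card (s ` Basis) + card (t ` Basis) + card ((\<lambda>(j, i). yam (f i) (f j)) ` J)"
    unfolding G_def by (meson card_Un_le le_trans add_le_mono1)
  also have "\<dots> \<le> ?d + ?d + card J"
    by (intro add_mono card_image_le) (auto simp: J_def)
  finally show ?thesis using cardJ by simp
qed

end

section \<open>Inverse matrices\<close>

lemma matrix_inv_left: "invertible P \<Longrightarrow> matrix_inv P ** P = mat 1"
  and matrix_inv_right: "invertible P \<Longrightarrow> P ** matrix_inv P = mat 1"
  unfolding invertible_def matrix_inv_def by (metis (mono_tags, lifting) someI_ex)+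

lemma matrix_inv_eqI: "P ** Q = mat 1 \<Longrightarrow> Q ** P = mat 1 \<Longrightarrow> matrix_inv P = Q"
  by (metis invertible_def matrix_inv_left matrix_mul_assoc matrix_mul_lid matrix_mul_rid)

lemma invertible_matrix_inv: "invertible P \<Longrightarrow> invertible (matrix_inv P)"
  using matrix_inv_left matrix_inv_right invertible_def by blast

lemma matrix_inv_matrix_inv: "invertible P \<Longrightarrow> matrix_inv (matrix_inv P) = P"
  by (simp add: matrix_inv_eqI matrix_inv_left matrix_inv_right)

lemma matrix_inv_mult:
  assumes "invertible P" "invertible Q"
  shows "matrix_inv (P ** Q) = matrix_inv Q ** matrix_inv P"
proof (rule matrix_inv_eqI)
  show "P ** Q ** (matrix_inv Q ** matrix_inv P) = mat 1"
    by (metis assms matrix_inv_right matrix_mul_assoc matrix_mul_rid)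
  show "matrix_inv Q ** matrix_inv P ** (P ** Q) = mat 1"
    by (metis assms matrix_inv_left matrix_mul_assoc matrix_mul_lid)
qed

lemma matrix_inv_cancel:
  assumes "invertible P"
  shows "matrix_inv P ** (P ** Q) = Q" "P ** (matrix_inv P ** Q) = Q"
    "Q ** P ** matrix_inv P = Q" "Q ** matrix_inv P ** P = Q"
  by (simp_all add: matrix_mul_assoc assms matrix_inv_left matrix_inv_right)
    (simp_all add: assms matrix_inv_left matrix_inv_right flip: matrix_mul_assoc)

lemma matrix_mult_norm_bound:
  "\<exists>K>0. \<forall>(A :: 'k::{real_normed_field, euclidean_space}^'n^'n::finite) (B :: 'k^'n^'n).
    norm (A ** B) \<le> norm A * norm B * K"
  by (rule bounded_bilinear.pos_bounded[OF bounded_bilinear_matrix_mult])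

text \<open>
  Differentiation within the invertible matrices is enough for curves and families of invertible
  operators. The two-sided estimate comes from
  $Q^{-1} - P^{-1} = -Q^{-1}(Q-P)P^{-1}$, which also bounds $Q^{-1}$ near $P$.
\<close>

lemma has_derivative_matrix_inv:
  fixes P :: "'k::{real_normed_field, euclidean_space}^'n^'n::finite"
  assumes P: "invertible P"
  shows "(matrix_inv has_derivative (\<lambda>H. - (matrix_inv P ** H ** matrix_inv P)))
    (at P within {Q. invertible Q})"
proof -
  obtain K where K: "K > 0" "\<And>(A :: 'k^'n^'n) (B :: 'k^'n^'n). norm (A ** B) \<le> norm A * norm B * K"
    using matrix_mult_norm_bound by metis
  define R where "R = matrix_inv P"
  have K2: "norm (A ** B ** C) \<le> norm A * norm B * norm C * K^2" for A B C :: "'k^'n^'n"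
  proof -
    have "norm (A ** B ** C) \<le> norm (A ** B) * norm C * K" by (rule K(2))
    also have "\<dots> \<le> (norm A * norm B * K) * norm C * K"
      using K by (intro mult_right_mono) auto
    finally show ?thesis by (simp add: power2_eq_square mult_ac)
  qed
  \<comment> \<open>within this distance of \<open>P\<close> the identity \<open>diff\<close> gives $|Q^{-1}| \le |R| + |Q^{-1}|/2$\<close>
  define e where "e = 1 / (2 * (norm R * K^2 + 1))"
  have e: "e > 0" using K by (simp add: e_def add_nonneg_pos)
  have diff: "matrix_inv Q - R = - (matrix_inv Q ** (Q - P) ** R)" if "invertible Q" for Q
  proof -
    have "matrix_inv Q ** (Q - P) ** R = R - matrix_inv Q"
      using that P by (simp add: mat_simps matrix_inv_left R_def)
        (simp add: matrix_inv_right flip: matrix_mul_assoc)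
    then show ?thesis by simp
  qed
  have bound: "norm (matrix_inv Q) \<le> 2 * norm R" if Q: "invertible Q" "norm (Q - P) < e" for Q
  proof -
    have "norm (matrix_inv Q) \<le> norm R + norm (matrix_inv Q - R)"
      by (metis add.commute norm_triangle_sub)
    also have "norm (matrix_inv Q - R) \<le> norm (matrix_inv Q) * norm (Q - P) * norm R * K^2"
      unfolding diff[OF Q(1)] norm_minus_cancel by (rule K2)
    also have "\<dots> = norm (matrix_inv Q) * (norm (Q - P) * (norm R * K^2))"
      by simp
    also have "\<dots> \<le> norm (matrix_inv Q) * (1/2)"
    proof (rule mult_left_mono)
      have "norm (Q - P) * (norm R * K^2) \<le> e * (norm R * K^2 + 1)"
        using Q(2) K e by (intro mult_mono) auto
      also have "\<dots> = 1/2"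
      proof -
        have "norm R * K^2 + 1 > 0" using K by (simp add: add_nonneg_pos)
        then show ?thesis by (simp add: e_def)
      qed
      finally show "norm (Q - P) * (norm R * K^2) \<le> 1/2" .
    qed simp
    finally show ?thesis by simp
  qed
  define C where "C = 2 * norm R * norm R * norm R * K^2 * K^2"
  show ?thesis
    unfolding R_def[symmetric]
  proof (rule has_derivativeI_sandwich[of e])
    show "bounded_linear (\<lambda>H. - (R ** H ** R))"
      by (intro bounded_linear_minus bounded_linear_compose[OF
            bounded_bilinear.bounded_linear_left[OF bounded_bilinear_matrix_mult]
            bounded_bilinear.bounded_linear_right[OF bounded_bilinear_matrix_mult]])
    show "((\<lambda>Q. C * norm (Q - P)) \<longlongrightarrow> 0) (at P within {Q. invertible Q})"
      by (rule tendsto_eq_rhs, (rule tendsto_intros)+) simp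
    fix Q assume Q: "Q \<in> {Q. invertible Q}" "Q \<noteq> P" "dist Q P < e"
    have inv: "invertible Q" and d: "norm (Q - P) < e" using Q by (auto simp: dist_norm)
    have "matrix_inv Q - R - - (R ** (Q - P) ** R) = matrix_inv Q ** (Q - P) ** (R ** (Q - P) ** R)"
    proof -
      have "matrix_inv Q - R + R ** (Q - P) ** R = (R - matrix_inv Q) ** (Q - P) ** R"
        by (simp add: diff[OF inv] mat_simps)
      also have "R - matrix_inv Q = matrix_inv Q ** (Q - P) ** R"
        using diff[OF inv] by (simp add: algebra_simps)
      finally show ?thesis by (simp add: matrix_mul_assoc)
    qed
    also have "norm \<dots> \<le> norm (matrix_inv Q) * norm (Q - P) * norm (R ** (Q - P) ** R) * K^2"
      by (rule K2)
    also have "\<dots> \<le> (2 * norm R) * norm (Q - P) * (norm R * norm (Q - P) * norm R * K^2) * K^2"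
      by (intro mult_right_mono mult_mono K2 bound inv d) (auto intro: mult_nonneg_nonneg)
    also have "\<dots> = C * norm (Q - P) * norm (Q - P)"
      by (simp add: C_def)
    finally show "norm (matrix_inv Q - matrix_inv P - - (R ** (Q - P) ** R)) / norm (Q - P)
        \<le> C * norm (Q - P)"
      using Q(2) by (simp add: divide_le_eq R_def)
  qed (use e P in auto)
qed

lemma has_vector_derivative_matrix_inv:
  fixes P :: "real \<Rightarrow> 'k::{real_normed_field, euclidean_space}^'n^'n::finite"
  assumes "(P has_vector_derivative P') (at t within I)" "\<And>t. t \<in> I \<Longrightarrow> invertible (P t)" "t \<in> I"
  shows "((\<lambda>t. matrix_inv (P t)) has_vector_derivative - (matrix_inv (P t) ** P' ** matrix_inv (P t)))
    (at t within I)"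
proof -
  have "((\<lambda>t. matrix_inv (P t)) has_derivative
      (\<lambda>h. - (matrix_inv (P t) ** (h *\<^sub>R P') ** matrix_inv (P t)))) (at t within I)"
    using assms
    by (intro has_derivative_in_compose2[where t = "{Q. invertible Q}" and f = P and g = matrix_inv
        and g' = "\<lambda>P H. - (matrix_inv P ** H ** matrix_inv P)"] has_derivative_matrix_inv)
      (auto simp: has_vector_derivative_def)
  then show ?thesis by (simp add: has_vector_derivative_def mat_scaleR)
qed

lemmas has_vector_derivative_matrix_mult =
  bounded_bilinear.has_vector_derivative[OF bounded_bilinear_matrix_mult]

lemma continuous_on_matrix_inv:
  fixes P :: "'a::topological_space \<Rightarrow> 'k::{real_normed_field, euclidean_space}^'n^'n::finite"
  assumes "continuous_on I P" "\<And>t. t \<in> I \<Longrightarrow> invertible (P t)"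
  shows "continuous_on I (\<lambda>t. matrix_inv (P t))"
proof -
  have "continuous (at Q within {Q. invertible Q}) matrix_inv" if "invertible Q" for Q :: "'k^'n^'n"
    by (rule has_derivative_continuous[OF has_derivative_matrix_inv[OF that]])
  then have "continuous_on {Q :: 'k^'n^'n. invertible Q} matrix_inv"
    by (simp add: continuous_on_eq_continuous_within)
  then show ?thesis
    by (rule continuous_on_compose2[OF _ assms(1)]) (use assms(2) in auto)
qed

lemmas continuous_on_matrix_mult [continuous_intros] =
  bounded_bilinear.continuous_on[OF bounded_bilinear_matrix_mult]

section \<open>Power series at their centre\<close>

lemma has_sum_finite_sum:
  fixes f :: "'i \<Rightarrow> 'j \<Rightarrow> 'b::real_normed_vector"
  assumes "\<And>j. j \<in> A \<Longrightarrow> ((\<lambda>i. f i j) has_sum g j) I"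
  shows "((\<lambda>i. \<Sum>j\<in>A. f i j) has_sum (\<Sum>j\<in>A. g j)) I"
  using assms by (induction A rule: infinite_finite_induct) (auto intro: has_sum_add)

lemma summable_on_finite_sum:
  fixes f :: "'i \<Rightarrow> 'j \<Rightarrow> 'b::real_normed_vector"
  assumes "\<And>j. j \<in> A \<Longrightarrow> (\<lambda>i. f i j) summable_on I"
  shows "(\<lambda>i. \<Sum>j\<in>A. f i j) summable_on I"
  using assms by (induction A rule: infinite_finite_induct) (auto intro: summable_on_add)

lemma has_sum_minus:
  fixes f :: "'i \<Rightarrow> 'b::real_normed_vector"
  assumes "(f has_sum a) I" "(g has_sum b) I"
  shows "((\<lambda>i. f i - g i) has_sum a - b) I"
  using has_sum_add[OF assms(1) has_sum_bounded_linear[OF bounded_linear_minus[OF bounded_linear_ident] assms(2)]]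
  by simp

text \<open>
  At its centre a power series is differentiable by a quadratic estimate of the terms of order at least two, so
  termwise differentiation on a whole neighbourhood is avoided. The terms are indexed by an
  arbitrary set with a monomial attached to each index: this lets one apply the lemma to a series in
  which some of the variables have been absorbed into the coefficients.
\<close>

lemma has_derivative_power_series_centre:
  fixes c :: "'i \<Rightarrow> 'b::euclidean_space" and \<alpha> :: "'i \<Rightarrow> 'a::euclidean_space \<Rightarrow> nat"
  assumes "\<epsilon> > 0"
    and series: "\<And>h. norm h < \<epsilon> \<Longrightarrow> ((\<lambda>i. (\<Prod>b\<in>Basis. (h \<bullet> b) ^ \<alpha> i b) *\<^sub>R c i) has_sum f h) I"
  defines "J \<equiv> \<lambda>b. {i \<in> I. \<forall>b'\<in>Basis. \<alpha> i b' = (if b' = b then 1 else 0)}"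
  shows "b \<in> Basis \<Longrightarrow> c summable_on J b"
    and "(f has_derivative (\<lambda>h. \<Sum>b\<in>Basis. (h \<bullet> b) *\<^sub>R infsum c (J b))) (at 0)"
proof -
  define n where "n = (\<lambda>i. \<Sum>b\<in>Basis. \<alpha> i b)"
  define mon where "mon = (\<lambda>h i. \<Prod>b\<in>Basis. (h \<bullet> b) ^ \<alpha> i b)"
  define \<delta> where "\<delta> = \<epsilon> / (2 * DIM('a))"
  have \<delta>: "\<delta> > 0" using \<open>\<epsilon> > 0\<close> by (simp add: \<delta>_def)
  have "\<delta> \<le> \<epsilon> / 2" using \<open>\<epsilon> > 0\<close> by (auto simp: \<delta>_def field_simps)
  then have \<delta>\<epsilon>: "\<delta> < \<epsilon>" using \<open>\<epsilon> > 0\<close> by simp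
  \<comment> \<open>a point with all coordinates equal to \<open>\<delta>\<close>: every monomial of degree $n$ takes the
    value $\delta^n$ there, and dominates the same monomial on the ball of radius \<open>\<delta>\<close>\<close>
  define h0 :: 'a where "h0 = (\<Sum>b\<in>Basis. \<delta> *\<^sub>R b)"
  have "norm h0 \<le> (\<Sum>b\<in>(Basis::'a set). norm (\<delta> *\<^sub>R b))" unfolding h0_def by (rule norm_sum)
  also have "\<dots> = \<epsilon> / 2" using \<open>\<epsilon> > 0\<close> by (simp add: \<delta>_def)
  finally have h0: "norm h0 < \<epsilon>" using \<open>\<epsilon> > 0\<close> by simp
  have mon_h0: "mon h0 i = \<delta> ^ n i" for i
    by (simp add: mon_def n_def h0_def power_sum)
  have sumble: "(\<lambda>i. \<delta> ^ n i *\<^sub>R c i) summable_on I"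
    using series[OF h0] mon_h0 by (auto simp: mon_def summable_on_def)
  have abs1: "(\<lambda>i. norm (\<delta> ^ n i *\<^sub>R c i)) summable_on I"
  proof -
    have "(\<lambda>i. \<Sum>b\<in>Basis. norm ((\<delta> ^ n i *\<^sub>R c i) \<bullet> b)) summable_on I"
    proof (rule summable_on_finite_sum)
      fix b :: 'b
      have "(\<lambda>i. (\<delta> ^ n i *\<^sub>R c i) \<bullet> b) summable_on I"
        using sumble by (rule summable_on_bounded_linear[OF bounded_linear_inner_left])
      then show "(\<lambda>i. norm ((\<delta> ^ n i *\<^sub>R c i) \<bullet> b)) summable_on I"
        by (rule summable_on_iff_abs_summable_on_real[THEN iffD1])
    qed
    then show ?thesis
      by (rule summable_on_comparison_test) (auto simp: norm_le_l1 simp del: inner_scaleR_left norm_scaleR)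
  qed
  define M where "M = infsum (\<lambda>i. norm (\<delta> ^ n i *\<^sub>R c i)) I"
  have Jn: "n i = 1" if "i \<in> J b" "b \<in> Basis" for i b
    using that by (auto simp: J_def n_def)
  have sJ: "c summable_on J b" if b: "b \<in> Basis" for b
  proof -
    have "(\<lambda>i. \<delta> ^ n i *\<^sub>R c i) summable_on J b"
      using sumble by (rule summable_on_subset_banach) (auto simp: J_def)
    then have "(\<lambda>i. (1/\<delta>) *\<^sub>R (\<delta> ^ n i *\<^sub>R c i)) summable_on J b"
      by (rule summable_on_bounded_linear[OF bounded_linear_scaleR_right])
    then show ?thesis
      by (rule summable_on_cong[THEN iffD1, rotated]) (use \<delta> Jn[OF _ b] in auto)
  qed
  then show "b \<in> Basis \<Longrightarrow> c summable_on J b" .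
  have mon0: "mon 0 i = (if n i = 0 then 1 else 0)" for i
    by (auto simp: mon_def n_def intro!: prod_zero)
  have mon_le: "\<bar>mon h i\<bar> \<le> norm h ^ n i" for h i
  proof -
    have "\<bar>mon h i\<bar> = (\<Prod>b\<in>Basis. \<bar>h \<bullet> b\<bar> ^ \<alpha> i b)"
      by (simp add: mon_def abs_prod power_abs)
    also have "\<dots> \<le> (\<Prod>b\<in>Basis. norm h ^ \<alpha> i b)"
      by (intro prod_mono conjI power_mono Basis_le_norm) auto
    finally show ?thesis by (simp add: n_def power_sum)
  qed
  have lin_part: "(\<Sum>b\<in>Basis. (h \<bullet> b) * (if i \<in> J b then 1 else 0)) = (if n i = 1 then mon h i else 0)"
    if i: "i \<in> I" for h i
  proof (cases "n i = 1")
    case True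
    then have "\<exists>b\<in>Basis. \<alpha> i b = 1 \<and> (\<forall>b'\<in>Basis. b \<noteq> b' \<longrightarrow> \<alpha> i b' = 0)"
      using sum_eq_1_iff[of Basis "\<alpha> i"] by (simp add: n_def)
    then obtain b where b: "b \<in> Basis" "\<alpha> i b = 1" "\<And>b'. b' \<in> Basis \<Longrightarrow> b' \<noteq> b \<Longrightarrow> \<alpha> i b' = 0"
      by metis
    have Jb: "i \<in> J b' \<longleftrightarrow> b' = b" if "b' \<in> Basis" for b'
      using b that i by (auto simp: J_def)
    have "mon h i = (\<Prod>b'\<in>Basis. if b' = b then h \<bullet> b else 1)"
      unfolding mon_def by (rule prod.cong) (use b in auto)
    also have "\<dots> = h \<bullet> b" using b(1) by simp
    finally have "mon h i = h \<bullet> b" .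
    moreover have "(\<Sum>b\<in>Basis. (h \<bullet> b) * (if i \<in> J b then 1 else 0)) = (\<Sum>b'\<in>Basis. if b' = b then h \<bullet> b else 0)"
      by (rule sum.cong) (use Jb in auto)
    ultimately show ?thesis using True b(1) by simp
  next
    case False
    then have "(\<Sum>b\<in>Basis. (h \<bullet> b) * (if i \<in> J b then 1 else 0)) = 0"
      using Jn by (intro sum.neutral) auto
    then show ?thesis using False by simp
  qed
  define D where "D = (\<lambda>h::'a. \<Sum>b\<in>Basis. (h \<bullet> b) *\<^sub>R infsum c (J b))"
  have D: "((\<lambda>i. (if n i = 1 then mon h i else 0) *\<^sub>R c i) has_sum D h) I" for h
  proof -
    have "((\<lambda>i. \<Sum>b\<in>Basis. (h \<bullet> b) *\<^sub>R (if i \<in> J b then c i else 0)) has_sum D h) I"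
      unfolding D_def
    proof (rule has_sum_finite_sum)
      fix b :: 'a assume "b \<in> Basis"
      then have hs: "(c has_sum infsum c (J b)) (J b)" using sJ by simp
      have "J b \<subseteq> I" by (auto simp: J_def)
      then have "((\<lambda>i. if i \<in> J b then c i else 0) has_sum infsum c (J b)) I"
        by (intro has_sum_cong_neutral[THEN iffD1, OF _ _ _ hs]) auto
      then show "((\<lambda>i. (h \<bullet> b) *\<^sub>R (if i \<in> J b then c i else 0)) has_sum (h \<bullet> b) *\<^sub>R infsum c (J b)) I"
        by (rule has_sum_bounded_linear[OF bounded_linear_scaleR_right])
    qed
    then show ?thesis
    proof (rule has_sum_cong[THEN iffD1, rotated])
      fix i assume "i \<in> I"
      have "(\<Sum>b\<in>Basis. (h \<bullet> b) *\<^sub>R (if i \<in> J b then c i else 0))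
          = (\<Sum>b\<in>Basis. (h \<bullet> b) * (if i \<in> J b then 1 else 0)) *\<^sub>R c i"
        unfolding scaleR_sum_left by (rule sum.cong) auto
      then show "(\<Sum>b\<in>Basis. (h \<bullet> b) *\<^sub>R (if i \<in> J b then c i else 0))
          = (if n i = 1 then mon h i else 0) *\<^sub>R c i"
        using lin_part[OF \<open>i \<in> I\<close>] by simp
    qed
  qed
  have rest: "norm (f h - f 0 - D h) \<le> M / \<delta>^2 * norm h * norm h" if h: "norm h < \<delta>" for h
  proof -
    have 1: "((\<lambda>i. mon h i *\<^sub>R c i - mon 0 i *\<^sub>R c i - (if n i = 1 then mon h i else 0) *\<^sub>R c i)
        has_sum f h - f 0 - D h) I"
      using h \<delta>\<epsilon> \<open>\<epsilon> > 0\<close> unfolding mon_def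
      by (intro has_sum_minus series D[unfolded mon_def]) auto
    have 2: "((\<lambda>i. (norm h / \<delta>)^2 * norm (\<delta> ^ n i *\<^sub>R c i)) has_sum (norm h / \<delta>)^2 * M) I"
      using abs1 unfolding M_def by (intro has_sum_cmult_right has_sum_infsum)
    have "norm (f h - f 0 - D h) \<le> (norm h / \<delta>)^2 * M"
    proof (rule norm_infsum_le[OF 1 2])
      fix i assume "i \<in> I"
      consider "n i = 0" | "n i = 1" | "n i \<ge> 2" by linarith
      then show "norm (mon h i *\<^sub>R c i - mon 0 i *\<^sub>R c i - (if n i = 1 then mon h i else 0) *\<^sub>R c i)
          \<le> (norm h / \<delta>)^2 * norm (\<delta> ^ n i *\<^sub>R c i)"
      proof cases
        case 1
        then have "mon h i = 1" by (simp add: mon_def n_def)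
        then show ?thesis using 1 by (simp add: mon0)
      next
        case 2
        then show ?thesis by (simp add: mon0)
      next
        case 3
        have "\<bar>mon h i\<bar> \<le> norm h ^ n i" by (rule mon_le)
        also have "\<dots> = (norm h / \<delta>) ^ n i * \<delta> ^ n i"
          using \<delta> by (simp add: power_divide)
        also have "(norm h / \<delta>) ^ n i \<le> (norm h / \<delta>)^2"
          using 3 h \<delta> by (intro power_decreasing) auto
        finally have "\<bar>mon h i\<bar> \<le> (norm h / \<delta>)^2 * \<delta> ^ n i"
          using \<delta> by simp
        then have "\<bar>mon h i\<bar> * norm (c i) \<le> (norm h / \<delta>)^2 * \<delta> ^ n i * norm (c i)"
          by (rule mult_right_mono) simp
        then show ?thesis using 3 \<delta> by (simp add: mon0)
      qed
    qed
    then show ?thesis by (simp add: power_divide power2_eq_square mult_ac)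
  qed
  show "(f has_derivative (\<lambda>h. \<Sum>b\<in>Basis. (h \<bullet> b) *\<^sub>R infsum c (J b))) (at 0)"
    unfolding D_def[symmetric]
  proof (rule has_derivativeI_sandwich[of \<delta>])
    show "bounded_linear D" unfolding D_def
      by (intro bounded_linear_sum bounded_linear_scaleR_const bounded_linear_inner_left)
    show "((\<lambda>h. M / \<delta>^2 * norm h) \<longlongrightarrow> 0) (at (0::'a))"
      by (rule tendsto_eq_rhs, (rule tendsto_intros)+) simp
    show "norm (f h - f 0 - D (h - 0)) / norm (h - 0) \<le> M / \<delta>^2 * norm h"
      if "h \<noteq> 0" "dist h 0 < \<delta>" for h
      using rest[of h] that by (simp add: divide_le_eq)
  qed (use \<delta> in auto)
qed

lemma has_vector_derivative_line:
  assumes "(f has_derivative D) (at (p + \<sigma> *\<^sub>R \<xi>))"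
  shows "((\<lambda>\<sigma>. f (p + \<sigma> *\<^sub>R \<xi>)) has_vector_derivative D \<xi>) (at \<sigma> within I)"
proof -
  have "((\<lambda>\<sigma>. p + \<sigma> *\<^sub>R \<xi>) has_vector_derivative \<xi>) (at \<sigma> within I)"
    by (auto intro!: derivative_eq_intros)
  then show ?thesis
    using vector_derivative_diff_chain_within[of "\<lambda>\<sigma>. p + \<sigma> *\<^sub>R \<xi>" \<xi> \<sigma> I f D] assms
    by (simp add: o_def has_derivative_at_withinI)
qed

text \<open>
  The derivative in the second variable at its centre only sees the terms of degree one in that
  variable; they form a power series in the first variable. For the multiplication of a loop this
  gives the auxiliary functions and their differentiability.
\<close>

lemma mixed_derivative_power_series:
  fixes a :: "('a::euclidean_space \<times> 'c::euclidean_space \<Rightarrow> nat) \<Rightarrow> 'b::euclidean_space"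
  assumes "\<epsilon> > 0" and e: "e \<in> Basis"
    and series: "\<And>h. norm h < \<epsilon> \<Longrightarrow>
      ((\<lambda>\<alpha>. (\<Prod>b\<in>Basis. (h \<bullet> b) ^ \<alpha> b) *\<^sub>R a \<alpha>) has_sum F h) (Basis \<rightarrow>\<^sub>E (UNIV :: nat set))"
  obtains W where
    "\<And>s. norm s < \<epsilon>/2 \<Longrightarrow> ((\<lambda>t. F (s, t *\<^sub>R e)) has_vector_derivative W s) (at 0)"
    "W differentiable (at 0)"
proof -
  define I where "I = (Basis :: ('a \<times> 'c) set) \<rightarrow>\<^sub>E (UNIV :: nat set)"
  define mon where "mon = (\<lambda>s (\<alpha> :: 'a \<times> 'c \<Rightarrow> nat). \<Prod>u\<in>Basis. (s \<bullet> u) ^ \<alpha> (u, 0))"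
  \<comment> \<open>the monomials that survive at the points \<open>(s, t *\<^sub>R e)\<close>\<close>
  define z where "z = (\<lambda>\<alpha> :: 'a \<times> 'c \<Rightarrow> nat. \<forall>v\<in>Basis - {e}. \<alpha> (0, v) = 0)"
  define \<kappa> where "\<kappa> = (\<lambda>s \<alpha>. (if z \<alpha> then mon s \<alpha> else 0) *\<^sub>R a \<alpha>)"
  define J1 where "J1 = {\<alpha> \<in> I. \<alpha> (0, e) = 1}"
  define J2 where "J2 = {\<alpha> \<in> J1. z \<alpha>}"
  define W where "W = (\<lambda>s. infsum (\<kappa> s) J1)"
  have split: "(\<Prod>b\<in>Basis. ((s, t *\<^sub>R e) \<bullet> b) ^ \<alpha> b) = t ^ \<alpha> (0, e) * (if z \<alpha> then mon s \<alpha> else 0)"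
    for s :: 'a and t \<alpha>
  proof -
    have "(\<Prod>b\<in>Basis. ((s, t *\<^sub>R e) \<bullet> b) ^ \<alpha> b)
        = (\<Prod>b\<in>(\<lambda>u. (u, 0)) ` Basis. ((s, t *\<^sub>R e) \<bullet> b) ^ \<alpha> b) * (\<Prod>b\<in>(\<lambda>v. (0, v)) ` Basis. ((s, t *\<^sub>R e) \<bullet> b) ^ \<alpha> b)"
      unfolding Basis_prod_def by (rule prod.union_disjoint) auto
    also have "(\<Prod>b\<in>(\<lambda>u. (u, 0)) ` Basis. ((s, t *\<^sub>R e) \<bullet> b) ^ \<alpha> b) = mon s \<alpha>"
      unfolding mon_def by (subst prod.reindex) (auto simp: inj_on_def)
    also have "(\<Prod>b\<in>(\<lambda>v. (0, v)) ` Basis. ((s, t *\<^sub>R e) \<bullet> b) ^ \<alpha> b)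
        = (\<Prod>v\<in>Basis. (t * (e \<bullet> v)) ^ \<alpha> (0, v))"
      by (subst prod.reindex) (auto simp: inj_on_def)
    also have "\<dots> = (t * (e \<bullet> e)) ^ \<alpha> (0, e) * (\<Prod>v\<in>Basis - {e}. (t * (e \<bullet> v)) ^ \<alpha> (0, v))"
      by (rule prod.remove) (use e in auto)
    also have "(\<Prod>v\<in>Basis - {e}. (t * (e \<bullet> v)) ^ \<alpha> (0, v)) = (\<Prod>v\<in>Basis - {e}. if \<alpha> (0, v) = 0 then 1 else 0)"
      by (rule prod.cong) (use e in \<open>auto simp: inner_Basis\<close>)
    also have "\<dots> = (if z \<alpha> then 1 else 0)"
      by (auto simp: z_def intro!: prod.neutral prod_zero)
    finally show ?thesis using e by (simp add: inner_Basis)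
  qed
  have ser: "((\<lambda>\<alpha>. (\<Prod>b\<in>Basis. (t \<bullet> b) ^ \<alpha> (0, e)) *\<^sub>R \<kappa> s \<alpha>) has_sum F (s, t *\<^sub>R e)) I"
    if "norm s < \<epsilon>/2" "norm t < \<epsilon>/2" for s t
  proof -
    have "norm (s, t *\<^sub>R e) \<le> norm s + norm (t *\<^sub>R e)"
      using norm_triangle_ineq[of "(s, 0)" "(0, t *\<^sub>R e)"] by simp
    then have "norm (s, t *\<^sub>R e) < \<epsilon>" using that e by simp
    from series[OF this] show ?thesis
      unfolding split \<kappa>_def I_def by simp
  qed
  have J1: "J1 = {\<alpha> \<in> I. \<forall>b'\<in>(Basis::real set). \<alpha> (0, e) = (if b' = 1 then 1 else 0)}"
    by (auto simp: J1_def)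
  have W: "((\<lambda>t. F (s, t *\<^sub>R e)) has_vector_derivative W s) (at 0)"
    and sum: "\<kappa> s summable_on J1" if s: "norm s < \<epsilon>/2" for s
  proof -
    have "\<epsilon>/2 > 0" using \<open>\<epsilon> > 0\<close> by simp
    note * = has_derivative_power_series_centre[OF this ser[OF s]]
    show "((\<lambda>t. F (s, t *\<^sub>R e)) has_vector_derivative W s) (at 0)"
      using *(2) by (simp add: has_vector_derivative_def W_def J1)
    show "\<kappa> s summable_on J1"
      using *(1)[of 1] by (simp add: J1)
  qed
  have "((\<lambda>\<alpha>. (\<Prod>u\<in>Basis. (s \<bullet> u) ^ (\<lambda>u. \<alpha> (u, 0)) u) *\<^sub>R a \<alpha>) has_sum W s) J2" if "norm s < \<epsilon>/2" for s
  proof -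
    have "(\<kappa> s has_sum W s) J1" using sum[OF that] by (simp add: W_def)
    then show ?thesis
      by (rule has_sum_cong_neutral[THEN iffD1, rotated -1]) (auto simp: J2_def \<kappa>_def mon_def)
  qed
  note W_series = this
  have "\<epsilon>/2 > 0" using \<open>\<epsilon> > 0\<close> by simp
  then have "W differentiable (at 0)"
    by (rule differentiableI[OF has_derivative_power_series_centre(2)[OF _ W_series]])
  with W show ?thesis by (rule that)
qed

lemma real_analytic_on_differentiable:
  fixes f :: "'a::euclidean_space \<Rightarrow> 'b::euclidean_space"
  assumes "real_analytic_on f X" "p \<in> X"
  shows "f differentiable (at p)"
proof -
  obtain a :: "('a \<Rightarrow> nat) \<Rightarrow> 'b" and \<epsilon> where \<epsilon>: "\<epsilon> > 0" and
    ser: "\<And>h. norm h < \<epsilon> \<Longrightarrow> ((\<lambda>\<alpha>. (\<Prod>b\<in>Basis. (h \<bullet> b) ^ \<alpha> b) *\<^sub>R a \<alpha>) has_sum f (p + h))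
          (Basis \<rightarrow>\<^sub>E (UNIV :: nat set))"
    using assms unfolding real_analytic_on_def by blast
  have "(\<lambda>h. f (p + h)) differentiable (at 0)"
    by (rule differentiableI[OF has_derivative_power_series_centre(2)[OF \<epsilon> ser]])
  then obtain D where D: "((\<lambda>h. f (p + h)) has_derivative D) (at 0)"
    by (auto simp: differentiable_def)
  have "(f has_derivative D) (at p)"
  proof -
    have "((\<lambda>x. x - p) has_derivative (\<lambda>h. h)) (at p)" by (auto intro!: derivative_eq_intros)
    from has_derivative_compose[OF this, of "\<lambda>h. f (p + h)" D] D show ?thesis by simp
  qed
  then show ?thesis by (auto simp: differentiable_def)
qed

section \<open>Symmetry of second derivatives\<close>

text \<open>
  The mean value theorem, applied first in direction \<open>\<xi>\<close> and then in direction \<open>\<eta>\<close>. The left side is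
  symmetric in the two directions, which gives the symmetry of the second derivative.
\<close>

lemma second_difference:
  fixes f :: "'a::real_normed_vector \<Rightarrow> 'b::real_inner"
  assumes f': "\<And>p. p \<in> X \<Longrightarrow> (f has_derivative f' p) (at p)"
    and A: "\<And>p. p \<in> X \<Longrightarrow> ((\<lambda>p. f' p \<xi>) has_derivative A p) (at p)"
    and "h > 0" and X: "\<And>\<sigma> \<tau>. \<sigma> \<in> {0..h} \<Longrightarrow> \<tau> \<in> {0..h} \<Longrightarrow> x + \<sigma> *\<^sub>R \<xi> + \<tau> *\<^sub>R \<eta> \<in> X"
  obtains \<sigma> \<tau> where "\<sigma> \<in> {0..h}" "\<tau> \<in> {0..h}"
    "(f (x + h *\<^sub>R \<xi> + h *\<^sub>R \<eta>) - f (x + h *\<^sub>R \<xi>) - f (x + h *\<^sub>R \<eta>) + f x) \<bullet> w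
      = h * h * (A (x + \<sigma> *\<^sub>R \<xi> + \<tau> *\<^sub>R \<eta>) \<eta> \<bullet> w)"
proof -
  define \<phi> where "\<phi> = (\<lambda>\<sigma>. (f (x + \<sigma> *\<^sub>R \<xi> + h *\<^sub>R \<eta>) - f (x + \<sigma> *\<^sub>R \<xi>)) \<bullet> w)"
  have d\<phi>: "DERIV \<phi> \<sigma> :> (f' (x + \<sigma> *\<^sub>R \<xi> + h *\<^sub>R \<eta>) \<xi> - f' (x + \<sigma> *\<^sub>R \<xi>) \<xi>) \<bullet> w"
    if "0 \<le> \<sigma>" "\<sigma> \<le> h" for \<sigma>
  proof -
    have 1: "((\<lambda>\<sigma>. f (x + h *\<^sub>R \<eta> + \<sigma> *\<^sub>R \<xi>)) has_vector_derivative f' (x + h *\<^sub>R \<eta> + \<sigma> *\<^sub>R \<xi>) \<xi>) (at \<sigma>)"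
      using X[of \<sigma> h] that \<open>h > 0\<close>
      by (intro has_vector_derivative_line f') (simp add: add_ac)
    have 2: "((\<lambda>\<sigma>. f (x + \<sigma> *\<^sub>R \<xi>)) has_vector_derivative f' (x + \<sigma> *\<^sub>R \<xi>) \<xi>) (at \<sigma>)"
      using X[of \<sigma> 0] that \<open>h > 0\<close>
      by (intro has_vector_derivative_line f') simp
    show ?thesis
      using bounded_linear.has_vector_derivative[OF bounded_linear_inner_left
          has_vector_derivative_diff[OF 1 2], of w]
      unfolding \<phi>_def has_real_derivative_iff_has_vector_derivative by (simp add: add_ac)
  qed
  obtain \<sigma> where \<sigma>: "0 < \<sigma>" "\<sigma> < h"
    "\<phi> h - \<phi> 0 = (h - 0) * ((f' (x + \<sigma> *\<^sub>R \<xi> + h *\<^sub>R \<eta>) \<xi> - f' (x + \<sigma> *\<^sub>R \<xi>) \<xi>) \<bullet> w)"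
    using MVT2[OF \<open>h > 0\<close> d\<phi>] by blast
  define \<psi> where "\<psi> = (\<lambda>\<tau>. f' (x + \<sigma> *\<^sub>R \<xi> + \<tau> *\<^sub>R \<eta>) \<xi> \<bullet> w)"
  have d\<psi>: "DERIV \<psi> \<tau> :> A (x + \<sigma> *\<^sub>R \<xi> + \<tau> *\<^sub>R \<eta>) \<eta> \<bullet> w" if "0 \<le> \<tau>" "\<tau> \<le> h" for \<tau>
  proof -
    have "((\<lambda>\<tau>. f' (x + \<sigma> *\<^sub>R \<xi> + \<tau> *\<^sub>R \<eta>) \<xi>) has_vector_derivative A (x + \<sigma> *\<^sub>R \<xi> + \<tau> *\<^sub>R \<eta>) \<eta>) (at \<tau>)"
      using X[of \<sigma> \<tau>] that \<sigma> \<open>h > 0\<close>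
      by (intro has_vector_derivative_line[where f = "\<lambda>p. f' p \<xi>"] A) simp
    then show ?thesis
      using bounded_linear.has_vector_derivative[OF bounded_linear_inner_left, of _ _ _ w]
      unfolding \<psi>_def has_real_derivative_iff_has_vector_derivative by blast
  qed
  obtain \<tau> where \<tau>: "0 < \<tau>" "\<tau> < h" "\<psi> h - \<psi> 0 = (h - 0) * (A (x + \<sigma> *\<^sub>R \<xi> + \<tau> *\<^sub>R \<eta>) \<eta> \<bullet> w)"
    using MVT2[OF \<open>h > 0\<close> d\<psi>] by blast
  have "\<phi> h - \<phi> 0 = h * (\<psi> h - \<psi> 0)"
    using \<sigma>(3) by (simp add: \<psi>_def inner_diff_left)
  then have "(f (x + h *\<^sub>R \<xi> + h *\<^sub>R \<eta>) - f (x + h *\<^sub>R \<xi>) - f (x + h *\<^sub>R \<eta>) + f x) \<bullet> w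
      = h * h * (A (x + \<sigma> *\<^sub>R \<xi> + \<tau> *\<^sub>R \<eta>) \<eta> \<bullet> w)"
    unfolding \<tau>(3) \<phi>_def by (simp add: inner_diff_left inner_add_left)
  then show ?thesis using \<sigma> \<tau> that[of \<sigma> \<tau>] by auto
qed

lemma symmetric_second_derivative:
  fixes f :: "'a::real_normed_vector \<Rightarrow> 'b::real_inner"
  assumes "open X" "x \<in> X"
    and f': "\<And>p. p \<in> X \<Longrightarrow> (f has_derivative f' p) (at p)"
    and A: "\<And>p. p \<in> X \<Longrightarrow> ((\<lambda>p. f' p \<xi>) has_derivative A p) (at p)"
    and B: "\<And>p. p \<in> X \<Longrightarrow> ((\<lambda>p. f' p \<eta>) has_derivative B p) (at p)"
    and contA: "continuous (at x) (\<lambda>p. A p \<eta>)"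
    and contB: "continuous (at x) (\<lambda>p. B p \<xi>)"
  shows "A x \<eta> = B x \<xi>"
proof (rule vec_eq_by_inner)
  fix w :: 'b
  have bound: "\<bar>A x \<eta> \<bullet> w - B x \<xi> \<bullet> w\<bar> \<le> \<epsilon>" if "\<epsilon> > 0" for \<epsilon>
  proof -
    have "\<epsilon>/2 > 0" using that by simp
    have cA: "continuous (at x) (\<lambda>p. A p \<eta> \<bullet> w)" and cB: "continuous (at x) (\<lambda>p. B p \<xi> \<bullet> w)"
      using contA contB by (auto intro!: continuous_intros)
    from cA[unfolded continuous_at_eps_delta, rule_format, OF \<open>\<epsilon>/2 > 0\<close>]
    obtain d1 where d1: "d1 > 0" "\<And>p. dist p x < d1 \<Longrightarrow> dist (A p \<eta> \<bullet> w) (A x \<eta> \<bullet> w) < \<epsilon>/2"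
      by blast
    from cB[unfolded continuous_at_eps_delta, rule_format, OF \<open>\<epsilon>/2 > 0\<close>]
    obtain d2 where d2: "d2 > 0" "\<And>p. dist p x < d2 \<Longrightarrow> dist (B p \<xi> \<bullet> w) (B x \<xi> \<bullet> w) < \<epsilon>/2"
      by blast
    obtain d3 where d3: "d3 > 0" "ball x d3 \<subseteq> X" using assms(1,2) open_contains_ball by blast
    define d where "d = min d1 (min d2 d3)"
    have "d > 0" using d1 d2 d3 by (simp add: d_def)
    define h where "h = d / (norm \<xi> + norm \<eta> + 1)"
    have h: "h > 0" using \<open>d > 0\<close> by (simp add: h_def add_nonneg_pos)
    have close: "dist (x + \<sigma> *\<^sub>R \<xi> + \<tau> *\<^sub>R \<eta>) x < d" if "\<sigma> \<in> {0..h}" "\<tau> \<in> {0..h}" for \<sigma> \<tau>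
    proof -
      have "dist (x + \<sigma> *\<^sub>R \<xi> + \<tau> *\<^sub>R \<eta>) x \<le> \<bar>\<sigma>\<bar> * norm \<xi> + \<bar>\<tau>\<bar> * norm \<eta>"
        using norm_triangle_ineq[of "\<sigma> *\<^sub>R \<xi>" "\<tau> *\<^sub>R \<eta>"] by (simp add: dist_norm)
      also have "\<dots> \<le> h * norm \<xi> + h * norm \<eta>"
        using that by (intro add_mono mult_right_mono) auto
      also have "\<dots> < h * (norm \<xi> + norm \<eta> + 1)" using h by (simp add: algebra_simps)
      also have "\<dots> = d"
        unfolding h_def by (smt (verit) nonzero_eq_divide_eq norm_ge_zero)
      finally show ?thesis .
    qed
    have X: "x + \<sigma> *\<^sub>R \<xi> + \<tau> *\<^sub>R \<eta> \<in> X" if "\<sigma> \<in> {0..h}" "\<tau> \<in> {0..h}" for \<sigma> \<tau>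
      using close[OF that] d3 by (auto simp: d_def dist_commute)
    let ?\<Delta> = "(f (x + h *\<^sub>R \<xi> + h *\<^sub>R \<eta>) - f (x + h *\<^sub>R \<xi>) - f (x + h *\<^sub>R \<eta>) + f x) \<bullet> w"
    obtain \<sigma> \<tau> where 1: "\<sigma> \<in> {0..h}" "\<tau> \<in> {0..h}"
      "?\<Delta> = h * h * (A (x + \<sigma> *\<^sub>R \<xi> + \<tau> *\<^sub>R \<eta>) \<eta> \<bullet> w)"
      using second_difference[OF f' A h X] by blast
    have X': "x + \<sigma> *\<^sub>R \<eta> + \<tau> *\<^sub>R \<xi> \<in> X" if "\<sigma> \<in> {0..h}" "\<tau> \<in> {0..h}" for \<sigma> \<tau>
      using X[OF that(2,1)] by (simp add: add_ac)
    obtain \<sigma>' \<tau>' where 2: "\<sigma>' \<in> {0..h}" "\<tau>' \<in> {0..h}"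
      "(f (x + h *\<^sub>R \<eta> + h *\<^sub>R \<xi>) - f (x + h *\<^sub>R \<eta>) - f (x + h *\<^sub>R \<xi>) + f x) \<bullet> w
        = h * h * (B (x + \<sigma>' *\<^sub>R \<eta> + \<tau>' *\<^sub>R \<xi>) \<xi> \<bullet> w)"
      using second_difference[OF f' B h X'] by blast
    have "?\<Delta> = h * h * (B (x + \<tau>' *\<^sub>R \<xi> + \<sigma>' *\<^sub>R \<eta>) \<xi> \<bullet> w)"
      using 2(3) by (simp add: algebra_simps)
    then have "A (x + \<sigma> *\<^sub>R \<xi> + \<tau> *\<^sub>R \<eta>) \<eta> \<bullet> w = B (x + \<tau>' *\<^sub>R \<xi> + \<sigma>' *\<^sub>R \<eta>) \<xi> \<bullet> w"
      using 1(3) h by simp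
    moreover have "dist (A (x + \<sigma> *\<^sub>R \<xi> + \<tau> *\<^sub>R \<eta>) \<eta> \<bullet> w) (A x \<eta> \<bullet> w) < \<epsilon>/2"
      using close[OF 1(1,2)] by (intro d1) (simp add: d_def)
    moreover have "dist (B (x + \<tau>' *\<^sub>R \<xi> + \<sigma>' *\<^sub>R \<eta>) \<xi> \<bullet> w) (B x \<xi> \<bullet> w) < \<epsilon>/2"
      using close[OF 2(2,1)] by (intro d2) (simp add: d_def)
    ultimately show ?thesis unfolding dist_real_def by linarith
  qed
  have "\<bar>A x \<eta> \<bullet> w - B x \<xi> \<bullet> w\<bar> \<le> 0"
    by (rule field_le_epsilon) (simp add: bound)
  then show "A x \<eta> \<bullet> w = B x \<xi> \<bullet> w" by simp
qed

lemma smooth_on_second_derivative: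
  fixes f :: "'a::euclidean_space \<Rightarrow> 'b::real_inner"
  assumes "smooth_on f X" "open X"
  obtains f' f'' where
    "\<And>x. x \<in> X \<Longrightarrow> (f has_derivative f' x) (at x)"
    "\<And>x \<xi>. x \<in> X \<Longrightarrow> ((\<lambda>p. f' p \<xi>) has_derivative (\<lambda>\<eta>. f'' x \<eta> \<xi>)) (at x)"
    "\<And>x \<xi> \<eta>. x \<in> X \<Longrightarrow> f'' x \<xi> \<eta> = f'' x \<eta> \<xi>"
proof -
  define f' where "f' = (\<lambda>x. frechet_derivative f (at x))"
  define g where "g = (\<lambda>b x. frechet_derivative (\<lambda>p. f' p b) (at x))"
  define f'' where "f'' = (\<lambda>x \<eta> \<xi>. \<Sum>b\<in>Basis. (\<xi> \<bullet> b) *\<^sub>R g b x \<eta>)"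
  have C: "Ck_on (Suc (Suc 0)) f X" using assms(1) unfolding smooth_on_def by blast
  have f': "(f has_derivative f' x) (at x)" if "x \<in> X" for x
  proof -
    have "f differentiable (at x within X)" using C that by (auto simp: differentiable_on_def)
    then show ?thesis
      using at_within_open[OF that \<open>open X\<close>] by (simp add: f'_def frechet_derivative_works[symmetric])
  qed
  have g: "((\<lambda>p. f' p b) has_derivative g b x) (at x)" if "x \<in> X" "b \<in> Basis" for x b
  proof -
    have "(\<lambda>p. f' p b) differentiable (at x within X)"
      using C that by (auto simp: differentiable_on_def f'_def)
    then show ?thesis
      using at_within_open[OF that(1) \<open>open X\<close>] by (simp add: g_def frechet_derivative_works[symmetric])
  qed
  have contg: "continuous_on X (\<lambda>x. g b x b')" if "b \<in> Basis" "b' \<in> Basis" for b b'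
    using C that by (auto simp: f'_def g_def)
  have rep: "L \<xi> = (\<Sum>b\<in>Basis. (\<xi> \<bullet> b) *\<^sub>R L b)" if "linear L" for L :: "'a \<Rightarrow> 'b" and \<xi>
    using linear_sum[OF that, of "\<lambda>b. (\<xi> \<bullet> b) *\<^sub>R b" Basis]
    by (simp add: euclidean_representation linear_scale[OF that])
  have rep_f': "f' p \<xi> = (\<Sum>b\<in>Basis. (\<xi> \<bullet> b) *\<^sub>R f' p b)" if "p \<in> X" for p \<xi>
    using f'[OF that] has_derivative_linear rep by blast
  have rep_g: "g b p \<xi> = (\<Sum>b'\<in>Basis. (\<xi> \<bullet> b') *\<^sub>R g b p b')" if "p \<in> X" "b \<in> Basis" for b p \<xi>
    using g[OF that] has_derivative_linear rep by blast
  have d2: "((\<lambda>p. f' p \<xi>) has_derivative (\<lambda>\<eta>. f'' x \<eta> \<xi>)) (at x)" if "x \<in> X" for x \<xi>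
  proof -
    have "((\<lambda>p. \<Sum>b\<in>Basis. (\<xi> \<bullet> b) *\<^sub>R f' p b) has_derivative (\<lambda>\<eta>. f'' x \<eta> \<xi>)) (at x)"
      unfolding f''_def by (intro has_derivative_sum has_derivative_scaleR_right g that)
    then show ?thesis
      by (rule has_derivative_transform_within_open[OF _ \<open>open X\<close> that]) (simp add: rep_f')
  qed
  have sym: "g b x b' = g b' x b" if "x \<in> X" "b \<in> Basis" "b' \<in> Basis" for x b b'
  proof -
    have "isCont (\<lambda>p. g b p b') x" "isCont (\<lambda>p. g b' p b) x"
      using contg that continuous_on_eq_continuous_at[OF \<open>open X\<close>] by metis+
    then show ?thesis
      by (intro symmetric_second_derivative[OF \<open>open X\<close> that(1) f' g g] that)
  qed
  have sym': "f'' x \<xi> \<eta> = f'' x \<eta> \<xi>" if "x \<in> X" for x \<xi> \<eta>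
  proof -
    have "f'' x \<xi> \<eta> = (\<Sum>b\<in>Basis. \<Sum>b'\<in>Basis. (\<eta> \<bullet> b) *\<^sub>R (\<xi> \<bullet> b') *\<^sub>R g b x b')"
      unfolding f''_def by (rule sum.cong) (auto simp: rep_g[OF that, of _ \<xi>] scaleR_sum_right)
    also have "\<dots> = (\<Sum>b'\<in>Basis. \<Sum>b\<in>Basis. (\<eta> \<bullet> b) *\<^sub>R (\<xi> \<bullet> b') *\<^sub>R g b x b')"
      by (rule sum.swap)
    also have "\<dots> = (\<Sum>b'\<in>Basis. \<Sum>b\<in>Basis. (\<xi> \<bullet> b') *\<^sub>R (\<eta> \<bullet> b) *\<^sub>R g b' x b)"
      by (intro sum.cong) (auto simp: sym[OF that])
    also have "\<dots> = f'' x \<eta> \<xi>"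
      unfolding f''_def by (rule sum.cong) (auto simp: rep_g[OF that, of _ \<eta>] scaleR_sum_right)
    finally show ?thesis .
  qed
  show ?thesis by (rule that[OF f' d2 sym'])
qed

text \<open>
  The first two derivatives in terms of \<open>frechet_derivative\<close>, so that they can be named by definitions.
\<close>

lemma smooth_on_frechet:
  fixes f :: "'a::euclidean_space \<Rightarrow> 'b::real_inner"
  assumes "smooth_on f X" "open X" "x \<in> X"
  defines "D \<equiv> \<lambda>p. frechet_derivative f (at p)"
  defines "D2 \<equiv> \<lambda>x \<eta> \<xi>. frechet_derivative (\<lambda>p. D p \<xi>) (at x) \<eta>"
  shows "(f has_derivative D x) (at x)"
    and "((\<lambda>p. D p \<xi>) has_derivative (\<lambda>\<eta>. D2 x \<eta> \<xi>)) (at x)"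
    and "D2 x \<xi> \<eta> = D2 x \<eta> \<xi>"
proof -
  obtain f' f'' where f:
    "\<And>x. x \<in> X \<Longrightarrow> (f has_derivative f' x) (at x)"
    "\<And>x \<xi>. x \<in> X \<Longrightarrow> ((\<lambda>p. f' p \<xi>) has_derivative (\<lambda>\<eta>. f'' x \<eta> \<xi>)) (at x)"
    "\<And>x \<xi> \<eta>. x \<in> X \<Longrightarrow> f'' x \<xi> \<eta> = f'' x \<eta> \<xi>"
    using smooth_on_second_derivative[OF assms(1,2)] by metis
  have D: "D p = f' p" if "p \<in> X" for p
    unfolding D_def using frechet_derivative_at[OF f(1)[OF that]] by simp
  show "(f has_derivative D x) (at x)" using f(1)[OF assms(3)] D[OF assms(3)] by simp
  have d2: "((\<lambda>p. D p \<xi>) has_derivative (\<lambda>\<eta>. f'' x \<eta> \<xi>)) (at x)" for \<xi>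
    by (rule has_derivative_transform_within_open[OF f(2)[OF assms(3)] assms(2,3)]) (simp add: D)
  have D2: "D2 x \<eta> \<xi> = f'' x \<eta> \<xi>" for \<eta> \<xi>
    unfolding D2_def using frechet_derivative_at[OF d2] by metis
  show "((\<lambda>p. D p \<xi>) has_derivative (\<lambda>\<eta>. D2 x \<eta> \<xi>)) (at x)" using d2 by (simp add: D2)
  show "D2 x \<xi> \<eta> = D2 x \<eta> \<xi>" using f(3)[OF assms(3)] by (simp add: D2)
qed

section \<open>Moufang loops and their birepresentations\<close>

context moufang_loop
begin

text \<open>
  Only right inverses are available by definition; the lemmas below show that they are two-sided and satisfy both
  inverse properties.
\<close>

definition ginv :: "'g \<Rightarrow> 'g" where "ginv g = (THE h. g \<odot> h = e)"

lemma left_cancel: "a \<odot> x = a \<odot> y \<Longrightarrow> x = y"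
  using left_division[of a "a \<odot> y"] by auto

lemma right_cancel: "x \<odot> a = y \<odot> a \<Longrightarrow> x = y"
  using right_division[of a "y \<odot> a"] by auto

lemma right_inverse: "g \<odot> ginv g = e"
  unfolding ginv_def by (rule theI'[OF left_division])

lemma flexible: "a \<odot> (h \<odot> a) = (a \<odot> h) \<odot> a"
  using moufang[of a e h] by (simp add: unit_left unit_right)

lemma inverse_cancel_left: "a \<odot> (ginv a \<odot> h) = h"
proof -
  have "h \<odot> a = (a \<odot> (ginv a \<odot> h)) \<odot> a"
    using moufang[of a "ginv a" h] by (simp add: right_inverse unit_left)
  then show ?thesis using right_cancel by metis
qed

lemma inverse_inverse: "ginv (ginv a) = a"
  using inverse_cancel_left[of a "ginv (ginv a)"] by (simp add: right_inverse unit_right)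

lemma left_inverse: "ginv g \<odot> g = e"
  using right_inverse[of "ginv g"] by (simp add: inverse_inverse)

lemma cancel_left_inverse: "ginv a \<odot> (a \<odot> h) = h"
  using inverse_cancel_left[of "ginv a"] by (simp add: inverse_inverse)

lemma inverse_cancel_right: "(g \<odot> ginv a) \<odot> a = g"
proof -
  have "a \<odot> g = a \<odot> ((g \<odot> ginv a) \<odot> a)"
    using moufang[of a g "ginv a"] by (simp add: left_inverse unit_right flexible)
  then show ?thesis using left_cancel by metis
qed

lemma cancel_right_inverse: "(g \<odot> a) \<odot> ginv a = g"
  using inverse_cancel_right[of g "ginv a"] by (simp add: inverse_inverse)

lemma inverse_mult: "ginv (g \<odot> h) = ginv h \<odot> ginv g"
proof -
  have "ginv h = ginv (g \<odot> h) \<odot> g"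
    using cancel_left_inverse[of "g \<odot> h" "ginv h"] by (simp add: cancel_right_inverse)
  then show ?thesis by (simp add: cancel_right_inverse)
qed

end

locale moufang_birepresentation = moufang_loop m e + birepresentation m e S T
  for m :: "'g \<Rightarrow> 'g \<Rightarrow> 'g" (infixl "\<odot>" 70) and e
    and S T :: "'g \<Rightarrow> 'k::{real_normed_field, euclidean_space}^'n^'n::finite"
begin

lemma TS_commute: "T g ** S g = S g ** T g"
  using TSS[of g e] by (simp add: S_unit unit_right matrix_mul_assoc)

lemma S_inverse: "S (ginv g) = matrix_inv (S g)"
proof -
  have "T g ** (S g ** S (ginv g)) = T g ** mat 1"
    using TSS[of g "ginv g"] by (simp add: right_inverse S_unit matrix_mul_assoc)
  then have *: "S g ** S (ginv g) = mat 1" by (metis matrix_inv_cancel(1) invertible_T)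
  then have "S (ginv g) ** S g = mat 1" by (metis matrix_left_right_inverse)
  with * show ?thesis by (simp add: matrix_inv_eqI)
qed

lemma T_inverse: "T (ginv g) = matrix_inv (T g)"
proof -
  have "S g ** (T g ** T (ginv g)) = S g ** mat 1"
    using STT[of g "ginv g"] by (simp add: left_inverse T_unit matrix_mul_assoc)
  then have *: "T g ** T (ginv g) = mat 1" by (metis matrix_inv_cancel(1) invertible_S)
  then have "T (ginv g) ** T g = mat 1" by (metis matrix_left_right_inverse)
  with * show ?thesis by (simp add: matrix_inv_eqI)
qed

lemma S_mult: "S (g \<odot> h) = T g ** S g ** S h ** matrix_inv (T g)"
  unfolding TSS by (simp add: matrix_inv_cancel invertible_T)

lemma T_mult: "T (g \<odot> h) = S h ** T h ** T g ** matrix_inv (S h)"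
  unfolding STT by (simp add: matrix_inv_cancel invertible_S)

text \<open>
  The formula \<open>S_mult\<close> for the product of the inverses, inverted.
\<close>

lemma S_mult': "S (g \<odot> h) = matrix_inv (T h) ** S g ** S h ** T h"
proof -
  have "matrix_inv (S (g \<odot> h)) = S (ginv h \<odot> ginv g)"
    by (simp add: S_inverse inverse_mult[symmetric])
  also have "\<dots> = matrix_inv (T h) ** matrix_inv (S h) ** matrix_inv (S g) ** T h"
    by (simp add: S_mult S_inverse T_inverse matrix_inv_matrix_inv invertible_T)
  finally have "S (g \<odot> h) = matrix_inv (matrix_inv (T h) ** matrix_inv (S h) ** matrix_inv (S g) ** T h)"
    by (metis matrix_inv_matrix_inv invertible_S)
  then show ?thesis
    by (simp add: matrix_inv_mult invertible_mult invertible_matrix_inv invertible_S invertible_T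
        matrix_inv_matrix_inv matrix_mul_assoc)
qed

text \<open>
  The two expressions for $S_{gh}$ show that $T_h T_g$ commutes with $S_g S_h$, and this
  moves the conjugation by $S_h$ in \<open>T_mult\<close> to one by $S_g$. Together with \<open>T_mult\<close> it is responsible for
  $S_a(g) + T_a(g)$ being constant.
\<close>

lemma T_mult': "T (g \<odot> h) = matrix_inv (S g) ** T h ** S g ** T g"
proof -
  have "T g ** S g ** S h ** matrix_inv (T g) = matrix_inv (T h) ** S g ** S h ** T h"
    by (simp flip: S_mult add: S_mult')
  then have "T h ** (T g ** S g ** S h ** matrix_inv (T g)) ** T g
      = T h ** (matrix_inv (T h) ** S g ** S h ** T h) ** T g" by simp
  then have 1: "T h ** T g ** S g ** S h = S g ** S h ** T h ** T g"
    by (simp add: matrix_mul_assoc matrix_inv_cancel invertible_T matrix_inv_right)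
  have "T (g \<odot> h) = matrix_inv (S g) ** (S g ** S h ** T h ** T g) ** matrix_inv (S h)"
    by (simp add: T_mult matrix_mul_assoc matrix_inv_left invertible_S)
  also have "\<dots> = matrix_inv (S g) ** T h ** (T g ** S g)"
    unfolding 1[symmetric] by (simp add: matrix_mul_assoc matrix_inv_cancel invertible_S)
  finally show ?thesis by (simp add: TS_commute matrix_mul_assoc)
qed

end

section \<open>Coordinates\<close>

lemma is_chart_facts:
  assumes "is_chart (U, \<phi>)"
  shows "open U" "open (\<phi> ` U)" "continuous_on U \<phi>" "continuous_on (\<phi> ` U) (chart_inv (U, \<phi>))"
    "g \<in> U \<Longrightarrow> chart_inv (U, \<phi>) (\<phi> g) = g" "x \<in> \<phi> ` U \<Longrightarrow> \<phi> (chart_inv (U, \<phi>) x) = x"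
    "x \<in> \<phi> ` U \<Longrightarrow> chart_inv (U, \<phi>) x \<in> U" "inj_on \<phi> U"
  using assms by (auto simp: is_chart_def homeomorphism_def inj_on_def) metis

lemma real_analytic_on_subset: "real_analytic_on f X \<Longrightarrow> Y \<subseteq> X \<Longrightarrow> real_analytic_on f Y"
  unfolding real_analytic_on_def by (simp add: subset_iff)

lemma real_analytic_on_singleton_transform:
  assumes f: "real_analytic_on f {p}" and X: "open X" "p \<in> X" and eq: "\<And>x. x \<in> X \<Longrightarrow> f x = g x"
  shows "real_analytic_on g {p}"
proof -
  obtain a \<epsilon> where *: "\<epsilon> > 0" "\<And>h. norm h < \<epsilon> \<Longrightarrow>
        ((\<lambda>\<alpha>. (\<Prod>b\<in>Basis. (h \<bullet> b) ^ \<alpha> b) *\<^sub>R a \<alpha>) has_sum f (p + h))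
          (Basis \<rightarrow>\<^sub>E (UNIV :: nat set))"
    using f unfolding real_analytic_on_def by blast
  obtain d where d: "d > 0" "ball p d \<subseteq> X" using X open_contains_ball by blast
  have "((\<lambda>\<alpha>. (\<Prod>b\<in>Basis. (h \<bullet> b) ^ \<alpha> b) *\<^sub>R a \<alpha>) has_sum g (p + h))
          (Basis \<rightarrow>\<^sub>E (UNIV :: nat set))" if "norm h < min \<epsilon> d" for h
  proof -
    have "p + h \<in> X" using d that by (auto simp: dist_norm subset_iff)
    then show ?thesis using *(2)[of h] that eq by simp
  qed
  moreover have "min \<epsilon> d > 0" using *(1) d(1) by simp
  ultimately show ?thesis unfolding real_analytic_on_def ball_simps by blast
qed

context analytic_moufang_loop
begin

lemma chart_facts: "c \<in> A \<Longrightarrow> is_chart c"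
  using atlas by (simp add: analytic_atlas_def)

lemma continuous_mult: "continuous_on UNIV (\<lambda>(g, h). m g h)"
  using analytic_mult by (simp add: analytic_map_def)

lemma continuous_mult_left: "continuous_on UNIV (\<lambda>h. m g h)"
  using continuous_on_compose2[OF continuous_mult, of UNIV "\<lambda>h. (g, h)"]
  by (simp add: continuous_intros)

text \<open>
  Three charts are needed since the inverse of an element of the distinguished chart domain may lie outside of that
  domain.
\<close>

lemma mult_expansion:
  assumes "(U1, \<phi>1) \<in> A" "(U2, \<phi>2) \<in> A" "(U3, \<phi>3) \<in> A" and g: "g \<in> U1" "h \<in> U2" "m g h \<in> U3"
  shows "real_analytic_on (\<lambda>(x, y). \<phi>3 (m (chart_inv (U1, \<phi>1) x) (chart_inv (U2, \<phi>2) y))) {(\<phi>1 g, \<phi>2 h)}"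
proof -
  note c1 = is_chart_facts[OF chart_facts[OF assms(1)]] and c2 = is_chart_facts[OF chart_facts[OF assms(2)]]
  let ?c = "(U1 \<times> U2, map_prod \<phi>1 \<phi>2)"
  have "?c \<in> prod_atlas A A"
    using assms(1,2) by (force simp: prod_atlas_def)
  then have main: "real_analytic_on (\<phi>3 \<circ> (\<lambda>(g, h). m g h) \<circ> chart_inv ?c)
      (map_prod \<phi>1 \<phi>2 ` (U1 \<times> U2 \<inter> (\<lambda>(g, h). m g h) -` U3))"
    using analytic_mult assms(3) unfolding analytic_map_def by fastforce
  have mem: "(\<phi>1 g, \<phi>2 h) \<in> map_prod \<phi>1 \<phi>2 ` (U1 \<times> U2 \<inter> (\<lambda>(g, h). m g h) -` U3)"
    using g by (intro image_eqI[of _ _ "(g, h)"]) auto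
  have "real_analytic_on (\<phi>3 \<circ> (\<lambda>(g, h). m g h) \<circ> chart_inv ?c) {(\<phi>1 g, \<phi>2 h)}"
    by (rule real_analytic_on_subset[OF main]) (use mem in simp)
  then show ?thesis
  proof (rule real_analytic_on_singleton_transform)
    show "open (\<phi>1 ` U1 \<times> \<phi>2 ` U2)" using c1(2) c2(2) by (rule open_Times)
    show "(\<phi>1 g, \<phi>2 h) \<in> \<phi>1 ` U1 \<times> \<phi>2 ` U2" using g by simp
    fix p assume "p \<in> \<phi>1 ` U1 \<times> \<phi>2 ` U2"
    then obtain a b where ab: "a \<in> U1" "b \<in> U2" "p = (\<phi>1 a, \<phi>2 b)" by auto
    have "inj_on (map_prod \<phi>1 \<phi>2) (U1 \<times> U2)"
      using c1(8) c2(8) by (rule map_prod_inj_on)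
    then have "chart_inv ?c p = (a, b)"
      using inv_into_f_f[of "map_prod \<phi>1 \<phi>2" "U1 \<times> U2" "(a, b)"] ab by (simp add: chart_inv_def)
    then show "(\<phi>3 \<circ> (\<lambda>(g, h). m g h) \<circ> chart_inv ?c) p
        = (case p of (x, y) \<Rightarrow> \<phi>3 (m (chart_inv (U1, \<phi>1) x) (chart_inv (U2, \<phi>2) y)))"
      using ab c1(5) c2(5) by simp
  qed
qed

lemma mult_differentiable_right:
  assumes "(U1, \<phi>1) \<in> A" "(U2, \<phi>2) \<in> A" "(U3, \<phi>3) \<in> A" and g: "g \<in> U1" "h \<in> U2" "m g h \<in> U3"
  shows "(\<lambda>y. \<phi>3 (m g (chart_inv (U2, \<phi>2) y))) differentiable (at (\<phi>2 h))"
proof -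
  note c1 = is_chart_facts[OF chart_facts[OF assms(1)]]
  have "(\<lambda>(x, y). \<phi>3 (m (chart_inv (U1, \<phi>1) x) (chart_inv (U2, \<phi>2) y))) differentiable (at (\<phi>1 g, \<phi>2 h))"
    by (rule real_analytic_on_differentiable[OF mult_expansion[OF assms]]) simp
  then obtain D where D: "((\<lambda>(x, y). \<phi>3 (m (chart_inv (U1, \<phi>1) x) (chart_inv (U2, \<phi>2) y))) has_derivative D)
      (at (\<phi>1 g, \<phi>2 h))" by (auto simp: differentiable_def)
  have "((\<lambda>y. (\<phi>1 g, y)) has_derivative (\<lambda>k. (0, k))) (at (\<phi>2 h))"
    by (auto intro!: derivative_eq_intros)
  from has_derivative_compose[OF this D]
  have "((\<lambda>y. \<phi>3 (m g (chart_inv (U2, \<phi>2) y))) has_derivative (\<lambda>k. D (0, k))) (at (\<phi>2 h))"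
    using g c1(5) by simp
  then show ?thesis by (rule differentiableI)
qed

end

lemma vec_axis_sum: "(\<Sum>i\<in>UNIV. x $ i *\<^sub>R axis i 1) = (x :: real^'r::finite)"
  by (simp add: vec_eq_iff axis_def if_distrib cong: if_cong)

lemma linear_axis_sum:
  fixes L :: "real^'r::finite \<Rightarrow> 'b::real_vector"
  assumes "linear L"
  shows "(\<Sum>i\<in>UNIV. x $ i *\<^sub>R L (axis i 1)) = L x"
proof -
  have "L x = L (\<Sum>i\<in>UNIV. x $ i *\<^sub>R axis i 1)" by (simp add: vec_axis_sum)
  then show ?thesis by (simp add: linear_sum[OF assms] linear_scale[OF assms])
qed

lemmas has_derivative_matrix_mult = bounded_bilinear.FDERIV[OF bounded_bilinear_matrix_mult]

lemma bounded_linear_sandwich: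
  fixes P Q :: "'k::{real_normed_field, euclidean_space}^'n^'n::finite"
  shows "bounded_linear (\<lambda>H. P ** H ** Q)"
  by (intro bounded_linear_compose[OF
        bounded_bilinear.bounded_linear_left[OF bounded_bilinear_matrix_mult]
        bounded_bilinear.bounded_linear_right[OF bounded_bilinear_matrix_mult]])

lemma has_derivative_matrix_inv_compose:
  fixes P :: "'a::real_normed_vector \<Rightarrow> 'k::{real_normed_field, euclidean_space}^'n^'n::finite"
  assumes "(P has_derivative P') (at x)" "\<And>x. invertible (P x)"
  shows "((\<lambda>x. matrix_inv (P x)) has_derivative (\<lambda>h. - (matrix_inv (P x) ** P' h ** matrix_inv (P x)))) (at x)"
  using assms
  by (intro has_derivative_in_compose2[where t = "{Q. invertible Q}" and f = P and g = matrix_inv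
        and g' = "\<lambda>P H. - (matrix_inv P ** H ** matrix_inv P)"] has_derivative_matrix_inv) auto

section \<open>The generalized Lie equations and their integrability conditions\<close>

text \<open>
  A birepresentation together with a chart around the unit, in which all derivatives are computed.
\<close>

locale birep_chart =
  analytic_moufang_loop m e A + moufang_birepresentation m e S T
  for m :: "'g::{t2_space, second_countable_topology} \<Rightarrow> 'g \<Rightarrow> 'g" (infixl "\<odot>" 70) and e :: 'g
    and A :: "('g, real^'r::finite) chart set"
    and S T :: "'g \<Rightarrow> 'k::{real_normed_field, euclidean_space}^'n^'n::finite" +
  fixes U :: "'g set" and \<phi> :: "'g \<Rightarrow> real^'r"
  assumes smooth_S: "smooth_function A S"
    and smooth_T: "smooth_function A T"
    and chart_mem: "(U, \<phi>) \<in> A"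
    and unit_mem: "e \<in> U"
begin

abbreviation X :: "(real^'r) set" where "X \<equiv> \<phi> ` U"
abbreviation psi :: "real^'r \<Rightarrow> 'g" where "psi \<equiv> chart_inv (U, \<phi>)"
abbreviation y0 :: "real^'r" where "y0 \<equiv> \<phi> e"

lemmas chart = is_chart_facts[OF chart_facts[OF chart_mem]]

lemma y0_mem: "y0 \<in> X" using unit_mem by simp

lemma psi_y0: "psi y0 = e" using unit_mem chart(5) by simp

text \<open>
  \<open>V x\<close> is the differential at the unit of left translation by the element with coordinates \<open>x\<close>; its
  columns are the auxiliary functions. The derivatives \<open>Ds2 x \<eta> a\<close>, \<open>Dt2 x \<eta> a\<close> and \<open>V2 x \<eta> a\<close> are taken in
  the direction \<open>\<eta>\<close>, with \<open>a\<close> held fixed.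
\<close>

definition s :: "real^'r \<Rightarrow> 'k^'n^'n" where "s x = S (psi x)"
definition t :: "real^'r \<Rightarrow> 'k^'n^'n" where "t x = T (psi x)"
definition Ds where "Ds x = frechet_derivative s (at x)"
definition Dt where "Dt x = frechet_derivative t (at x)"
definition Ds2 where "Ds2 x \<eta> a = frechet_derivative (\<lambda>p. Ds p a) (at x) \<eta>"
definition Dt2 where "Dt2 x \<eta> a = frechet_derivative (\<lambda>p. Dt p a) (at x) \<eta>"
definition V :: "real^'r \<Rightarrow> real^'r \<Rightarrow> real^'r" where
  "V x = frechet_derivative (\<lambda>y. \<phi> (psi x \<odot> psi y)) (at y0)"
definition V2 where "V2 x \<eta> a = frechet_derivative (\<lambda>p. V p a) (at x) \<eta>"

lemma inv_s: "invertible (s x)" and inv_t: "invertible (t x)"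
  by (simp_all add: s_def t_def invertible_S invertible_T)

lemma s_y0: "s y0 = mat 1" and t_y0: "t y0 = mat 1"
  by (simp_all add: s_def t_def psi_y0 S_unit T_unit)

lemma
  assumes "x \<in> X"
  shows s_deriv: "(s has_derivative Ds x) (at x)"
    and Ds_deriv: "((\<lambda>p. Ds p a) has_derivative (\<lambda>\<eta>. Ds2 x \<eta> a)) (at x)"
    and Ds2_sym: "Ds2 x \<eta> \<xi> = Ds2 x \<xi> \<eta>"
proof -
  have "S \<circ> psi = s" by (auto simp: s_def)
  then have "smooth_on s X"
    using smooth_S chart_mem by (auto simp: smooth_function_def)
  note * = smooth_on_frechet[OF this chart(2) assms, folded Ds_def, folded Ds2_def]
  show "(s has_derivative Ds x) (at x)" "((\<lambda>p. Ds p a) has_derivative (\<lambda>\<eta>. Ds2 x \<eta> a)) (at x)"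
    "Ds2 x \<eta> \<xi> = Ds2 x \<xi> \<eta>" by (fact *)+
qed

lemma
  assumes "x \<in> X"
  shows t_deriv: "(t has_derivative Dt x) (at x)"
    and Dt_deriv: "((\<lambda>p. Dt p a) has_derivative (\<lambda>\<eta>. Dt2 x \<eta> a)) (at x)"
    and Dt2_sym: "Dt2 x \<eta> \<xi> = Dt2 x \<xi> \<eta>"
proof -
  have "T \<circ> psi = t" by (auto simp: t_def)
  then have "smooth_on t X"
    using smooth_T chart_mem by (auto simp: smooth_function_def)
  note * = smooth_on_frechet[OF this chart(2) assms, folded Dt_def, folded Dt2_def]
  show "(t has_derivative Dt x) (at x)" "((\<lambda>p. Dt p a) has_derivative (\<lambda>\<eta>. Dt2 x \<eta> a)) (at x)"
    "Dt2 x \<eta> \<xi> = Dt2 x \<xi> \<eta>" by (fact *)+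
qed

lemma coord_deriv_eq:
  assumes "((\<lambda>x. F (psi x)) has_derivative D) (at (\<phi> g))"
  shows "coord_deriv (U, \<phi>) F j g = D (axis j 1)"
proof -
  have "((\<lambda>\<sigma>. F (psi (\<phi> g + \<sigma> *\<^sub>R axis j 1))) has_vector_derivative D (axis j 1)) (at 0)"
    by (rule has_vector_derivative_line[where f = "\<lambda>x. F (psi x)"]) (use assms in simp)
  then show ?thesis by (simp add: coord_deriv_def vector_derivative_at)
qed

subsection \<open>The auxiliary functions\<close>

lemma near_unit:
  assumes "x \<in> X"
  shows "open {y \<in> X. psi x \<odot> psi y \<in> U}" "y0 \<in> {y \<in> X. psi x \<odot> psi y \<in> U}"
proof -
  have "continuous_on X (\<lambda>y. psi x \<odot> psi y)"
    by (rule continuous_on_compose2[OF continuous_mult_left chart(4)]) simp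
  from continuous_open_preimage[OF this chart(2,1)]
  show "open {y \<in> X. psi x \<odot> psi y \<in> U}" by (simp add: vimage_def Int_def)
  show "y0 \<in> {y \<in> X. psi x \<odot> psi y \<in> U}"
    using assms chart(7) by (simp add: y0_mem psi_y0 unit_right)
qed

lemma mult_deriv:
  assumes "x \<in> X"
  shows "((\<lambda>y. \<phi> (psi x \<odot> psi y)) has_derivative V x) (at y0)"
  using mult_differentiable_right[OF chart_mem chart_mem chart_mem, of "psi x" e] chart(7)[OF assms] unit_mem
  unfolding V_def by (simp add: unit_right frechet_derivative_works)

lemma linear_V: "x \<in> X \<Longrightarrow> linear (V x)"
  using mult_deriv has_derivative_linear by blast

text \<open>
  Left translation by the inverse element undoes left translation.
\<close>

lemma V_inj:
  assumes x: "x \<in> X" and "V x a = 0"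
  shows "a = 0"
proof -
  let ?g = "psi x"
  have "ginv ?g \<in> (\<Union>c\<in>A. fst c)" using atlas by (simp add: analytic_atlas_def)
  then obtain c where "c \<in> A" "ginv ?g \<in> fst c" by blast
  then obtain U1 \<phi>1 where c: "(U1, \<phi>1) \<in> A" "ginv ?g \<in> U1" by (cases c) auto
  have "(\<lambda>z. \<phi> (ginv ?g \<odot> psi z)) differentiable (at (\<phi> ?g))"
    by (rule mult_differentiable_right[OF c(1) chart_mem chart_mem c(2)])
      (use chart(7)[OF x] unit_mem in \<open>simp_all add: left_inverse\<close>)
  then obtain D where D: "((\<lambda>z. \<phi> (ginv ?g \<odot> psi z)) has_derivative D) (at x)"
    using chart(6)[OF x] by (auto simp: differentiable_def)
  have "\<phi> (?g \<odot> psi y0) = x" using chart(6)[OF x] by (simp add: psi_y0 unit_right)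
  then have "((\<lambda>y. \<phi> (ginv ?g \<odot> psi (\<phi> (?g \<odot> psi y)))) has_derivative (\<lambda>h. D (V x h))) (at y0)"
    using has_derivative_compose[OF mult_deriv[OF x], of "\<lambda>z. \<phi> (ginv ?g \<odot> psi z)" D] D by simp
  then have "((\<lambda>y. y) has_derivative (\<lambda>h. D (V x h))) (at y0)"
    by (rule has_derivative_transform_within_open[OF _ near_unit[OF x]])
      (auto simp: chart(5,6) cancel_left_inverse)
  then have "(\<lambda>h. D (V x h)) = (\<lambda>h. h)"
    using has_derivative_unique has_derivative_ident by blast
  then have "D (V x a) = a" by metis
  moreover have "D 0 = 0" using D has_derivative_linear linear_0 by blast
  ultimately show ?thesis using assms(2) by simp
qed

lemma V_deriv:
  assumes x: "x \<in> X"
  shows "((\<lambda>p. V p a) has_derivative (\<lambda>\<eta>. V2 x \<eta> a)) (at x)"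
proof -
  let ?F = "\<lambda>(x, y). \<phi> (psi x \<odot> psi y)"
  have "real_analytic_on ?F {(x, y0)}"
    using mult_expansion[OF chart_mem chart_mem chart_mem, of "psi x" e] chart(6,7)[OF x] unit_mem
    by (simp add: unit_right)
  then obtain c \<epsilon> where \<epsilon>: "\<epsilon> > 0" and ser: "\<And>h. norm h < \<epsilon> \<Longrightarrow>
      ((\<lambda>\<alpha>. (\<Prod>b\<in>Basis. (h \<bullet> b) ^ \<alpha> b) *\<^sub>R c \<alpha>) has_sum ?F ((x, y0) + h)) (Basis \<rightarrow>\<^sub>E (UNIV :: nat set))"
    unfolding real_analytic_on_def by blast
  have axis: "(\<lambda>p. V p (axis j 1)) differentiable (at x)" for j
  proof -
    have "axis j 1 \<in> (Basis :: (real^'r) set)" by (simp add: axis_in_Basis_iff)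
    from mixed_derivative_power_series[OF \<epsilon> this ser]
    obtain W where W: "\<And>h. norm h < \<epsilon>/2 \<Longrightarrow> ((\<lambda>\<sigma>. ?F ((x, y0) + (h, \<sigma> *\<^sub>R axis j 1))) has_vector_derivative W h) (at 0)"
      and dW: "W differentiable (at 0)" by blast
    obtain d where d: "d > 0" "ball x d \<subseteq> X" using chart(2) x open_contains_ball by blast
    have VW: "W (p - x) = V p (axis j 1)" if p: "p \<in> ball x (min (\<epsilon>/2) d)" for p
    proof -
      have "p \<in> X" "norm (p - x) < \<epsilon>/2" using p d by (auto simp: dist_norm norm_minus_commute)
      have "((\<lambda>\<sigma>. \<phi> (psi p \<odot> psi (y0 + \<sigma> *\<^sub>R axis j 1))) has_vector_derivative V p (axis j 1)) (at 0)"
        by (rule has_vector_derivative_line[where f = "\<lambda>y. \<phi> (psi p \<odot> psi y)"]) (use mult_deriv[OF \<open>p \<in> X\<close>] in simp)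
      with W[OF \<open>norm (p - x) < \<epsilon>/2\<close>] show ?thesis
        by (auto dest: vector_derivative_unique_at)
    qed
    obtain D where D: "(W has_derivative D) (at 0)" using dW by (auto simp: differentiable_def)
    have "((\<lambda>p. p - x) has_derivative (\<lambda>h. h)) (at x)" by (auto intro!: derivative_eq_intros)
    from has_derivative_compose[OF this, of W D] D
    have "((\<lambda>p. W (p - x)) has_derivative D) (at x)" by simp
    then have "((\<lambda>p. V p (axis j 1)) has_derivative D) (at x)"
      by (rule has_derivative_transform_within_open[of _ _ _ _ "ball x (min (\<epsilon>/2) d)"])
        (use \<epsilon> d VW in auto)
    then show ?thesis by (rule differentiableI)
  qed
  then obtain D where D: "\<And>j. ((\<lambda>p. V p (axis j 1)) has_derivative D j) (at x)"
    unfolding differentiable_def by metis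
  have "((\<lambda>p. \<Sum>j\<in>UNIV. a $ j *\<^sub>R V p (axis j 1)) has_derivative (\<lambda>h. \<Sum>j\<in>UNIV. a $ j *\<^sub>R D j h)) (at x)"
    by (intro has_derivative_sum has_derivative_scaleR_right D)
  then have "((\<lambda>p. V p a) has_derivative (\<lambda>h. \<Sum>j\<in>UNIV. a $ j *\<^sub>R D j h)) (at x)"
    by (rule has_derivative_transform_within_open[OF _ chart(2) x])
      (simp add: linear_axis_sum[OF linear_V])
  then show ?thesis
    unfolding V2_def by (simp add: frechet_derivative_at[symmetric])
qed

lemma linear_V2: "x \<in> X \<Longrightarrow> linear (\<lambda>\<eta>. V2 x \<eta> a)"
  using V_deriv has_derivative_linear by blast

lemma linear_V2': 
  assumes x: "x \<in> X"
  shows "linear (V2 x \<eta>)"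
proof (rule linearI)
  fix a b c
  have "((\<lambda>p. V p a + V p b) has_derivative (\<lambda>\<eta>. V2 x \<eta> a + V2 x \<eta> b)) (at x)"
    by (intro has_derivative_add V_deriv x)
  then have "((\<lambda>p. V p (a + b)) has_derivative (\<lambda>\<eta>. V2 x \<eta> a + V2 x \<eta> b)) (at x)"
    by (rule has_derivative_transform_within_open[OF _ chart(2) x]) (simp add: linear_add[OF linear_V])
  from has_derivative_unique[OF this V_deriv[OF x]]
  show "V2 x \<eta> (a + b) = V2 x \<eta> a + V2 x \<eta> b" by metis
  have "((\<lambda>p. c *\<^sub>R V p a) has_derivative (\<lambda>\<eta>. c *\<^sub>R V2 x \<eta> a)) (at x)"
    by (intro has_derivative_scaleR_right V_deriv x)
  then have "((\<lambda>p. V p (c *\<^sub>R a)) has_derivative (\<lambda>\<eta>. c *\<^sub>R V2 x \<eta> a)) (at x)"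
    by (rule has_derivative_transform_within_open[OF _ chart(2) x]) (simp add: linear_scale[OF linear_V])
  from has_derivative_unique[OF this V_deriv[OF x]]
  show "V2 x \<eta> (c *\<^sub>R a) = c *\<^sub>R V2 x \<eta> a" by metis
qed

lemma aux_fun_eq:
  assumes "g \<in> U"
  shows "aux_fun m e (U, \<phi>) j n g = V (\<phi> g) (axis j 1) $ n"
proof -
  have "((\<lambda>y. \<phi> (g \<odot> psi y) $ n) has_derivative (\<lambda>h. V (\<phi> g) h $ n)) (at y0)"
    using bounded_linear.has_derivative[OF bounded_linear_vec_nth mult_deriv[of "\<phi> g"]] assms
    by (simp add: chart(5))
  then show ?thesis unfolding aux_fun_def snd_conv by (rule coord_deriv_eq)
qed

lemma coord_deriv_along:
  assumes g: "g \<in> U" and D: "((\<lambda>x. F (psi x)) has_derivative D) (at (\<phi> g))"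
  shows "(\<Sum>n\<in>UNIV. aux_fun m e (U, \<phi>) j n g *\<^sub>R coord_deriv (U, \<phi>) F n g) = D (V (\<phi> g) (axis j 1))"
  unfolding aux_fun_eq[OF g] coord_deriv_eq[OF D]
  by (rule linear_axis_sum[OF has_derivative_linear[OF D]])

lemma aux_fun_deriv:
  assumes g: "g \<in> U"
  shows "(\<Sum>n\<in>UNIV. aux_fun m e (U, \<phi>) j n g * coord_deriv (U, \<phi>) (aux_fun m e (U, \<phi>) k i) n g)
    = V2 (\<phi> g) (V (\<phi> g) (axis j 1)) (axis k 1) $ i"
proof -
  have "((\<lambda>x. V x (axis k 1) $ i) has_derivative (\<lambda>\<eta>. V2 (\<phi> g) \<eta> (axis k 1) $ i)) (at (\<phi> g))"
    by (rule bounded_linear.has_derivative[OF bounded_linear_vec_nth V_deriv]) (use g in simp)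
  then have "((\<lambda>x. aux_fun m e (U, \<phi>) k i (psi x)) has_derivative (\<lambda>\<eta>. V2 (\<phi> g) \<eta> (axis k 1) $ i)) (at (\<phi> g))"
    by (rule has_derivative_transform_within_open[OF _ chart(2)])
      (use g chart(5) in \<open>auto simp: aux_fun_eq\<close>)
  from coord_deriv_along[OF g this] show ?thesis by simp
qed

lemma V_surj: "x \<in> X \<Longrightarrow> \<exists>a. V x a = b"
  using linear_injective_imp_surjective[OF linear_V] linear_injective_0[OF linear_V] V_inj
  by (metis surjE)

text \<open>
  The defining equation of the structure functions in terms of \<open>V\<close>. As \<open>V\<close> is bijective it has exactly one
  solution, so that the definite description in \<open>structure_fun\<close> denotes it.
\<close>

lemma V_structure_fun:
  assumes g: "g \<in> U"
  shows "V (\<phi> g) (\<chi> n. structure_fun m e (U, \<phi>) g j k n)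
    = V2 (\<phi> g) (V (\<phi> g) (axis j 1)) (axis k 1) - V2 (\<phi> g) (V (\<phi> g) (axis k 1)) (axis j 1)"
proof -
  let ?x = "\<phi> g"
  have x: "?x \<in> X" using g by simp
  define w where "w = (\<lambda>j k. V2 ?x (V ?x (axis j 1)) (axis k 1) - V2 ?x (V ?x (axis k 1)) (axis j 1))"
  define P where "P = (\<lambda>C. \<forall>j k i.
       (\<Sum>n\<in>UNIV. aux_fun m e (U, \<phi>) j n g * coord_deriv (U, \<phi>) (aux_fun m e (U, \<phi>) k i) n g)
         - (\<Sum>n\<in>UNIV. aux_fun m e (U, \<phi>) k n g * coord_deriv (U, \<phi>) (aux_fun m e (U, \<phi>) j i) n g)
       = (\<Sum>n\<in>UNIV. C j k n * aux_fun m e (U, \<phi>) n i g))"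
  have P: "P C \<longleftrightarrow> (\<forall>j k. V ?x (\<chi> n. C j k n) = w j k)" for C
  proof -
    have "(\<Sum>n\<in>UNIV. C j k n * aux_fun m e (U, \<phi>) n i g) = V ?x (\<chi> n. C j k n) $ i" for j k i
      using arg_cong[OF linear_axis_sum[OF linear_V[OF x], of "\<chi> n. C j k n"], of "\<lambda>v. v $ i"]
      by (simp add: aux_fun_eq[OF g])
    then show ?thesis
      unfolding P_def aux_fun_deriv[OF g] w_def by (auto simp: vec_eq_iff)
  qed
  define c where "c = (\<lambda>j k. SOME a. V ?x a = w j k)"
  have c: "V ?x (c j k) = w j k" for j k unfolding c_def by (rule someI_ex[OF V_surj[OF x]])
  have inj: "V ?x a = V ?x b \<Longrightarrow> a = b" for a b
    using V_inj[OF x, of "a - b"] linear_diff[OF linear_V[OF x], of a b] by simp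
  have "P (\<lambda>j k n. c j k $ n)" by (simp add: P c)
  moreover have "C = (\<lambda>j k n. c j k $ n)" if "P C" for C
  proof -
    have "(\<chi> n. C j k n) = c j k" for j k
      by (rule inj) (use that c in \<open>simp add: P\<close>)
    then show ?thesis by (metis vec_lambda_beta)
  qed
  ultimately have "P (THE C. P C)" by (rule theI)
  moreover have "structure_fun m e (U, \<phi>) g = (THE C. P C)"
    unfolding structure_fun_def Let_def P_def ..
  ultimately have "P (structure_fun m e (U, \<phi>) g)" by simp
  then show ?thesis by (simp add: P w_def)
qed

abbreviation br where "br x \<equiv> loop_bracket m e (U, \<phi>) (psi x)"

text \<open>
  The bracket is the commutator of the vector fields $x \mapsto V(x)\,a$ and $x \mapsto V(x)\,b$.
\<close>

lemma V_bracket: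
  assumes x: "x \<in> X"
  shows "V x (br x a b) = V2 x (V x a) b - V2 x (V x b) a"
proof -
  let ?c = "\<lambda>j k. \<chi> n. structure_fun m e (U, \<phi>) (psi x) j k n"
  have g: "psi x \<in> U" "\<phi> (psi x) = x" using x chart(6,7) by auto
  have "br x a b = (\<Sum>j\<in>UNIV. \<Sum>k\<in>UNIV. a $ j *\<^sub>R b $ k *\<^sub>R ?c j k)"
    by (simp add: loop_bracket_def vec_eq_iff mult_ac)
  then have "V x (br x a b) = (\<Sum>j\<in>UNIV. \<Sum>k\<in>UNIV. a $ j *\<^sub>R b $ k *\<^sub>R V x (?c j k))"
    by (simp add: linear_sum[OF linear_V[OF x]] linear_scale[OF linear_V[OF x]])
  also have "\<dots> = (\<Sum>j\<in>UNIV. a $ j *\<^sub>R (\<Sum>k\<in>UNIV. b $ k *\<^sub>R V2 x (V x (axis j 1)) (axis k 1)))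
      - (\<Sum>j\<in>UNIV. a $ j *\<^sub>R (\<Sum>k\<in>UNIV. b $ k *\<^sub>R V2 x (V x (axis k 1)) (axis j 1)))"
    using V_structure_fun[OF g(1)]
    by (simp add: g(2) sum_subtractf scaleR_diff_right scaleR_sum_right)
  also have "(\<Sum>j\<in>UNIV. a $ j *\<^sub>R (\<Sum>k\<in>UNIV. b $ k *\<^sub>R V2 x (V x (axis j 1)) (axis k 1)))
      = V2 x (V x a) b"
    by (simp add: linear_axis_sum[OF linear_V2'[OF x]]
        linear_axis_sum[OF linear_compose[OF linear_V[OF x] linear_V2[OF x], unfolded o_def]])
  also have "(\<Sum>j\<in>UNIV. a $ j *\<^sub>R (\<Sum>k\<in>UNIV. b $ k *\<^sub>R V2 x (V x (axis k 1)) (axis j 1)))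
      = V2 x (V x b) a"
    by (simp add: linear_axis_sum[OF linear_V2'[OF x]]
        linear_axis_sum[OF linear_compose[OF linear_V[OF x] linear_V2[OF x], unfolded o_def]])
  finally show ?thesis .
qed

lemma V_cancel: "x \<in> X \<Longrightarrow> V x a = V x b \<Longrightarrow> a = b"
  using V_inj[of x "a - b"] linear_diff[OF linear_V, of x a b] by simp

lemma br_swap:
  assumes x: "x \<in> X" shows "br x a b = - br x b a"
  by (rule V_cancel[OF x]) (simp add: V_bracket[OF x] linear_neg[OF linear_V[OF x]])

lemma bilinear_br: "bilinear (br x)"
  unfolding bilinear_def
  by (auto intro!: linearI simp: loop_bracket_def vec_eq_iff algebra_simps sum.distrib sum_distrib_left)

subsection \<open>The generalized Lie equations\<close>

lemma linear_Ds: "x \<in> X \<Longrightarrow> linear (Ds x)" and linear_Dt: "x \<in> X \<Longrightarrow> linear (Dt x)"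
  using s_deriv t_deriv has_derivative_linear by blast+

abbreviation SS where "SS x \<equiv> lin_S e (U, \<phi>) S T (psi x)"
abbreviation TT where "TT x \<equiv> lin_T e (U, \<phi>) S T (psi x)"

lemma SS_eq: "SS x a = t x ** Ds y0 a ** matrix_inv (t x)"
proof -
  have "coord_deriv (U, \<phi>) S j e = Ds y0 (axis j 1)" for j
    using coord_deriv_eq[of S "Ds y0" e j] s_deriv[OF y0_mem] by (simp add: s_def[abs_def])
  then show ?thesis
    using linear_axis_sum[OF linear_compose[OF linear_Ds[OF y0_mem]
          bounded_linear.linear[OF bounded_linear_sandwich]], of a "t x" "matrix_inv (t x)"]
    by (simp add: lin_S_def dgen_S_def t_def)
qed

lemma TT_eq: "TT x a = matrix_inv (s x) ** Dt y0 a ** s x"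
proof -
  have "coord_deriv (U, \<phi>) T j e = Dt y0 (axis j 1)" for j
    using coord_deriv_eq[of T "Dt y0" e j] t_deriv[OF y0_mem] by (simp add: t_def[abs_def])
  then show ?thesis
    using linear_axis_sum[OF linear_compose[OF linear_Dt[OF y0_mem]
          bounded_linear.linear[OF bounded_linear_sandwich]], of a "matrix_inv (s x)" "s x"]
    by (simp add: lin_T_def dgen_T_def s_def)
qed

text \<open>
  Any formula for $F(gh)$ as a function of $h$ can be differentiated at $h = e$ to obtain the derivative of $F$
  along the vector field of a tangent vector.
\<close>

lemma translate_deriv:
  fixes F :: "'g \<Rightarrow> 'k^'n^'n"
  assumes x: "x \<in> X"
    and F: "((\<lambda>x. F (psi x)) has_derivative F') (at x)"
    and eq: "\<And>y. F (psi x \<odot> psi y) = G y"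
    and G: "(G has_derivative G') (at y0)"
  shows "F' (V x a) = G' a"
proof -
  have "\<phi> (psi x \<odot> psi y0) = x" using chart(6)[OF x] by (simp add: psi_y0 unit_right)
  then have "((\<lambda>y. F (psi (\<phi> (psi x \<odot> psi y)))) has_derivative (\<lambda>h. F' (V x h))) (at y0)"
    using has_derivative_compose[OF mult_deriv[OF x], of "\<lambda>x. F (psi x)" F'] F by simp
  then have "(G has_derivative (\<lambda>h. F' (V x h))) (at y0)"
    by (rule has_derivative_transform_within_open[OF _ near_unit[OF x]])
      (auto simp: chart(5) simp flip: eq)
  then show ?thesis using has_derivative_unique[OF _ G] by metis
qed

lemmas s_deriv_psi = s_deriv[unfolded s_def[abs_def]] and t_deriv_psi = t_deriv[unfolded t_def[abs_def]]

lemma lie_S: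
  assumes x: "x \<in> X" shows "Ds x (V x a) = s x ** SS x a"
proof -
  have "Ds x (V x a) = (t x ** s x) ** Ds y0 a ** matrix_inv (t x)"
    by (rule translate_deriv[OF x s_deriv_psi[OF x] _ bounded_linear.has_derivative[OF bounded_linear_sandwich s_deriv[OF y0_mem]]])
      (simp add: S_mult s_def t_def)
  then show ?thesis by (simp add: SS_eq matrix_mul_assoc) (simp add: s_def t_def TS_commute)
qed

lemma lie_T:
  assumes x: "x \<in> X" shows "Dt x (V x a) = TT x a ** t x"
proof -
  have "Dt x (V x a) = matrix_inv (s x) ** Dt y0 a ** (s x ** t x)"
    by (rule translate_deriv[OF x t_deriv_psi[OF x] _ bounded_linear.has_derivative[OF bounded_linear_sandwich t_deriv[OF y0_mem]]])
      (simp add: T_mult' s_def t_def matrix_mul_assoc)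
  then show ?thesis by (simp add: TT_eq matrix_mul_assoc)
qed

text \<open>
  Differentiating \<open>T_mult\<close> instead of \<open>T_mult'\<close> gives $D_a T = (S_a + T_a) T - T S_a$ with generators at the unit;
  comparison with \<open>lie_T\<close> gives the claim.
\<close>

lemma sum_const:
  assumes x: "x \<in> X" shows "SS x a + TT x a = Ds y0 a + Dt y0 a"
proof -
  have d: "((\<lambda>y. s y ** t y ** t x ** matrix_inv (s y)) has_derivative
      (\<lambda>h. s y0 ** t y0 ** t x ** (- (matrix_inv (s y0) ** Ds y0 h ** matrix_inv (s y0)))
        + (s y0 ** t y0 ** 0 + (s y0 ** Dt y0 h + Ds y0 h ** t y0) ** t x) ** matrix_inv (s y0))) (at y0)"
    by (intro has_derivative_matrix_mult has_derivative_matrix_inv_compose s_deriv t_deriv y0_mem inv_s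
        has_derivative_const)
  have "Dt x (V x a) = s y0 ** t y0 ** t x ** (- (matrix_inv (s y0) ** Ds y0 a ** matrix_inv (s y0)))
        + (s y0 ** t y0 ** 0 + (s y0 ** Dt y0 a + Ds y0 a ** t y0) ** t x) ** matrix_inv (s y0)"
    by (rule translate_deriv[OF x t_deriv_psi[OF x] _ d]) (simp add: T_mult s_def t_def)
  moreover have "matrix_inv (mat 1 :: 'k^'n^'n) = mat 1" by (simp add: matrix_inv_eqI)
  ultimately have "TT x a ** t x = Dt y0 a ** t x + Ds y0 a ** t x - t x ** Ds y0 a"
    by (simp add: lie_T[OF x] s_y0 t_y0 mat_simps)
  then have "TT x a ** t x ** matrix_inv (t x) = Dt y0 a + Ds y0 a - SS x a"
    by (simp add: SS_eq mat_simps matrix_inv_cancel inv_t)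
  then show ?thesis by (simp add: matrix_inv_cancel inv_t algebra_simps)
qed

subsection \<open>Derivatives of the derivative generators\<close>

text \<open>
  The differential as a whole has a clumsy form, but along the vector fields the Lie equations turn it into a commutator;
  this is also the reason for the shape of the next lemma.
\<close>

lemma SS_deriv:
  assumes x: "x \<in> X"
  obtains D where "((\<lambda>p. SS p b) has_derivative D) (at x)"
    "\<And>a. D (V x a) = commutator (TT x a) (SS x b)"
proof
  show "((\<lambda>p. SS p b) has_derivative (\<lambda>\<eta>. t x ** Ds y0 b ** (- (matrix_inv (t x) ** Dt x \<eta> ** matrix_inv (t x)))
      + (t x ** 0 + Dt x \<eta> ** Ds y0 b) ** matrix_inv (t x))) (at x)"
    unfolding SS_eq
    by (intro has_derivative_matrix_mult has_derivative_matrix_inv_compose t_deriv x inv_t has_derivative_const)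
  show "t x ** Ds y0 b ** (- (matrix_inv (t x) ** Dt x (V x a) ** matrix_inv (t x)))
      + (t x ** 0 + Dt x (V x a) ** Ds y0 b) ** matrix_inv (t x) = commutator (TT x a) (SS x b)" for a
    by (simp add: lie_T[OF x] SS_eq[of x b] commutator_def mat_simps matrix_inv_cancel inv_t)
qed

lemma TT_deriv:
  assumes x: "x \<in> X"
  obtains D where "((\<lambda>p. TT p b) has_derivative D) (at x)"
    "\<And>a. D (V x a) = - commutator (SS x a) (TT x b)"
proof
  show "((\<lambda>p. TT p b) has_derivative (\<lambda>\<eta>. matrix_inv (s x) ** Dt y0 b ** Ds x \<eta>
      + (matrix_inv (s x) ** 0 + (- (matrix_inv (s x) ** Ds x \<eta> ** matrix_inv (s x))) ** Dt y0 b) ** s x)) (at x)"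
    unfolding TT_eq
    by (intro has_derivative_matrix_mult has_derivative_matrix_inv_compose s_deriv x inv_s has_derivative_const)
  show "matrix_inv (s x) ** Dt y0 b ** Ds x (V x a)
      + (matrix_inv (s x) ** 0 + (- (matrix_inv (s x) ** Ds x (V x a) ** matrix_inv (s x))) ** Dt y0 b) ** s x
      = - commutator (SS x a) (TT x b)" for a
    by (simp add: lie_S[OF x] TT_eq[of x b] commutator_def mat_simps matrix_inv_cancel inv_s
        matrix_inv_left)
qed

text \<open>
  The derivative of the constant in \<open>sum_const\<close> vanishes.
\<close>

lemma mixed_swap:
  assumes x: "x \<in> X" shows "commutator (SS x a) (TT x b) = commutator (TT x a) (SS x b)"
proof -
  obtain D where D: "((\<lambda>p. SS p b) has_derivative D) (at x)" "\<And>a. D (V x a) = commutator (TT x a) (SS x b)"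
    using SS_deriv[OF x] by blast
  obtain E where E: "((\<lambda>p. TT p b) has_derivative E) (at x)" "\<And>a. E (V x a) = - commutator (SS x a) (TT x b)"
    using TT_deriv[OF x] by blast
  have "((\<lambda>p. SS p b + TT p b) has_derivative (\<lambda>h. D h + E h)) (at x)"
    by (intro has_derivative_add D E)
  then have "((\<lambda>p. Ds y0 b + Dt y0 b) has_derivative (\<lambda>h. D h + E h)) (at x)"
    by (rule has_derivative_transform_within_open[OF _ chart(2) x]) (simp add: sum_const)
  then have "(\<lambda>h. D h + E h) = (\<lambda>h. 0)"
    by (rule has_derivative_unique[OF _ has_derivative_const])
  from fun_cong[OF this, of "V x a"] show ?thesis by (simp add: D(2) E(2))
qed

text \<open>
  The rule $D_a D_b - D_b D_a = D_{[a,b]}$: the second derivatives of the function cancel by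
  symmetry and the derivatives of the vector fields combine to \<open>V_bracket\<close>. Here \<open>G b\<close> is an expression that
  agrees with $D_b$ of the function.
\<close>

lemma bracket_of_derivatives:
  assumes x: "x \<in> X"
    and lin: "\<And>p. p \<in> X \<Longrightarrow> linear (f' p)"
    and f2: "\<And>a. ((\<lambda>p. f' p a) has_derivative (\<lambda>\<eta>. f2 \<eta> a)) (at x)"
    and sym: "\<And>\<eta> \<xi>. f2 \<eta> \<xi> = f2 \<xi> \<eta>"
    and G: "\<And>b p. p \<in> X \<Longrightarrow> G b p = f' p (V p b)"
    and DG: "(G a has_derivative DGa) (at x)" "(G b has_derivative DGb) (at x)"
  shows "DGb (V x a) - DGa (V x b) = f' x (V x (br x a b))"
proof -
  have lin2: "linear (\<lambda>\<eta>. f2 \<eta> a)" for a using f2 has_derivative_linear by blast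
  have lin2': "linear (f2 \<eta>)" for \<eta>
  proof -
    have "(\<lambda>\<xi>. f2 \<xi> \<eta>) = f2 \<eta>" by (rule ext, rule sym)
    then show ?thesis using lin2[of \<eta>] by simp
  qed
  have der: "D \<eta> = f2 \<eta> (V x b) + f' x (V2 x \<eta> b)" if D: "(G b has_derivative D) (at x)" for b D \<eta>
  proof -
    have "((\<lambda>p. \<Sum>j\<in>UNIV. V p b $ j *\<^sub>R f' p (axis j 1)) has_derivative
      (\<lambda>\<eta>. \<Sum>j\<in>UNIV. V x b $ j *\<^sub>R f2 \<eta> (axis j 1) + V2 x \<eta> b $ j *\<^sub>R f' x (axis j 1))) (at x)"
      by (intro has_derivative_sum has_derivative_scaleR f2
          bounded_linear.has_derivative[OF bounded_linear_vec_nth V_deriv] x)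
    then have "(G b has_derivative
      (\<lambda>\<eta>. \<Sum>j\<in>UNIV. V x b $ j *\<^sub>R f2 \<eta> (axis j 1) + V2 x \<eta> b $ j *\<^sub>R f' x (axis j 1))) (at x)"
      by (rule has_derivative_transform_within_open[OF _ chart(2) x])
        (simp add: G linear_axis_sum[OF lin])
    from fun_cong[OF has_derivative_unique[OF D this], of \<eta>] show ?thesis
      by (simp add: sum.distrib linear_axis_sum[OF lin2'] linear_axis_sum[OF lin[OF x]])
  qed
  have "DGb (V x a) - DGa (V x b) = f' x (V2 x (V x a) b) - f' x (V2 x (V x b) a)"
    using der[OF DG(1), of "V x b"] der[OF DG(2), of "V x a"] sym[of "V x a" "V x b"] by simp
  then show ?thesis by (simp add: V_bracket[OF x] linear_diff[OF lin[OF x]])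
qed

lemma FS_deriv:
  assumes x: "x \<in> X"
  obtains D where "((\<lambda>p. s p ** SS p b) has_derivative D) (at x)"
    "\<And>a. D (V x a) = s x ** (SS x a ** SS x b + commutator (TT x a) (SS x b))"
proof -
  obtain D where D: "((\<lambda>p. SS p b) has_derivative D) (at x)" "\<And>a. D (V x a) = commutator (TT x a) (SS x b)"
    using SS_deriv[OF x] by blast
  show ?thesis
    by (rule that[OF has_derivative_matrix_mult[OF s_deriv[OF x] D(1)]])
      (simp add: D(2) lie_S[OF x] mat_add matrix_mul_assoc)
qed

lemma FT_deriv:
  assumes x: "x \<in> X"
  obtains D where "((\<lambda>p. TT p b ** t p) has_derivative D) (at x)"
    "\<And>a. D (V x a) = (TT x b ** TT x a - commutator (SS x a) (TT x b)) ** t x"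
proof -
  obtain D where D: "((\<lambda>p. TT p b) has_derivative D) (at x)" "\<And>a. D (V x a) = - commutator (SS x a) (TT x b)"
    using TT_deriv[OF x] by blast
  show ?thesis
    by (rule that[OF has_derivative_matrix_mult[OF D(1) t_deriv[OF x]]])
      (simp add: D(2) lie_T[OF x] mat_simps)
qed

lemma FS_bracket:
  assumes x: "x \<in> X"
    and D: "((\<lambda>p. s p ** SS p a) has_derivative Da) (at x)" "((\<lambda>p. s p ** SS p b) has_derivative Db) (at x)"
  shows "Db (V x a) - Da (V x b) = s x ** SS x (br x a b)"
  using bracket_of_derivatives[OF x linear_Ds Ds_deriv[OF x] Ds2_sym[OF x] lie_S[symmetric] D]
  by (simp add: lie_S[OF x])

lemma FT_bracket:
  assumes x: "x \<in> X"
    and D: "((\<lambda>p. TT p a ** t p) has_derivative Da) (at x)" "((\<lambda>p. TT p b ** t p) has_derivative Db) (at x)"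
  shows "Db (V x a) - Da (V x b) = TT x (br x a b) ** t x"
  using bracket_of_derivatives[OF x linear_Dt Dt_deriv[OF x] Dt2_sym[OF x] lie_T[symmetric] D]
  by (simp add: lie_T[OF x])

lemma integr_SS:
  assumes x: "x \<in> X"
  shows "commutator (SS x a) (SS x b) + 2 *\<^sub>R commutator (SS x a) (TT x b) = SS x (br x a b)"
proof -
  obtain Da where Da: "((\<lambda>p. s p ** SS p a) has_derivative Da) (at x)"
    "\<And>b. Da (V x b) = s x ** (SS x b ** SS x a + commutator (TT x b) (SS x a))"
    using FS_deriv[OF x] by blast
  obtain Db where Db: "((\<lambda>p. s p ** SS p b) has_derivative Db) (at x)"
    "\<And>a. Db (V x a) = s x ** (SS x a ** SS x b + commutator (TT x a) (SS x b))"
    using FS_deriv[OF x] by blast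
  have swap: "commutator (TT x b) (SS x a) = - commutator (SS x a) (TT x b)"
    by (rule commutator_swap)
  note mixed = mixed_swap[OF x, of a b, symmetric]
  let ?C = "commutator (SS x a) (TT x b)"
  have "s x ** (SS x a ** SS x b + ?C - (SS x b ** SS x a + - ?C)) = s x ** SS x (br x a b)"
    using FS_bracket[OF x Da(1) Db(1)] unfolding Da(2) Db(2) swap mixed
    by (simp only: mat_diff)
  then have "SS x a ** SS x b + ?C - (SS x b ** SS x a + - ?C) = SS x (br x a b)"
    by (metis matrix_inv_cancel(1) inv_s)
  then show ?thesis by (simp add: commutator_def[of "SS x a" "SS x b"] scaleR_2 algebra_simps)
qed

lemma integr_TT:
  assumes x: "x \<in> X"
  shows "commutator (TT x a) (TT x b) + 2 *\<^sub>R commutator (SS x a) (TT x b) = - TT x (br x a b)"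
proof -
  obtain Da where Da: "((\<lambda>p. TT p a ** t p) has_derivative Da) (at x)"
    "\<And>b. Da (V x b) = (TT x a ** TT x b - commutator (SS x b) (TT x a)) ** t x"
    using FT_deriv[OF x] by blast
  obtain Db where Db: "((\<lambda>p. TT p b ** t p) has_derivative Db) (at x)"
    "\<And>a. Db (V x a) = (TT x b ** TT x a - commutator (SS x a) (TT x b)) ** t x"
    using FT_deriv[OF x] by blast
  have swap: "commutator (SS x b) (TT x a) = - commutator (SS x a) (TT x b)"
    by (metis commutator_swap mixed_swap[OF x])
  let ?C = "commutator (SS x a) (TT x b)"
  have "(TT x b ** TT x a - ?C - (TT x a ** TT x b - - ?C)) ** t x = TT x (br x a b) ** t x"
    using FT_bracket[OF x Da(1) Db(1)] unfolding Da(2) Db(2) swap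
    by (simp only: mat_diff)
  then have "TT x b ** TT x a - ?C - (TT x a ** TT x b - - ?C) = TT x (br x a b)"
    by (metis matrix_inv_cancel(3) inv_t)
  from this[symmetric] show ?thesis
    by (simp add: commutator_def[of "TT x a" "TT x b"] scaleR_2 algebra_simps)
qed

lemma linear_SS: "linear (SS x)" and linear_TT: "linear (TT x)"
  by (auto intro!: linearI simp: lin_S_def lin_T_def scaleR_add_left sum.distrib scaleR_sum_right)

lemma relations_at:
  assumes x: "x \<in> X"
  shows "moufang_relations (SS x) (TT x) (br x)"
  by (rule moufang_relations.intro; fact linear_SS linear_TT bilinear_br br_swap[OF x] mixed_swap[OF x]
      integr_SS[OF x] integr_TT[OF x])

lemma dgen_lin: "dgen_S e (U, \<phi>) S T j g = lin_S e (U, \<phi>) S T g (axis j 1)"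
  "dgen_T e (U, \<phi>) S T j g = lin_T e (U, \<phi>) S T g (axis j 1)"
  by (simp_all add: lin_S_def lin_T_def axis_def if_distrib[of "\<lambda>c. c *\<^sub>R _"] cong: if_cong)

lemma lie_equations_at:
  assumes g: "g \<in> U" shows "generalized_lie_equations m e (U, \<phi>) S T g"
proof -
  have x: "\<phi> g \<in> X" and gx: "psi (\<phi> g) = g" using g chart(5) by auto
  have "((\<lambda>x. S (psi x)) has_derivative Ds (\<phi> g)) (at (\<phi> g))" "((\<lambda>x. T (psi x)) has_derivative Dt (\<phi> g)) (at (\<phi> g))"
    using s_deriv[OF x] t_deriv[OF x] by (simp_all add: s_def[abs_def] t_def[abs_def])
  from this[THEN coord_deriv_along[OF g]] show ?thesis
    using lie_S[OF x] lie_T[OF x]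
    by (simp add: generalized_lie_equations_def dgen_lin gx s_def t_def)
qed

lemma integrability_at:
  assumes g: "g \<in> U" shows "integrability_conditions m e (U, \<phi>) S T g"
proof -
  have x: "\<phi> g \<in> X" and gx: "psi (\<phi> g) = g" using g chart(5) by auto
  let ?FS = "\<lambda>j g. S g ** dgen_S e (U, \<phi>) S T j g"
  let ?FT = "\<lambda>j g. dgen_T e (U, \<phi>) S T j g ** T g"
  let ?v = "aux_fun m e (U, \<phi>)" and ?C = "structure_fun m e (U, \<phi>) g"
  have br: "br (\<phi> g) (axis j 1) (axis k 1) = (\<chi> n. ?C j k n)" for j k
    by (simp add: loop_bracket_def gx axis_def if_distrib[of "\<lambda>c. _ * c"] vec_eq_iff cong: if_cong)
  have FS: "(\<Sum>n\<in>UNIV. ?C j k n *\<^sub>R ?FS n g) = s (\<phi> g) ** SS (\<phi> g) (br (\<phi> g) (axis j 1) (axis k 1))" for j k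
    unfolding br by (simp add: s_def gx lin_S_def mat_sum mat_scaleR)
  have FT: "(\<Sum>n\<in>UNIV. ?C j k n *\<^sub>R ?FT n g) = TT (\<phi> g) (br (\<phi> g) (axis j 1) (axis k 1)) ** t (\<phi> g)" for j k
    unfolding br by (simp add: t_def gx lin_T_def mat_sum mat_scaleR)
  have "(\<Sum>n\<in>UNIV. ?v j n g *\<^sub>R coord_deriv (U, \<phi>) (?FS k) n g)
         - (\<Sum>n\<in>UNIV. ?v k n g *\<^sub>R coord_deriv (U, \<phi>) (?FS j) n g)
         = (\<Sum>n\<in>UNIV. ?C j k n *\<^sub>R ?FS n g)" for j k
  proof -
    obtain Dj where Dj: "((\<lambda>p. s p ** SS p (axis j 1)) has_derivative Dj) (at (\<phi> g))"
      using FS_deriv[OF x] by blast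
    obtain Dk where Dk: "((\<lambda>p. s p ** SS p (axis k 1)) has_derivative Dk) (at (\<phi> g))"
      using FS_deriv[OF x] by blast
    have "((\<lambda>x. ?FS j (psi x)) has_derivative Dj) (at (\<phi> g))" "((\<lambda>x. ?FS k (psi x)) has_derivative Dk) (at (\<phi> g))"
      using Dj Dk by (simp_all add: dgen_lin s_def)
    from this[THEN coord_deriv_along[OF g]] FS_bracket[OF x Dj Dk] FS show ?thesis by metis
  qed
  moreover have "(\<Sum>n\<in>UNIV. ?v j n g *\<^sub>R coord_deriv (U, \<phi>) (?FT k) n g)
         - (\<Sum>n\<in>UNIV. ?v k n g *\<^sub>R coord_deriv (U, \<phi>) (?FT j) n g)
         = (\<Sum>n\<in>UNIV. ?C j k n *\<^sub>R ?FT n g)" for j k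
  proof -
    obtain Dj where Dj: "((\<lambda>p. TT p (axis j 1) ** t p) has_derivative Dj) (at (\<phi> g))"
      using FT_deriv[OF x] by blast
    obtain Dk where Dk: "((\<lambda>p. TT p (axis k 1) ** t p) has_derivative Dk) (at (\<phi> g))"
      using FT_deriv[OF x] by blast
    have "((\<lambda>x. ?FT j (psi x)) has_derivative Dj) (at (\<phi> g))" "((\<lambda>x. ?FT k (psi x)) has_derivative Dk) (at (\<phi> g))"
      using Dj Dk by (simp_all add: dgen_lin t_def)
    from this[THEN coord_deriv_along[OF g]] FT_bracket[OF x Dj Dk] FT show ?thesis by metis
  qed
  ultimately show ?thesis unfolding integrability_conditions_def Let_def by blast
qed

end

section \<open>The Lie algebra of a matrix group\<close>

lemma subspace_projection:
  fixes M :: "'a::euclidean_space set"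
  assumes "subspace M"
  shows "\<exists>\<pi> B. linear \<pi> \<and> (\<forall>x. \<pi> x = 0 \<longleftrightarrow> x \<in> M) \<and> (\<forall>x. x - \<pi> x \<in> M) \<and>
    finite B \<and> B \<subseteq> M \<and> (\<forall>x. \<pi> x = x - (\<Sum>b\<in>B. (x \<bullet> b) *\<^sub>R b))"
proof -
  obtain B where B: "B \<subseteq> M" "pairwise orthogonal B" "\<And>x. x \<in> B \<Longrightarrow> norm x = 1" "independent B" "span B = M"
    using orthonormal_basis_subspace[OF assms] by metis
  have fin: "finite B" using B(4) by (simp add: independent_imp_finite)
  define \<pi> where "\<pi> = (\<lambda>x. x - (\<Sum>b\<in>B. (x \<bullet> b) *\<^sub>R b))"
  have lin: "linear \<pi>"
    by (auto intro!: linearI simp: \<pi>_def inner_add_left scaleR_add_left sum.distrib scaleR_diff_right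
        scaleR_sum_right)
  have sub: "x - \<pi> x \<in> M" for x
    using B(1) assms by (auto simp: \<pi>_def intro!: subspace_sum subspace_scale)
  have zero: "\<pi> c = 0" if "c \<in> B" for c
  proof -
    have "(\<Sum>b\<in>B. (c \<bullet> b) *\<^sub>R b) = (\<Sum>b\<in>B. if b = c then c else 0)"
    proof (rule sum.cong)
      fix b assume "b \<in> B"
      show "(c \<bullet> b) *\<^sub>R b = (if b = c then c else 0)"
      proof (cases "b = c")
        case True
        then show ?thesis using B(3)[OF that] by (simp add: power2_norm_eq_inner[symmetric])
      next
        case False
        then have "orthogonal c b" using B(2) that \<open>b \<in> B\<close> by (auto simp: pairwise_def)
        then show ?thesis using False by (simp add: orthogonal_def)
      qed
    qed simp
    also have "\<dots> = c" using fin that by simp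
    finally show ?thesis by (simp add: \<pi>_def)
  qed
  have "\<pi> x = 0" if "x \<in> M" for x
    using that linear_eq_0_on_span[OF lin zero] by (simp add: B(5)[symmetric])
  moreover have "x \<in> M" if "\<pi> x = 0" for x using sub[of x] that by simp
  ultimately have "\<pi> x = 0 \<longleftrightarrow> x \<in> M" for x by blast
  with lin sub fin B(1) \<pi>_def show ?thesis by blast
qed

text \<open>
  Linear subspaces of a Euclidean space are closed.
\<close>

lemma derivative_in_subspace:
  fixes Z :: "real \<Rightarrow> 'a::euclidean_space"
  assumes "subspace M" "open I" "\<tau> \<in> I" "\<And>\<sigma>. \<sigma> \<in> I \<Longrightarrow> Z \<sigma> \<in> M"
    and Z: "(Z has_vector_derivative Z') (at \<tau>)"
  shows "Z' \<in> M"
proof -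
  obtain \<pi> :: "'a \<Rightarrow> 'a" where \<pi>: "linear \<pi>" "\<And>x. \<pi> x = 0 \<longleftrightarrow> x \<in> M"
    using subspace_projection[OF assms(1)] by blast
  have "((\<lambda>\<sigma>. \<pi> (Z \<sigma>)) has_vector_derivative \<pi> Z') (at \<tau>)"
    by (rule bounded_linear.has_vector_derivative[OF linear_conv_bounded_linear[THEN iffD1, OF \<pi>(1)] Z])
  then have "((\<lambda>\<sigma>. 0) has_vector_derivative \<pi> Z') (at \<tau>)"
    by (rule has_vector_derivative_transform_within_open[OF _ assms(2,3)]) (simp add: \<pi>(2) assms(4))
  then have "\<pi> Z' = 0" by (rule vector_derivative_unique_at[OF _ has_vector_derivative_const])
  then show ?thesis by (simp add: \<pi>(2))
qed

lemma linear_injective_on_subspace_surj: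
  fixes f :: "'a::euclidean_space \<Rightarrow> 'a"
  assumes f: "linear f" and M: "subspace M" and into: "\<And>x. x \<in> M \<Longrightarrow> f x \<in> M"
    and inj: "\<And>x. x \<in> M \<Longrightarrow> f x = 0 \<Longrightarrow> x = 0"
  shows "f ` M = M"
proof (rule subspace_dim_equal)
  have "inj_on f M"
  proof (rule inj_onI)
    fix x y assume "x \<in> M" "y \<in> M" "f x = f y"
    then show "x = y" using inj[of "x - y"] linear_diff[OF f, of x y] subspace_diff[OF M] by auto
  qed
  moreover have "span M = M" using M by (simp add: span_eq_iff)
  ultimately have "inj_on f (span M)" by metis
  then show "dim (f ` M) \<ge> dim M" by (simp add: dim_image_eq[OF f])
  show "subspace (f ` M)" by (rule linear_subspace_image[OF f M])
qed (use M into in auto)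

text \<open>
  Conjugation is injective, so on an invariant subspace of finite dimension it is also onto.
\<close>

lemma conjugation_inverse_invariant:
  fixes M :: "('k::{real_normed_field, euclidean_space}^'n^'n::finite) set"
  assumes M: "subspace M" and P: "invertible P"
    and Ad: "\<And>Q. Q \<in> M \<Longrightarrow> P ** Q ** matrix_inv P \<in> M" and "Q \<in> M"
  shows "matrix_inv P ** Q ** P \<in> M"
proof -
  have "(\<lambda>Q. P ** Q ** matrix_inv P) ` M = M"
  proof (rule linear_injective_on_subspace_surj[OF bounded_linear.linear[OF bounded_linear_sandwich] M Ad])
    fix Q assume "P ** Q ** matrix_inv P = 0"
    then have "matrix_inv P ** (P ** Q ** matrix_inv P) ** P = 0" by (simp add: mat_zero)
    then show "Q = 0" using P by (simp add: matrix_mul_assoc matrix_inv_left matrix_inv_cancel)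
  qed
  then obtain R where "R \<in> M" "Q = P ** R ** matrix_inv P" using \<open>Q \<in> M\<close> by blast
  then show ?thesis using P by (simp add: matrix_mul_assoc matrix_inv_left matrix_inv_cancel)
qed

text \<open>
  A group of matrices, not assumed closed, with a space \<open>L\<close> that it normalizes: the candidate for its Lie algebra.
\<close>

locale invariant_matrix_group =
  fixes L K :: "('k::{real_normed_field, euclidean_space}^'n^'n::finite) set"
  assumes sub_L: "subspace L"
    and one_K: "mat 1 \<in> K"
    and mult_K: "P \<in> K \<Longrightarrow> Q \<in> K \<Longrightarrow> P ** Q \<in> K"
    and inv_K: "P \<in> K \<Longrightarrow> matrix_inv P \<in> K"
    and K_invertible: "P \<in> K \<Longrightarrow> invertible P"
    and Ad_L: "P \<in> K \<Longrightarrow> B \<in> L \<Longrightarrow> P ** B ** matrix_inv P \<in> L"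
begin

lemma Ad_L': "P \<in> K \<Longrightarrow> B \<in> L \<Longrightarrow> matrix_inv P ** B ** P \<in> L"
  using Ad_L[OF inv_K] by (simp add: matrix_inv_matrix_inv K_invertible)

text \<open>
  Curves in the group that are tangent to the distribution $P \mapsto P L$. Invariance of \<open>L\<close> makes pointwise products and
  inverses of such curves horizontal again.
\<close>

definition horizontal ::
  "(real \<Rightarrow> 'k^'n^'n) \<Rightarrow> (real \<Rightarrow> 'k^'n^'n) \<Rightarrow> real set \<Rightarrow> bool" where
  "horizontal \<gamma> \<gamma>' I \<longleftrightarrow> continuous_on I \<gamma>' \<and>
    (\<forall>\<tau>\<in>I. \<gamma> \<tau> \<in> K \<and> (\<gamma> has_vector_derivative \<gamma>' \<tau>) (at \<tau> within I) \<and> matrix_inv (\<gamma> \<tau>) ** \<gamma>' \<tau> \<in> L)"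

lemma horizontalD:
  assumes "horizontal \<gamma> \<gamma>' I"
  shows "continuous_on I \<gamma>'" "\<tau> \<in> I \<Longrightarrow> \<gamma> \<tau> \<in> K"
    "\<tau> \<in> I \<Longrightarrow> (\<gamma> has_vector_derivative \<gamma>' \<tau>) (at \<tau> within I)"
    "\<tau> \<in> I \<Longrightarrow> matrix_inv (\<gamma> \<tau>) ** \<gamma>' \<tau> \<in> L" "continuous_on I \<gamma>"
  using assms unfolding horizontal_def
  by (auto simp: continuous_on_eq_continuous_within intro: has_vector_derivative_continuous)

lemma horizontal_const: "P \<in> K \<Longrightarrow> horizontal (\<lambda>_. P) (\<lambda>_. 0) I"
  by (simp add: horizontal_def mat_zero subspace_0[OF sub_L])

lemma horizontal_subset: "horizontal \<gamma> \<gamma>' I \<Longrightarrow> J \<subseteq> I \<Longrightarrow> horizontal \<gamma> \<gamma>' J"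
  unfolding horizontal_def
  by (meson continuous_on_subset has_vector_derivative_within_subset subsetD)

lemma horizontal_mult:
  assumes P: "horizontal P P' I" and Q: "horizontal Q Q' I"
  shows "horizontal (\<lambda>\<tau>. P \<tau> ** Q \<tau>) (\<lambda>\<tau>. P \<tau> ** Q' \<tau> + P' \<tau> ** Q \<tau>) I"
  unfolding horizontal_def
proof (intro conjI ballI)
  show "continuous_on I (\<lambda>\<tau>. P \<tau> ** Q' \<tau> + P' \<tau> ** Q \<tau>)"
    by (intro continuous_intros horizontalD[OF P] horizontalD[OF Q])
  fix \<tau> assume \<tau>: "\<tau> \<in> I"
  show "P \<tau> ** Q \<tau> \<in> K" using horizontalD(2)[OF P \<tau>] horizontalD(2)[OF Q \<tau>] by (rule mult_K)
  show "((\<lambda>\<tau>. P \<tau> ** Q \<tau>) has_vector_derivative P \<tau> ** Q' \<tau> + P' \<tau> ** Q \<tau>) (at \<tau> within I)"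
    by (rule has_vector_derivative_matrix_mult[OF horizontalD(3)[OF P \<tau>] horizontalD(3)[OF Q \<tau>]])
  have inv: "invertible (P \<tau>)" "invertible (Q \<tau>)"
    using horizontalD(2)[OF P \<tau>] horizontalD(2)[OF Q \<tau>] K_invertible by auto
  have "matrix_inv (P \<tau> ** Q \<tau>) ** (P \<tau> ** Q' \<tau> + P' \<tau> ** Q \<tau>)
      = matrix_inv (Q \<tau>) ** Q' \<tau> + matrix_inv (Q \<tau>) ** (matrix_inv (P \<tau>) ** P' \<tau>) ** Q \<tau>"
    using inv by (simp add: matrix_inv_mult mat_simps matrix_inv_cancel)
  also have "\<dots> \<in> L"
    by (intro subspace_add[OF sub_L] Ad_L' horizontalD(2)[OF Q \<tau>] horizontalD(4)[OF P \<tau>] horizontalD(4)[OF Q \<tau>])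
  finally show "matrix_inv (P \<tau> ** Q \<tau>) ** (P \<tau> ** Q' \<tau> + P' \<tau> ** Q \<tau>) \<in> L" .
qed

lemma horizontal_inverse:
  assumes P: "horizontal P P' I"
  shows "horizontal (\<lambda>\<tau>. matrix_inv (P \<tau>)) (\<lambda>\<tau>. - (matrix_inv (P \<tau>) ** P' \<tau> ** matrix_inv (P \<tau>))) I"
  unfolding horizontal_def
proof (intro conjI ballI)
  have inv: "invertible (P \<tau>)" if "\<tau> \<in> I" for \<tau> using horizontalD(2)[OF P that] K_invertible by auto
  show "continuous_on I (\<lambda>\<tau>. - (matrix_inv (P \<tau>) ** P' \<tau> ** matrix_inv (P \<tau>)))"
    by (intro continuous_intros horizontalD[OF P] continuous_on_matrix_inv inv)
  fix \<tau> assume \<tau>: "\<tau> \<in> I"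
  show "matrix_inv (P \<tau>) \<in> K" using horizontalD(2)[OF P \<tau>] by (rule inv_K)
  show "((\<lambda>\<tau>. matrix_inv (P \<tau>)) has_vector_derivative - (matrix_inv (P \<tau>) ** P' \<tau> ** matrix_inv (P \<tau>)))
      (at \<tau> within I)"
    by (rule has_vector_derivative_matrix_inv[OF horizontalD(3)[OF P \<tau>] inv \<tau>])
  have "matrix_inv (matrix_inv (P \<tau>)) ** - (matrix_inv (P \<tau>) ** P' \<tau> ** matrix_inv (P \<tau>))
      = - (P \<tau> ** (matrix_inv (P \<tau>) ** P' \<tau>) ** matrix_inv (P \<tau>))"
    using inv[OF \<tau>] by (simp add: matrix_inv_matrix_inv mat_simps)
  also have "\<dots> \<in> L"
    by (intro subspace_neg[OF sub_L] Ad_L horizontalD(2)[OF P \<tau>] horizontalD(4)[OF P \<tau>])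
  finally show "matrix_inv (matrix_inv (P \<tau>)) ** - (matrix_inv (P \<tau>) ** P' \<tau> ** matrix_inv (P \<tau>)) \<in> L" .
qed

text \<open>
  The Lie algebra of the group computed with horizontal curves only. The remainder of this part
  shows that arbitrary curves give nothing more.
\<close>

definition velocities :: "('k^'n^'n) set" where
  "velocities = {B. \<exists>\<gamma> \<gamma>' \<epsilon>. \<epsilon> > 0 \<and> horizontal \<gamma> \<gamma>' {-\<epsilon><..<\<epsilon>} \<and> \<gamma> 0 = mat 1 \<and> \<gamma>' 0 = B}"

lemma velocitiesI:
  "\<epsilon> > 0 \<Longrightarrow> horizontal \<gamma> \<gamma>' {-\<epsilon><..<\<epsilon>} \<Longrightarrow> \<gamma> 0 = mat 1 \<Longrightarrow> \<gamma>' 0 = B \<Longrightarrow> B \<in> velocities"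
  unfolding velocities_def by blast

lemma velocitiesE:
  assumes "B \<in> velocities"
  obtains \<gamma> \<gamma>' \<epsilon> where "\<epsilon> > 0" "horizontal \<gamma> \<gamma>' {-\<epsilon><..<\<epsilon>}" "\<gamma> 0 = mat 1" "\<gamma>' 0 = B"
  using assms unfolding velocities_def by blast

lemma velocities_Ad:
  assumes "P \<in> K" "B \<in> velocities" shows "P ** B ** matrix_inv P \<in> velocities"
proof -
  obtain \<gamma> \<gamma>' \<epsilon> where \<gamma>: "\<epsilon> > 0" "horizontal \<gamma> \<gamma>' {-\<epsilon><..<\<epsilon>}" "\<gamma> 0 = mat 1" "\<gamma>' 0 = B"
    using assms(2) by (rule velocitiesE)
  show ?thesis
    by (rule velocitiesI[OF \<gamma>(1) horizontal_mult[OF horizontal_mult[OF horizontal_const[OF assms(1)] \<gamma>(2)]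
          horizontal_const[OF inv_K[OF assms(1)]]]])
      (simp_all add: \<gamma> mat_zero matrix_inv_right K_invertible assms(1))
qed

lemma subspace_velocities: "subspace velocities"
proof (rule subspaceI)
  show "0 \<in> velocities"
    by (rule velocitiesI[OF zero_less_one horizontal_const[OF one_K]]) auto
next
  fix B C assume "B \<in> velocities" "C \<in> velocities"
  then obtain \<gamma> \<gamma>' \<epsilon> \<delta> \<delta>' \<epsilon>' where \<gamma>: "\<epsilon> > 0" "horizontal \<gamma> \<gamma>' {-\<epsilon><..<\<epsilon>}" "\<gamma> 0 = mat 1" "\<gamma>' 0 = B"
    and \<delta>: "\<epsilon>' > 0" "horizontal \<delta> \<delta>' {-\<epsilon>'<..<\<epsilon>'}" "\<delta> 0 = mat 1" "\<delta>' 0 = C"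
    by (elim velocitiesE) blast
  define \<eta> where "\<eta> = min \<epsilon> \<epsilon>'"
  have \<eta>: "\<eta> > 0" using \<gamma> \<delta> by (simp add: \<eta>_def)
  have h\<gamma>: "horizontal \<gamma> \<gamma>' {-\<eta><..<\<eta>}"
    by (rule horizontal_subset[OF \<gamma>(2)]) (auto simp: \<eta>_def)
  have h\<delta>: "horizontal \<delta> \<delta>' {-\<eta><..<\<eta>}"
    by (rule horizontal_subset[OF \<delta>(2)]) (auto simp: \<eta>_def)
  show "B + C \<in> velocities"
    by (rule velocitiesI[OF \<eta> horizontal_mult[OF h\<gamma> h\<delta>]]) (simp_all add: \<gamma> \<delta> add.commute)
next
  fix c :: real and B assume "B \<in> velocities"
  then obtain \<gamma> \<gamma>' \<epsilon> where \<gamma>: "\<epsilon> > 0" "horizontal \<gamma> \<gamma>' {-\<epsilon><..<\<epsilon>}" "\<gamma> 0 = mat 1" "\<gamma>' 0 = B"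
    by (rule velocitiesE)
  define \<eta> where "\<eta> = \<epsilon> / (\<bar>c\<bar> + 1)"
  have \<eta>: "\<eta> > 0" using \<gamma>(1) by (simp add: \<eta>_def)
  have c\<tau>: "c * \<tau> \<in> {-\<epsilon><..<\<epsilon>}" if "\<tau> \<in> {-\<eta><..<\<eta>}" for \<tau>
  proof -
    have "\<bar>c * \<tau>\<bar> \<le> \<bar>c\<bar> * \<eta>" using that by (simp add: abs_mult mult_left_mono abs_le_iff)
    also have "\<dots> < (\<bar>c\<bar> + 1) * \<eta>" using \<eta> by (simp add: algebra_simps)
    also have "\<dots> = \<epsilon>" by (simp add: \<eta>_def)
    finally show ?thesis by auto
  qed
  have "horizontal (\<lambda>\<tau>. \<gamma> (c * \<tau>)) (\<lambda>\<tau>. c *\<^sub>R \<gamma>' (c * \<tau>)) {-\<eta><..<\<eta>}"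
    unfolding horizontal_def
  proof (intro conjI ballI)
    show "continuous_on {-\<eta><..<\<eta>} (\<lambda>\<tau>. c *\<^sub>R \<gamma>' (c * \<tau>))"
      by (intro continuous_intros continuous_on_compose2[OF horizontalD(1)[OF \<gamma>(2)]]) (use c\<tau> in auto)
    fix \<tau> assume \<tau>: "\<tau> \<in> {-\<eta><..<\<eta>}"
    show "\<gamma> (c * \<tau>) \<in> K" by (rule horizontalD(2)[OF \<gamma>(2) c\<tau>[OF \<tau>]])
    have "(\<gamma> has_vector_derivative \<gamma>' (c * \<tau>)) (at (c * \<tau>))"
      using horizontalD(3)[OF \<gamma>(2) c\<tau>[OF \<tau>]] at_within_open[OF c\<tau>[OF \<tau>]] by simp
    moreover have "((\<lambda>\<tau>. c * \<tau>) has_vector_derivative c) (at \<tau> within {-\<eta><..<\<eta>})"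
      by (auto intro!: derivative_eq_intros)
    ultimately show "((\<lambda>\<tau>. \<gamma> (c * \<tau>)) has_vector_derivative c *\<^sub>R \<gamma>' (c * \<tau>)) (at \<tau> within {-\<eta><..<\<eta>})"
      using vector_diff_chain_within[of "\<lambda>\<tau>. c * \<tau>" c \<tau> "{-\<eta><..<\<eta>}" \<gamma> "\<gamma>' (c * \<tau>)"]
      by (simp add: o_def has_vector_derivative_at_within)
    show "matrix_inv (\<gamma> (c * \<tau>)) ** c *\<^sub>R \<gamma>' (c * \<tau>) \<in> L"
      using horizontalD(4)[OF \<gamma>(2) c\<tau>[OF \<tau>]] by (simp add: mat_scaleR subspace_scale[OF sub_L])
  qed
  then show "c *\<^sub>R B \<in> velocities" by (rule velocitiesI[OF \<eta>]) (simp_all add: \<gamma>)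
qed

text \<open>
  Conjugating a fixed velocity by a horizontal curve yields a curve inside this finite-dimensional space, hence its
  derivative, which is the commutator, stays there.
\<close>

lemma lie_subalgebra_velocities: "lie_subalgebra velocities"
  unfolding lie_subalgebra_def
proof (intro conjI ballI)
  show "subspace velocities" by (rule subspace_velocities)
  fix B C assume "B \<in> velocities" and C: "C \<in> velocities"
  from this(1) obtain \<gamma> \<gamma>' \<epsilon> where \<gamma>: "\<epsilon> > 0" "horizontal \<gamma> \<gamma>' {-\<epsilon><..<\<epsilon>}" "\<gamma> 0 = mat 1" "\<gamma>' 0 = B"
    by (rule velocitiesE)
  have 0: "0 \<in> {-\<epsilon><..<\<epsilon>}" using \<gamma>(1) by simp
  have d: "(\<gamma> has_vector_derivative B) (at 0)"
    using horizontalD(3)[OF \<gamma>(2) 0] at_within_open[OF 0] by (simp add: \<gamma>(4))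
  have di: "((\<lambda>\<tau>. matrix_inv (\<gamma> \<tau>)) has_vector_derivative - (matrix_inv (\<gamma> 0) ** B ** matrix_inv (\<gamma> 0))) (at 0)"
    using horizontalD(3)[OF horizontal_inverse[OF \<gamma>(2)] 0] at_within_open[OF 0] by (simp add: \<gamma>(4))
  have one: "matrix_inv (mat 1 :: 'k^'n^'n) = mat 1" by (simp add: matrix_inv_eqI)
  have "((\<lambda>\<tau>. \<gamma> \<tau> ** C ** matrix_inv (\<gamma> \<tau>)) has_vector_derivative
      \<gamma> 0 ** C ** - (matrix_inv (\<gamma> 0) ** B ** matrix_inv (\<gamma> 0)) + (\<gamma> 0 ** 0 + B ** C) ** matrix_inv (\<gamma> 0)) (at 0)"
    by (intro has_vector_derivative_matrix_mult d di has_vector_derivative_const)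
  then have "((\<lambda>\<tau>. \<gamma> \<tau> ** C ** matrix_inv (\<gamma> \<tau>)) has_vector_derivative commutator B C) (at 0)"
    by (simp add: \<gamma>(3) one commutator_def mat_simps)
  then show "commutator B C \<in> velocities"
    by (rule derivative_in_subspace[OF subspace_velocities open_greaterThanLessThan 0, rotated])
      (rule velocities_Ad[OF horizontalD(2)[OF \<gamma>(2)] C])
qed

lemma velocities_subset_group_lie_algebra: "velocities \<subseteq> group_lie_algebra K"
proof
  fix B assume "B \<in> velocities"
  then obtain \<gamma> \<gamma>' \<epsilon> where \<gamma>: "\<epsilon> > 0" "horizontal \<gamma> \<gamma>' {-\<epsilon><..<\<epsilon>}" "\<gamma> 0 = mat 1" "\<gamma>' 0 = B"
    by (rule velocitiesE)
  have d: "(\<gamma> has_vector_derivative \<gamma>' \<tau>) (at \<tau>)" if "\<tau> \<in> {-\<epsilon><..<\<epsilon>}" for \<tau>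
    using horizontalD(3)[OF \<gamma>(2) that] at_within_open[OF that] by simp
  have "\<gamma> C1_differentiable_on {-\<epsilon><..<\<epsilon>}"
    unfolding C1_differentiable_on_def using d horizontalD(1)[OF \<gamma>(2)] by blast
  moreover have "\<gamma> ` {-\<epsilon><..<\<epsilon>} \<subseteq> K" using horizontalD(2)[OF \<gamma>(2)] by blast
  moreover have "(\<gamma> has_vector_derivative B) (at 0)" using d[of 0] \<gamma> by simp
  ultimately show "B \<in> group_lie_algebra K"
    unfolding group_lie_algebra_def using \<gamma>(1,3) by blast
qed

text \<open>
  A product of one horizontal curve for each element of \<open>B\<close>, with independent parameters. In place of a matrix
  exponential it furnishes an integral manifold of the distribution through the unit.
\<close>

lemma horizontal_family:
  fixes B :: "('k^'n^'n) set"
  assumes L: "L \<subseteq> velocities" and "finite B" "B \<subseteq> L"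
  shows "\<exists>(W :: ('k^'n^'n) set) F F'. open W \<and> 0 \<in> W \<and> F 0 = mat 1 \<and> (\<forall>H. F' 0 H = (\<Sum>b\<in>B. (H \<bullet> b) *\<^sub>R b)) \<and>
    (\<forall>Q\<in>W. F Q \<in> K \<and> (F has_derivative F' Q) (at Q) \<and> (\<forall>H. matrix_inv (F Q) ** F' Q H \<in> L)) \<and>
    (\<forall>H. continuous_on W (\<lambda>Q. F' Q H))"
  using assms(2,3)
proof (induction B rule: finite_induct)
  case empty
  show ?case
    by (rule exI[of _ UNIV], rule exI[of _ "\<lambda>_. mat 1"], rule exI[of _ "\<lambda>_ _. 0"])
      (simp add: one_K mat_zero subspace_0[OF sub_L])
next
  case (insert b B)
  from insert.IH insert.prems obtain W :: "('k^'n^'n) set" and F F' where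
    W: "open W" "0 \<in> W" and F0: "F 0 = mat 1" "\<And>H. F' 0 H = (\<Sum>b\<in>B. (H \<bullet> b) *\<^sub>R b)"
    and F: "\<And>Q. Q \<in> W \<Longrightarrow> F Q \<in> K" "\<And>Q. Q \<in> W \<Longrightarrow> (F has_derivative F' Q) (at Q)"
      "\<And>Q H. Q \<in> W \<Longrightarrow> matrix_inv (F Q) ** F' Q H \<in> L"
    and F'c: "\<And>H. continuous_on W (\<lambda>Q. F' Q H)"
    by blast
  have "b \<in> velocities" using insert.prems L by blast
  then obtain \<gamma> \<gamma>' \<epsilon> where \<gamma>: "\<epsilon> > 0" "horizontal \<gamma> \<gamma>' {-\<epsilon><..<\<epsilon>}" "\<gamma> 0 = mat 1" "\<gamma>' 0 = b"
    by (rule velocitiesE)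
  define W2 where "W2 = W \<inter> (\<lambda>Q. Q \<bullet> b) -` {-\<epsilon><..<\<epsilon>}"
  define G where "G = (\<lambda>Q. \<gamma> (Q \<bullet> b) ** F Q)"
  define G' where "G' = (\<lambda>Q H. \<gamma> (Q \<bullet> b) ** F' Q H + ((H \<bullet> b) *\<^sub>R \<gamma>' (Q \<bullet> b)) ** F Q)"
  have "open ((\<lambda>Q. Q \<bullet> b) -` {-\<epsilon><..<\<epsilon>})"
    by (intro open_vimage continuous_intros open_greaterThanLessThan)
  then have W2: "open W2" unfolding W2_def using W(1) by (rule open_Int[rotated])
  have dom: "Q \<in> W" "Q \<bullet> b \<in> {-\<epsilon><..<\<epsilon>}" if "Q \<in> W2" for Q using that by (auto simp: W2_def)
  have d\<gamma>: "((\<lambda>Q. \<gamma> (Q \<bullet> b)) has_derivative (\<lambda>H. (H \<bullet> b) *\<^sub>R \<gamma>' (Q \<bullet> b))) (at Q)" if Q: "Q \<in> W2" for Q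
  proof -
    have "(\<gamma> has_vector_derivative \<gamma>' (Q \<bullet> b)) (at (Q \<bullet> b))"
      using horizontalD(3)[OF \<gamma>(2) dom(2)[OF Q]] at_within_open[OF dom(2)[OF Q]] by simp
    then show ?thesis
      using has_derivative_compose[OF bounded_linear.has_derivative[OF bounded_linear_inner_left has_derivative_ident]]
      unfolding has_vector_derivative_def by fast
  qed
  have FcW: "continuous_on W2 F"
    by (rule continuous_at_imp_continuous_on) (use F(2) dom has_derivative_continuous in blast)
  have in\<gamma>: "(\<lambda>Q. Q \<bullet> b) ` W2 \<subseteq> {-\<epsilon><..<\<epsilon>}" using dom(2) by blast
  have cW2: "continuous_on W2 (\<lambda>Q. Q \<bullet> b)" by (intro continuous_intros)
  show ?case
  proof (rule exI[of _ W2], rule exI[of _ G], rule exI[of _ G'], intro conjI allI ballI)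
    show "open W2" by (rule W2)
    show "0 \<in> W2" using W(2) \<gamma>(1) by (simp add: W2_def)
    show "G 0 = mat 1" by (simp add: G_def \<gamma>(3) F0)
    show "G' 0 H = (\<Sum>b\<in>insert b B. (H \<bullet> b) *\<^sub>R b)" for H
      using insert.hyps by (simp add: G'_def \<gamma>(3,4) F0)
    show "continuous_on W2 (\<lambda>Q. G' Q H)" for H
      unfolding G'_def
      by (intro continuous_intros FcW continuous_on_compose2[OF horizontalD(1)[OF \<gamma>(2)] cW2 in\<gamma>]
          continuous_on_compose2[OF horizontalD(5)[OF \<gamma>(2)] cW2 in\<gamma>] continuous_on_subset[OF F'c])
        (use dom in auto)
    fix Q assume Q: "Q \<in> W2"
    have \<gamma>K: "\<gamma> (Q \<bullet> b) \<in> K" by (rule horizontalD(2)[OF \<gamma>(2) dom(2)[OF Q]])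
    show "G Q \<in> K" unfolding G_def by (rule mult_K[OF \<gamma>K F(1)[OF dom(1)[OF Q]]])
    show "(G has_derivative G' Q) (at Q)"
      unfolding G_def G'_def by (rule has_derivative_matrix_mult[OF d\<gamma>[OF Q] F(2)[OF dom(1)[OF Q]]])
    have inv: "invertible (\<gamma> (Q \<bullet> b))" "invertible (F Q)"
      using \<gamma>K F(1)[OF dom(1)[OF Q]] K_invertible by auto
    show "matrix_inv (G Q) ** G' Q H \<in> L" for H
    proof -
      have "matrix_inv (G Q) ** G' Q H = matrix_inv (F Q) ** F' Q H
          + (H \<bullet> b) *\<^sub>R (matrix_inv (F Q) ** (matrix_inv (\<gamma> (Q \<bullet> b)) ** \<gamma>' (Q \<bullet> b)) ** F Q)"
        using inv by (simp add: G_def G'_def matrix_inv_mult mat_simps matrix_inv_cancel)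
      also have "\<dots> \<in> L"
        by (intro subspace_add[OF sub_L] subspace_scale[OF sub_L] Ad_L' F(1,3) dom[OF Q] horizontalD(4)[OF \<gamma>(2)])
      finally show ?thesis .
    qed
  qed
qed

text \<open>
  The Frobenius theorem for the distribution $P \mapsto P L$ near the unit. The map
  $Q \mapsto (1 + \pi Q)\,F(Q)$ with $\pi$ the projection along \<open>L\<close> has the identity as derivative at 0, so it is a chart;
  $\pi$ of the coordinates is the first integral. By a dimension count the directions in \<open>L\<close> are mapped onto
  the whole space $y L$.
\<close>

lemma first_integral:
  assumes L: "L \<subseteq> velocities"
  shows "\<exists>V \<omega> \<omega>'. open V \<and> mat 1 \<in> V \<and>
    (\<forall>y\<in>V. ((\<omega> :: 'k^'n^'n \<Rightarrow> 'k^'n^'n) has_derivative \<omega>' y) (at y) \<and> (\<forall>C\<in>L. \<omega>' y (y ** C) = 0)) \<and>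
    (\<forall>C. \<omega>' (mat 1) C = 0 \<longrightarrow> C \<in> L)"
proof -
  obtain \<pi> :: "'k^'n^'n \<Rightarrow> 'k^'n^'n" and B where \<pi>: "linear \<pi>" "\<And>x. \<pi> x = 0 \<longleftrightarrow> x \<in> L"
    and B: "finite B" "B \<subseteq> L" "\<And>x. \<pi> x = x - (\<Sum>b\<in>B. (x \<bullet> b) *\<^sub>R b)"
    using subspace_projection[OF sub_L] by blast
  obtain W :: "('k^'n^'n) set" and F F' where
    W: "open W" "0 \<in> W" and F0: "F 0 = mat 1" "\<And>H. F' 0 H = (\<Sum>b\<in>B. (H \<bullet> b) *\<^sub>R b)"
    and F: "\<And>Q. Q \<in> W \<Longrightarrow> F Q \<in> K" "\<And>Q. Q \<in> W \<Longrightarrow> (F has_derivative F' Q) (at Q)"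
      "\<And>Q H. Q \<in> W \<Longrightarrow> matrix_inv (F Q) ** F' Q H \<in> L"
    and F'c: "\<And>H. continuous_on W (\<lambda>Q. F' Q H)"
    using horizontal_family[OF L B(1,2)] by blast
  have bl: "bounded_linear \<pi>" using \<pi>(1) by (simp add: linear_conv_bounded_linear)
  define \<Psi> where "\<Psi> = (\<lambda>Q. (mat 1 + \<pi> Q) ** F Q)"
  define \<Psi>' where "\<Psi>' = (\<lambda>Q H. (mat 1 + \<pi> Q) ** F' Q H + \<pi> H ** F Q)"
  have d\<Psi>: "(\<Psi> has_derivative \<Psi>' Q) (at Q)" if "Q \<in> W" for Q
  proof -
    have "((\<lambda>Q. mat 1 + \<pi> Q) has_derivative (\<lambda>H. 0 + \<pi> H)) (at Q)"
      by (intro has_derivative_add has_derivative_const bounded_linear.has_derivative[OF bl has_derivative_ident])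
    from has_derivative_matrix_mult[OF this F(2)[OF that]] show ?thesis
      by (simp add: \<Psi>_def \<Psi>'_def)
  qed
  have \<Psi>0: "\<Psi> 0 = mat 1" by (simp add: \<Psi>_def F0 linear_0[OF \<pi>(1)])
  have \<Psi>'0: "\<Psi>' 0 H = H" for H by (simp add: \<Psi>'_def F0 linear_0[OF \<pi>(1)] B(3))
  have blin: "bounded_linear (\<Psi>' Q)" if "Q \<in> W" for Q
    using d\<Psi>[OF that] by (rule has_derivative_bounded_linear)
  have FcW: "continuous_on W F"
    by (rule continuous_at_imp_continuous_on) (use F(2) has_derivative_continuous in blast)
  have cont: "continuous_on W (\<lambda>Q. Blinfun (\<Psi>' Q))"
  proof (rule continuous_on_blinfun_componentwise)
    fix i :: "'k^'n^'n"
    have "continuous_on W (\<lambda>Q. \<Psi>' Q i)"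
      unfolding \<Psi>'_def by (intro continuous_intros FcW F'c linear_continuous_on[OF bl])
    then show "continuous_on W (\<lambda>Q. blinfun_apply (Blinfun (\<Psi>' Q)) i)"
      by (rule continuous_on_eq) (simp add: bounded_linear_Blinfun_apply[OF blin])
  qed
  have "Blinfun (\<Psi>' 0) = id_blinfun"
    by (rule blinfun_eqI) (simp add: bounded_linear_Blinfun_apply[OF blin[OF W(2)]] \<Psi>'0)
  then have id: "id_blinfun o\<^sub>L Blinfun (\<Psi>' 0) = id_blinfun"
    by (simp add: blinfun_eqI)
  have der: "(\<Psi> has_derivative blinfun_apply (Blinfun (\<Psi>' Q))) (at Q)" if "Q \<in> W" for Q
    using d\<Psi>[OF that] by (simp add: bounded_linear_Blinfun_apply[OF blin[OF that]])
  obtain U' V g g' where U': "open U'" "U' \<subseteq> W" "0 \<in> U'" and V: "open V" "\<Psi> 0 \<in> V"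
    and hom: "homeomorphism U' V \<Psi> g" and dg: "\<And>y. y \<in> V \<Longrightarrow> (g has_derivative (g' y)) (at y)"
    and g': "\<And>y. y \<in> V \<Longrightarrow> g' y = inv_into UNIV (blinfun_apply (Blinfun (\<Psi>' (g y))))"
    and bij: "\<And>y. y \<in> V \<Longrightarrow> bij (blinfun_apply (Blinfun (\<Psi>' (g y))))"
    by (rule inverse_function_theorem[OF W(1) der cont W(2) id]) blast+
  have gU: "g y \<in> W" "\<Psi> (g y) = y" if "y \<in> V" for y
    using hom that U'(2) by (auto simp: homeomorphism_def)
  have bij': "bij (\<Psi>' (g y))" and g'': "g' y = inv_into UNIV (\<Psi>' (g y))" if "y \<in> V" for y
    using bij[OF that] g'[OF that] by (simp_all add: bounded_linear_Blinfun_apply[OF blin[OF gU(1)[OF that]]])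
  have g0: "g (mat 1) = 0" using hom U'(3) \<Psi>0 by (metis homeomorphism_def)
  have zero: "\<pi> (g' y (y ** C)) = 0" if y: "y \<in> V" and C: "C \<in> L" for y C
  proof -
    let ?Q = "g y"
    define \<tau> where "\<tau> = (\<lambda>H. matrix_inv (F ?Q) ** F' ?Q H)"
    have inv: "invertible (F ?Q)" using F(1)[OF gU(1)[OF y]] by (rule K_invertible)
    have eq: "\<Psi>' ?Q H = y ** \<tau> H" if "H \<in> L" for H
    proof -
      have "\<Psi>' ?Q H = (mat 1 + \<pi> ?Q) ** F' ?Q H" using that by (simp add: \<Psi>'_def \<pi>(2) mat_zero \<pi>(2)[THEN iffD2])
      also have "\<dots> = ((mat 1 + \<pi> ?Q) ** F ?Q) ** \<tau> H"
        unfolding \<tau>_def matrix_mul_assoc using inv by (simp add: matrix_inv_cancel)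
      finally show ?thesis using gU(2)[OF y] by (simp add: \<Psi>_def)
    qed
    have "linear (F' ?Q)" using F(2)[OF gU(1)[OF y]] by (rule has_derivative_linear)
    then have lin: "linear \<tau>"
      unfolding \<tau>_def by (auto intro!: linearI simp: linear_add linear_scale mat_add mat_scaleR)
    have "\<tau> ` L = L"
    proof (rule linear_injective_on_subspace_surj[OF lin sub_L])
      show "\<tau> H \<in> L" for H unfolding \<tau>_def by (rule F(3)[OF gU(1)[OF y]])
      fix H assume "H \<in> L" "\<tau> H = 0"
      then have "\<Psi>' ?Q H = \<Psi>' ?Q 0"
        using eq[of H] linear_0[OF bounded_linear.linear[OF blin[OF gU(1)[OF y]]]] by (simp add: mat_zero)
      then show "H = 0" using bij'[OF y] by (metis bij_is_inj injD)
    qed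
    then obtain H where H: "H \<in> L" "C = \<tau> H" using C by blast
    then have "g' y (y ** C) = H"
      using eq[OF H(1)] g''[OF y] bij'[OF y] by (simp add: bij_is_inj inv_f_eq)
    then show ?thesis using H(1) \<pi>(2) by simp
  qed
  have one: "mat 1 \<in> V" using V(2) \<Psi>0 by simp
  show ?thesis
  proof (rule exI[of _ V], rule exI[of _ "\<lambda>y. \<pi> (g y)"], rule exI[of _ "\<lambda>y H. \<pi> (g' y H)"],
      intro conjI ballI allI impI)
    show "((\<lambda>y. \<pi> (g y)) has_derivative (\<lambda>H. \<pi> (g' y H))) (at y)" if "y \<in> V" for y
      by (rule bounded_linear.has_derivative[OF bl dg[OF that]])
    fix C assume *: "\<pi> (g' (mat 1) C) = 0"
    have "g' (mat 1) C = C"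
      unfolding g''[OF one] g0 using bij'[OF one] unfolding g0 by (simp add: \<Psi>'0 bij_is_inj inv_f_eq)
    with * show "C \<in> L" by (simp add: \<pi>(2))
  qed (use V(1) one zero in auto)
qed

lemma first_integral_horizontal:
  assumes d: "\<And>y. y \<in> V \<Longrightarrow> (\<omega> has_derivative \<omega>' y) (at y)"
    and z: "\<And>y C. y \<in> V \<Longrightarrow> C \<in> L \<Longrightarrow> \<omega>' y (y ** C) = 0"
    and h: "horizontal \<eta> \<eta>' {0..1}" and V: "\<And>\<tau>. \<tau> \<in> {0..1} \<Longrightarrow> \<eta> \<tau> \<in> V"
  shows "\<omega> (\<eta> 0) = \<omega> (\<eta> 1)"
proof -
  have "((\<lambda>\<tau>. \<omega> (\<eta> \<tau>)) has_derivative (\<lambda>h. 0)) (at \<tau> within {0..1})" if "\<tau> \<in> {0..1}" for \<tau>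
  proof -
    have "((\<lambda>\<tau>. \<omega> (\<eta> \<tau>)) has_derivative (\<lambda>h. \<omega>' (\<eta> \<tau>) (h *\<^sub>R \<eta>' \<tau>))) (at \<tau> within {0..1})"
      using has_derivative_compose[OF horizontalD(3)[OF h that, unfolded has_vector_derivative_def] d[OF V[OF that]]] .
    moreover have "\<omega>' (\<eta> \<tau>) (h *\<^sub>R \<eta>' \<tau>) = 0" for h
    proof -
      have "invertible (\<eta> \<tau>)" using horizontalD(2)[OF h that] by (rule K_invertible)
      then have "h *\<^sub>R \<eta>' \<tau> = \<eta> \<tau> ** (h *\<^sub>R (matrix_inv (\<eta> \<tau>) ** \<eta>' \<tau>))"
        by (simp add: mat_scaleR matrix_inv_cancel)
      then show ?thesis
        using z[OF V[OF that] subspace_scale[OF sub_L horizontalD(4)[OF h that]]] by metis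
    qed
    ultimately show ?thesis by simp
  qed
  then obtain c where "\<And>\<tau>. \<tau> \<in> {0..1} \<Longrightarrow> \<omega> (\<eta> \<tau>) = c"
    using has_derivative_zero_constant[of "{0..1::real}" "\<lambda>\<tau>. \<omega> (\<eta> \<tau>)"] by auto
  then show ?thesis by simp
qed

text \<open>
  A connected set of more than one point is uncountable. Hence a first integral that takes countably many values
  along a curve is constant along it, and the velocity of the curve lies in its kernel.
\<close>

lemma group_lie_algebra_eq:
  assumes L: "L \<subseteq> velocities" and "countable D"
    and approx: "\<And>P \<epsilon>. P \<in> K \<Longrightarrow> \<epsilon> > 0 \<Longrightarrow>
      \<exists>\<eta> \<eta>'. horizontal \<eta> \<eta>' {0..1} \<and> \<eta> 0 \<in> D \<and> \<eta> 1 = P \<and> (\<forall>\<tau>\<in>{0..1}. dist P (\<eta> \<tau>) < \<epsilon>)"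
  shows "group_lie_algebra K = L"
proof
  show "L \<subseteq> group_lie_algebra K" using L velocities_subset_group_lie_algebra by blast
  show "group_lie_algebra K \<subseteq> L"
  proof
    fix B assume "B \<in> group_lie_algebra K"
    then obtain \<gamma> \<epsilon> where \<gamma>: "\<epsilon> > 0" "\<gamma> ` {-\<epsilon><..<\<epsilon>} \<subseteq> K" "\<gamma> C1_differentiable_on {-\<epsilon><..<\<epsilon>}"
      "\<gamma> 0 = mat 1" "(\<gamma> has_vector_derivative B) (at (0::real))"
      unfolding group_lie_algebra_def by blast
    obtain V and \<omega> :: "'k^'n^'n \<Rightarrow> 'k^'n^'n" and \<omega>' where V: "open V" "mat 1 \<in> V"
      and \<omega>: "\<And>y. y \<in> V \<Longrightarrow> (\<omega> has_derivative \<omega>' y) (at y)"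
      and z: "\<And>y C. y \<in> V \<Longrightarrow> C \<in> L \<Longrightarrow> \<omega>' y (y ** C) = 0"
      and ker: "\<And>C. \<omega>' (mat 1) C = 0 \<Longrightarrow> C \<in> L"
      using first_integral[OF L] by blast
    have cont: "continuous_on {-\<epsilon><..<\<epsilon>} \<gamma>"
      using \<gamma>(3) by (rule C1_differentiable_imp_continuous_on)
    obtain d where d: "d > 0" "\<And>\<tau>. \<bar>\<tau>\<bar> < d \<Longrightarrow> \<gamma> \<tau> \<in> V" "d \<le> \<epsilon>"
    proof -
      have "open ({-\<epsilon><..<\<epsilon>} \<inter> \<gamma> -` V)" by (rule continuous_open_preimage[OF cont open_greaterThanLessThan V(1)])
      moreover have "0 \<in> {-\<epsilon><..<\<epsilon>} \<inter> \<gamma> -` V" using \<gamma>(1,4) V(2) by simp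
      ultimately obtain d where "d > 0" "ball 0 d \<subseteq> {-\<epsilon><..<\<epsilon>} \<inter> \<gamma> -` V"
        using open_contains_ball by blast
      then show ?thesis using that[of "min d \<epsilon>"] \<gamma>(1) by (auto simp: subset_iff dist_norm)
    qed
    let ?J = "{-d<..<d}"
    have "\<omega> (\<gamma> \<tau>) \<in> \<omega> ` D" if \<tau>: "\<tau> \<in> ?J" for \<tau>
    proof -
      have "\<gamma> \<tau> \<in> V" "\<gamma> \<tau> \<in> K" using d \<tau> \<gamma>(2) by (auto simp: image_subset_iff)
      then obtain \<delta> where \<delta>: "\<delta> > 0" "ball (\<gamma> \<tau>) \<delta> \<subseteq> V" using V(1) open_contains_ball by blast
      obtain \<eta> \<eta>' where \<eta>: "horizontal \<eta> \<eta>' {0..1}" "\<eta> 0 \<in> D" "\<eta> 1 = \<gamma> \<tau>" "\<forall>\<sigma>\<in>{0..1}. dist (\<gamma> \<tau>) (\<eta> \<sigma>) < \<delta>"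
        using approx[OF \<open>\<gamma> \<tau> \<in> K\<close> \<delta>(1)] by blast
      have "\<omega> (\<eta> 0) = \<omega> (\<eta> 1)"
        by (rule first_integral_horizontal[OF \<omega> z \<eta>(1)]) (use \<eta>(4) \<delta>(2) in \<open>auto simp: subset_iff\<close>)
      then show ?thesis using \<eta>(2,3) by (metis imageI)
    qed
    then have countable: "countable ((\<lambda>\<tau>. \<omega> (\<gamma> \<tau>)) ` ?J)"
      using \<open>countable D\<close> by (meson countable_image countable_subset image_subsetI)
    have "continuous_on V \<omega>"
      by (rule continuous_at_imp_continuous_on) (use \<omega> has_derivative_continuous in blast)
    then have "continuous_on ?J (\<lambda>\<tau>. \<omega> (\<gamma> \<tau>))"
      by (rule continuous_on_compose2[OF _ continuous_on_subset[OF cont]]) (use d in auto)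
    then have conn: "connected ((\<lambda>\<tau>. \<omega> (\<gamma> \<tau>)) ` ?J)" by (intro connected_continuous_image) auto
    have const: "\<omega> (\<gamma> \<tau>) = \<omega> (\<gamma> 0)" if "\<tau> \<in> ?J" for \<tau>
    proof (rule ccontr)
      assume "\<omega> (\<gamma> \<tau>) \<noteq> \<omega> (\<gamma> 0)"
      then have "uncountable ((\<lambda>\<tau>. \<omega> (\<gamma> \<tau>)) ` ?J)"
        using connected_uncountable[OF conn, of "\<omega> (\<gamma> \<tau>)" "\<omega> (\<gamma> 0)"] that d(1) by force
      with countable show False by blast
    qed
    have "((\<lambda>\<tau>. \<omega> (\<gamma> \<tau>)) has_derivative (\<lambda>h. \<omega>' (mat 1) (h *\<^sub>R B))) (at 0)"
      using has_derivative_compose[OF \<gamma>(5)[unfolded has_vector_derivative_def]] \<omega>[OF V(2)] \<gamma>(4) by simp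
    then have "((\<lambda>\<tau>. \<omega> (\<gamma> 0)) has_derivative (\<lambda>h. \<omega>' (mat 1) (h *\<^sub>R B))) (at 0)"
      by (rule has_derivative_transform_within_open[of _ _ _ _ ?J]) (simp, simp add: d(1), rule const)
    then have "(\<lambda>h. \<omega>' (mat 1) (h *\<^sub>R B)) = (\<lambda>h. 0)"
      by (rule has_derivative_unique[OF _ has_derivative_const])
    from fun_cong[OF this, of 1] show "B \<in> L" by (intro ker) simp
  qed
qed

end

section \<open>Linear differential inequalities along curves\<close>

text \<open>
  The function $e^{-2c\tau} \sum_i |p_i|^2$ does not increase. A family is needed since the components of
  the generators $S_1(g), \ldots, S_r(g)$ orthogonal to the Lie algebra are coupled.
\<close>

lemma gronwall_family:
  fixes p :: "'i \<Rightarrow> real \<Rightarrow> 'a::real_inner"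
  assumes "finite I"
    and p': "\<And>i \<tau>. i \<in> I \<Longrightarrow> \<tau> \<in> {0..1} \<Longrightarrow> (p i has_vector_derivative p' i \<tau>) (at \<tau> within {0..1})"
    and le: "\<And>i \<tau>. i \<in> I \<Longrightarrow> \<tau> \<in> {0..1} \<Longrightarrow> norm (p' i \<tau>) \<le> C * (\<Sum>j\<in>I. norm (p j \<tau>))"
    and "C \<ge> 0" and p0: "\<And>i. i \<in> I \<Longrightarrow> p i 0 = 0" and i: "i \<in> I" and \<tau>: "\<tau> \<in> {0..1}"
  shows "p i \<tau> = 0"
proof -
  define c where "c = C * card I"
  define E where "E = (\<lambda>\<tau>. \<Sum>i\<in>I. p i \<tau> \<bullet> p i \<tau>)"
  define f where "f = (\<lambda>\<tau>. exp (- 2 * c * \<tau>) * E \<tau>)"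
  let ?d = "\<lambda>x. exp (- 2 * c * x) * (2 * (\<Sum>i\<in>I. p i x \<bullet> p' i x) - 2 * c * E x)"
  have "\<exists>x\<in>{0..\<tau>}. f \<tau> - f 0 = ?d x * (\<tau> - 0)"
  proof (rule mvt_very_simple)
    fix x assume x: "0 \<le> x" "x \<le> \<tau>"
    have 0: "(p i has_derivative (\<lambda>h. h *\<^sub>R p' i x)) (at x within {0..\<tau>})" if "i \<in> I" for i
      using p'[of i x] x \<tau> that has_derivative_subset[of "p i" _ x "{0..1}" "{0..\<tau>}"]
      by (auto simp: has_vector_derivative_def)
    have 3: "(\<Sum>i\<in>I. p i x \<bullet> h *\<^sub>R p' i x + h *\<^sub>R p' i x \<bullet> p i x) = 2 * h * (\<Sum>i\<in>I. p i x \<bullet> p' i x)" for h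
      by (simp add: inner_commute sum_distrib_left mult.assoc)
    have 1: "(E has_derivative (\<lambda>h. 2 * h * (\<Sum>i\<in>I. p i x \<bullet> p' i x))) (at x within {0..\<tau>})"
      unfolding E_def 3[symmetric] by (rule has_derivative_sum) (rule has_derivative_inner[OF 0 0])
    have 2: "((\<lambda>\<tau>. exp (- 2 * c * \<tau>)) has_derivative (\<lambda>h. exp (- 2 * c * x) * (- 2 * c * h))) (at x within {0..\<tau>})"
      by (auto intro!: derivative_eq_intros)
    show "(f has_derivative (*) (?d x)) (at x within {0..\<tau>})"
      unfolding f_def
      by (rule has_derivative_eq_rhs[OF has_derivative_mult[OF 2 1]])
        (simp add: fun_eq_iff algebra_simps)
  qed (use \<tau> in auto)
  then obtain x where x: "x \<in> {0..\<tau>}" and eq: "f \<tau> - f 0 = ?d x * \<tau>"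
    by auto
  have "(\<Sum>i\<in>I. p i x \<bullet> p' i x) \<le> (\<Sum>i\<in>I. norm (p i x) * (C * (\<Sum>j\<in>I. norm (p j x))))"
  proof (rule sum_mono)
    fix i assume "i \<in> I"
    have "p i x \<bullet> p' i x \<le> norm (p i x) * norm (p' i x)" by (rule norm_cauchy_schwarz)
    also have "\<dots> \<le> norm (p i x) * (C * (\<Sum>j\<in>I. norm (p j x)))"
      using le[OF \<open>i \<in> I\<close>, of x] x \<tau> by (intro mult_left_mono) auto
    finally show "p i x \<bullet> p' i x \<le> norm (p i x) * (C * (\<Sum>j\<in>I. norm (p j x)))" .
  qed
  also have "\<dots> = C * (\<Sum>i\<in>I. norm (p i x))\<^sup>2"
    by (simp add: sum_distrib_right[symmetric] power2_eq_square)
  also have "\<dots> \<le> C * ((\<Sum>i\<in>I. (norm (p i x))\<^sup>2) * card I)"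
    using \<open>C \<ge> 0\<close> sum_squared_le_sum_of_squares[of "\<lambda>i. norm (p i x)" I]
    by (intro mult_left_mono) auto
  also have "\<dots> = c * E x"
    by (simp add: c_def E_def power2_norm_eq_inner)
  finally have "f \<tau> - f 0 \<le> 0"
    unfolding eq using \<tau> by (intro mult_nonpos_nonneg mult_nonneg_nonpos) auto
  then have "exp (- 2 * c * \<tau>) * E \<tau> \<le> 0" using p0 by (simp add: f_def E_def)
  then have "E \<tau> \<le> 0" by (simp add: mult_le_0_iff)
  then have "E \<tau> = 0" using sum_nonneg[of I "\<lambda>i. p i \<tau> \<bullet> p i \<tau>"] by (simp add: E_def)
  then show ?thesis using i \<open>finite I\<close> by (simp add: E_def sum_nonneg_eq_0_iff)
qed

lemma norm_linear_axis_le: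
  fixes f :: "real^'r::finite \<Rightarrow> 'b::real_normed_vector"
  assumes "linear f"
  shows "norm (f a) \<le> norm a * (\<Sum>k\<in>UNIV. norm (f (axis k 1)))"
proof -
  have "norm (f a) = norm (\<Sum>k\<in>UNIV. a $ k *\<^sub>R f (axis k 1))" by (simp add: linear_axis_sum[OF assms])
  also have "\<dots> \<le> (\<Sum>k\<in>UNIV. norm (a $ k *\<^sub>R f (axis k 1)))" by (rule norm_sum)
  also have "\<dots> \<le> (\<Sum>k\<in>UNIV. norm a * norm (f (axis k 1)))"
    using component_le_norm_cart[of a] by (intro sum_mono) (simp add: mult_right_mono)
  finally show ?thesis by (simp add: sum_distrib_left)
qed

text \<open>
  Along the curve the conjugate $Z$ satisfies $Z' = [\Theta, Z]$, so its component orthogonal to \<open>L\<close> satisfies a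
  homogeneous linear inequality.
\<close>

lemma conjugation_along_curve:
  fixes L :: "('k::{real_normed_field, euclidean_space}^'n^'n::finite) set"
  assumes L: "lie_subalgebra L"
    and \<eta>: "\<And>\<tau>. \<tau> \<in> {0..1} \<Longrightarrow> (\<eta> has_vector_derivative \<Theta> \<tau> ** \<eta> \<tau>) (at \<tau> within {0..1})"
    and inv: "\<And>\<tau>. \<tau> \<in> {0..1} \<Longrightarrow> invertible (\<eta> \<tau>)" and \<eta>0: "\<eta> 0 = mat 1"
    and \<Theta>: "continuous_on {0..1} \<Theta>" "\<And>\<tau>. \<tau> \<in> {0..1} \<Longrightarrow> \<Theta> \<tau> \<in> L" and B: "B \<in> L"
  shows "\<eta> 1 ** B ** matrix_inv (\<eta> 1) \<in> L"
proof -
  have sub: "subspace L" and com: "\<And>P Q. P \<in> L \<Longrightarrow> Q \<in> L \<Longrightarrow> commutator P Q \<in> L"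
    using L by (auto simp: lie_subalgebra_def)
  obtain \<pi> :: "'k^'n^'n \<Rightarrow> 'k^'n^'n" where \<pi>: "linear \<pi>" "\<And>x. \<pi> x = 0 \<longleftrightarrow> x \<in> L" "\<And>x. x - \<pi> x \<in> L"
    using subspace_projection[OF sub] by blast
  have bl: "bounded_linear \<pi>" using \<pi>(1) by (simp add: linear_conv_bounded_linear)
  obtain k1 where k1: "k1 > 0" "\<And>x. norm (\<pi> x) \<le> norm x * k1"
    using bounded_linear.pos_bounded[OF bl] by metis
  obtain k2 where k2: "k2 > 0" "\<And>(P :: 'k^'n^'n) (Q :: 'k^'n^'n). norm (commutator P Q) \<le> norm P * norm Q * k2"
    using bounded_bilinear.pos_bounded[OF bounded_bilinear_commutator] by blast
  obtain M where M: "\<And>\<tau>. \<tau> \<in> {0..1} \<Longrightarrow> norm (\<Theta> \<tau>) \<le> M"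
    using compact_imp_bounded[OF compact_continuous_image[OF \<Theta>(1) compact_Icc]]
    unfolding bounded_iff by blast
  have "M \<ge> 0" by (rule order_trans[OF norm_ge_zero M[of 0]]) simp
  define Z where "Z = (\<lambda>\<tau>. \<eta> \<tau> ** B ** matrix_inv (\<eta> \<tau>))"
  have dZ: "(Z has_vector_derivative commutator (\<Theta> \<tau>) (Z \<tau>)) (at \<tau> within {0..1})" if \<tau>: "\<tau> \<in> {0..1}" for \<tau>
  proof -
    have "(Z has_vector_derivative \<eta> \<tau> ** B ** - (matrix_inv (\<eta> \<tau>) ** (\<Theta> \<tau> ** \<eta> \<tau>) ** matrix_inv (\<eta> \<tau>))
        + (\<eta> \<tau> ** 0 + (\<Theta> \<tau> ** \<eta> \<tau>) ** B) ** matrix_inv (\<eta> \<tau>)) (at \<tau> within {0..1})"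
      unfolding Z_def
      by (intro has_vector_derivative_matrix_mult has_vector_derivative_matrix_inv \<eta> inv \<tau> has_vector_derivative_const)
    then show ?thesis
      using inv[OF \<tau>] by (simp add: Z_def commutator_def mat_simps matrix_inv_cancel)
  qed
  have "\<pi> (Z 1) = 0"
  proof (rule gronwall_family[of "{()}" "\<lambda>_ \<tau>. \<pi> (Z \<tau>)" "\<lambda>_ \<tau>. \<pi> (commutator (\<Theta> \<tau>) (Z \<tau>))" "k1 * k2 * M"])
    show "((\<lambda>\<tau>. \<pi> (Z \<tau>)) has_vector_derivative \<pi> (commutator (\<Theta> \<tau>) (Z \<tau>))) (at \<tau> within {0..1})"
      if "\<tau> \<in> {0..1}" for \<tau>
      by (rule bounded_linear.has_vector_derivative[OF bl dZ[OF that]])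
    show "norm (\<pi> (commutator (\<Theta> \<tau>) (Z \<tau>))) \<le> k1 * k2 * M * (\<Sum>j\<in>{()}. norm (\<pi> (Z \<tau>)))"
      if \<tau>: "\<tau> \<in> {0..1}" for \<tau>
    proof -
      have "commutator (\<Theta> \<tau>) (Z \<tau>) = commutator (\<Theta> \<tau>) (\<pi> (Z \<tau>)) + commutator (\<Theta> \<tau>) (Z \<tau> - \<pi> (Z \<tau>))"
        by (simp flip: comm_add)
      moreover have "\<pi> (commutator (\<Theta> \<tau>) (Z \<tau> - \<pi> (Z \<tau>))) = 0"
        unfolding \<pi>(2) by (intro com \<Theta>(2)[OF \<tau>] \<pi>(3))
      ultimately have "norm (\<pi> (commutator (\<Theta> \<tau>) (Z \<tau>))) = norm (\<pi> (commutator (\<Theta> \<tau>) (\<pi> (Z \<tau>))))"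
        by (simp add: linear_add[OF \<pi>(1)])
      also have "\<dots> \<le> (norm (\<Theta> \<tau>) * norm (\<pi> (Z \<tau>)) * k2) * k1"
        using k1 k2(2) by (meson mult_right_mono order_trans less_imp_le)
      also have "\<dots> \<le> (M * norm (\<pi> (Z \<tau>)) * k2) * k1"
        using M[OF \<tau>] k1(1) k2(1) by (intro mult_right_mono) auto
      finally show ?thesis by (simp add: mult_ac)
    qed
    show "\<pi> (Z 0) = 0" using B by (simp add: Z_def \<eta>0 \<pi>(2) matrix_inv_eqI)
  qed (use k1 k2 \<open>M \<ge> 0\<close> in auto)
  then show ?thesis by (simp add: \<pi>(2) Z_def)
qed

context birep_chart
begin

section \<open>The Lie algebra at the unit is invariant under the operators near the unit\<close>

lemma birep_lie_algebra_eq: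
  assumes x: "x \<in> X"
  shows "birep_lie_algebra e (U, \<phi>) S T (psi x) = moufang_relations.lie (SS x) (TT x)"
  unfolding birep_lie_algebra_def moufang_relations.lie_def[OF relations_at[OF x]]
    moufang_relations.yam_def[OF relations_at[OF x]] yamagutian_def Let_def ..

definition L :: "('k^'n^'n) set" where "L = birep_lie_algebra e (U, \<phi>) S T e"

lemma L_eq: "L = moufang_relations.lie (SS y0) (TT y0)"
  using birep_lie_algebra_eq[OF y0_mem] by (simp add: L_def psi_y0)

lemma SS_y0: "SS y0 a = Ds y0 a" and TT_y0: "TT y0 a = Dt y0 a"
proof -
  have "matrix_inv (mat 1 :: 'k^'n^'n) = mat 1" by (simp add: matrix_inv_eqI)
  then show "SS y0 a = Ds y0 a" "TT y0 a = Dt y0 a" by (simp_all add: SS_eq TT_eq s_y0 t_y0)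
qed

lemma lie_L: "lie_subalgebra L"
  unfolding L_eq by (rule moufang_relations.lie_subalgebra_lie[OF relations_at[OF y0_mem]])

lemma sub_L: "subspace L" and com_L: "P \<in> L \<Longrightarrow> Q \<in> L \<Longrightarrow> commutator P Q \<in> L"
  using lie_L by (auto simp: lie_subalgebra_def)

lemma Ds_y0_L: "Ds y0 a \<in> L" and Dt_y0_L: "Dt y0 a \<in> L"
  unfolding L_eq SS_y0[symmetric] TT_y0[symmetric]
  by (rule moufang_relations.lie_memI[OF relations_at[OF y0_mem]])+

lemma V_y0: "V y0 a = a"
proof -
  have "((\<lambda>y. \<phi> (psi y0 \<odot> psi y)) has_derivative V y0) (at y0)" by (rule mult_deriv[OF y0_mem])
  then have "((\<lambda>y. y) has_derivative V y0) (at y0)"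
    by (rule has_derivative_transform_within_open[OF _ chart(2) y0_mem])
      (auto simp: psi_y0 unit_left chart(5))
  from fun_cong[OF has_derivative_unique[OF this has_derivative_ident]] show ?thesis .
qed

text \<open>
  \<open>V\<close> is the identity at the unit and continuous. The uniform bound on its inverse keeps the
  coefficients of the differential inequality in \<open>SS_N_L\<close> bounded.
\<close>

lemma V_bounded_below:
  "\<exists>\<rho>>0. ball y0 \<rho> \<subseteq> X \<and> (\<forall>x\<in>ball y0 \<rho>. \<forall>a. norm a \<le> 2 * norm (V x a))"
proof -
  let ?h = "\<lambda>x. \<Sum>j\<in>UNIV. norm (V x (axis j 1) - axis j 1)"
  have "isCont (\<lambda>p. V p (axis j 1)) y0" for j
    by (rule has_derivative_continuous[OF V_deriv[OF y0_mem]])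
  then have cont: "isCont ?h y0" by (intro continuous_intros)
  have h0: "?h y0 = 0" by (simp add: V_y0)
  have "(1/2 :: real) > 0" by simp
  from cont[unfolded continuous_at_eps_delta, rule_format, OF this]
  obtain d where d: "d > 0" "\<And>x. dist x y0 < d \<Longrightarrow> dist (?h x) 0 < 1/2"
    unfolding h0 by blast
  obtain d' where d': "d' > 0" "ball y0 d' \<subseteq> X" using chart(2) y0_mem open_contains_ball by blast
  have "norm a \<le> 2 * norm (V x a)" if "x \<in> ball y0 (min d d')" for x a
  proof -
    have x: "x \<in> X" "dist x y0 < d" using that d' by (auto simp: dist_commute)
    have "linear (\<lambda>a. V x a - a)"
      by (intro linear_compose_sub linear_V x linear_ident)
    from norm_linear_axis_le[OF this, of a] have "norm (V x a - a) \<le> norm a * ?h x" .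
    also have "\<dots> \<le> norm a * (1/2)"
      using d(2)[OF x(2)] by (intro mult_left_mono) (auto simp: dist_real_def)
    finally show ?thesis using norm_triangle_ineq2[of a "a - V x a"] by (simp add: norm_minus_commute)
  qed
  then show ?thesis using d(1) d' by (intro exI[of _ "min d d'"]) auto
qed

text \<open>
  The radius of a coordinate ball on which the estimate holds; everything below happens over this ball \<open>N\<close>.
\<close>

definition \<rho> where
  "\<rho> = (SOME \<rho>. \<rho> > 0 \<and> ball y0 \<rho> \<subseteq> X \<and> (\<forall>x\<in>ball y0 \<rho>. \<forall>a. norm a \<le> 2 * norm (V x a)))"
definition N where "N = ball y0 \<rho>"

lemma rho_pos: "\<rho> > 0" and N_X: "x \<in> N \<Longrightarrow> x \<in> X"
  and V_below: "x \<in> N \<Longrightarrow> norm a \<le> 2 * norm (V x a)"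
proof -
  have "\<rho> > 0 \<and> ball y0 \<rho> \<subseteq> X \<and> (\<forall>x\<in>ball y0 \<rho>. \<forall>a. norm a \<le> 2 * norm (V x a))"
    unfolding \<rho>_def by (rule someI_ex[OF V_bounded_below[unfolded Bex_def]])
  then show "\<rho> > 0" "x \<in> N \<Longrightarrow> x \<in> X" "x \<in> N \<Longrightarrow> norm a \<le> 2 * norm (V x a)"
    by (auto simp: N_def)
qed

lemma y0_N: "y0 \<in> N" by (simp add: N_def rho_pos)

lemma segment_N:
  assumes "q \<in> N" "y \<in> N" "\<tau> \<in> {0..1}"
  shows "q + \<tau> *\<^sub>R (y - q) \<in> N"
proof -
  have "q + \<tau> *\<^sub>R (y - q) = (1 - \<tau>) *\<^sub>R q + \<tau> *\<^sub>R y" by (simp add: algebra_simps)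
  then show ?thesis using convexD[OF convex_ball, of q y0 \<rho> y "1 - \<tau>" \<tau>] assms by (simp add: N_def)
qed

lemma linear_bounded_along_segment:
  fixes f :: "real^'r \<Rightarrow> real^'r \<Rightarrow> 'k^'n^'n"
  assumes lin: "\<And>x. linear (f x)" and cont: "\<And>b. continuous_on X (\<lambda>x. f x b)"
    and y: "y \<in> N"
  obtains M where "M \<ge> 0" "\<And>\<tau> a. \<tau> \<in> {0..1} \<Longrightarrow> norm (f (y0 + \<tau> *\<^sub>R (y - y0)) a) \<le> norm a * M"
proof -
  let ?x = "\<lambda>\<tau>. y0 + \<tau> *\<^sub>R (y - y0)"
  have "continuous_on {0..1} (\<lambda>\<tau>. f (?x \<tau>) b)" for b
    by (rule continuous_on_compose2[OF cont]) (auto intro!: continuous_intros N_X segment_N y0_N y)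
  then have "continuous_on {0..1} (\<lambda>\<tau>. \<Sum>k\<in>UNIV. norm (f (?x \<tau>) (axis k 1)))"
    by (intro continuous_intros)
  from compact_imp_bounded[OF compact_continuous_image[OF this compact_Icc]]
  obtain M where M: "\<And>\<tau>. \<tau> \<in> {0..1} \<Longrightarrow> norm (\<Sum>k\<in>UNIV. norm (f (?x \<tau>) (axis k 1))) \<le> M"
    unfolding bounded_iff by blast
  have "M \<ge> 0" by (rule order_trans[OF norm_ge_zero M[of 0]]) simp
  moreover have "norm (f (?x \<tau>) a) \<le> norm a * M" if "\<tau> \<in> {0..1}" for \<tau> a
    using order_trans[OF norm_linear_axis_le[OF lin] mult_left_mono[OF order_trans[OF abs_ge_self M[OF that, unfolded real_norm_def]] norm_ge_zero]] .
  ultimately show ?thesis by (rule that)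
qed

lemma continuous_SS: "continuous_on X (\<lambda>x. SS x b)"
  by (intro continuous_at_imp_continuous_on ballI)
    (rule SS_deriv[where b = b], assumption, erule has_derivative_continuous)

lemma continuous_TT: "continuous_on X (\<lambda>x. TT x b)"
  by (intro continuous_at_imp_continuous_on ballI)
    (rule TT_deriv[where b = b], assumption, erule has_derivative_continuous)

text \<open>
  Along the segment from the unit to \<open>y\<close>, in the coordinates $a$ of its direction, the generators satisfy
  $S_b' = [T_a, S_b] = [u_a - S_a, S_b]$ with $u_a = S_a + T_a$ constant and in \<open>L\<close>. Modulo \<open>L\<close> the right side
  is linear in the components of $S_a$ and $S_b$ orthogonal to \<open>L\<close>, which vanish at the unit.
\<close>

lemma SS_N_L: assumes y: "y \<in> N" shows "SS y b \<in> L"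
proof -
  obtain \<pi> :: "'k^'n^'n \<Rightarrow> 'k^'n^'n" where \<pi>: "linear \<pi>" "\<And>x. \<pi> x = 0 \<longleftrightarrow> x \<in> L" "\<And>x. x - \<pi> x \<in> L"
    using subspace_projection[OF sub_L] by blast
  have bl: "bounded_linear \<pi>" using \<pi>(1) by (simp add: linear_conv_bounded_linear)
  obtain k1 where k1: "k1 > 0" "\<And>x. norm (\<pi> x) \<le> norm x * k1"
    using bounded_linear.pos_bounded[OF bl] by metis
  obtain k2 where k2: "k2 > 0" "\<And>(P :: 'k^'n^'n) (Q :: 'k^'n^'n). norm (commutator P Q) \<le> norm P * norm Q * k2"
    using bounded_bilinear.pos_bounded[OF bounded_bilinear_commutator] by blast
  define \<xi> where "\<xi> = y - y0"
  define x where "x = (\<lambda>\<tau>. y0 + \<tau> *\<^sub>R \<xi>)"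
  have xN: "x \<tau> \<in> N" if "\<tau> \<in> {0..1}" for \<tau>
    unfolding x_def \<xi>_def by (rule segment_N[OF y0_N y that])
  obtain M where M: "M \<ge> 0" "\<And>\<tau> a. \<tau> \<in> {0..1} \<Longrightarrow> norm (SS (x \<tau>) a) \<le> norm a * M"
    using linear_bounded_along_segment[OF linear_SS continuous_SS y] unfolding x_def \<xi>_def by blast
  obtain M' where M': "M' \<ge> 0" "\<And>\<tau> a. \<tau> \<in> {0..1} \<Longrightarrow> norm (TT (x \<tau>) a) \<le> norm a * M'"
    using linear_bounded_along_segment[OF linear_TT continuous_TT y] unfolding x_def \<xi>_def by blast
  define a where "a = (\<lambda>\<tau>. SOME a. V (x \<tau>) a = \<xi>)"
  have a: "V (x \<tau>) (a \<tau>) = \<xi>" if "\<tau> \<in> {0..1}" for \<tau>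
    unfolding a_def by (rule someI_ex[OF V_surj[OF N_X[OF xN[OF that]]]])
  have na: "norm (a \<tau>) \<le> 2 * norm \<xi>" if "\<tau> \<in> {0..1}" for \<tau>
    using V_below[OF xN[OF that], of "a \<tau>"] a[OF that] by simp
  define p where "p = (\<lambda>k \<tau>. \<pi> (SS (x \<tau>) (axis k 1)))"
  define p' where "p' = (\<lambda>k \<tau>. \<pi> (commutator (TT (x \<tau>) (a \<tau>)) (SS (x \<tau>) (axis k 1))))"
  define C where "C = k1 * k2 * (2 * norm \<xi> * M' + 2 * norm \<xi> * (M + M * k1))"
  have sumk: "norm (\<pi> (SS (x \<tau>) b)) \<le> norm b * (\<Sum>k\<in>UNIV. norm (p k \<tau>))" for \<tau> b
    using norm_linear_axis_le[OF linear_compose[OF linear_SS \<pi>(1)], of "x \<tau>" b] by (simp add: p_def)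
  have "p k 1 = 0" for k
  proof (rule gronwall_family[of UNIV p p' C])
    show "(p k has_vector_derivative p' k \<tau>) (at \<tau> within {0..1})" if \<tau>: "\<tau> \<in> {0..1}" for k \<tau>
    proof -
      obtain D where D: "((\<lambda>p. SS p (axis k 1)) has_derivative D) (at (x \<tau>))"
        "\<And>a. D (V (x \<tau>) a) = commutator (TT (x \<tau>) a) (SS (x \<tau>) (axis k 1))"
        using SS_deriv[OF N_X[OF xN[OF \<tau>]]] by blast
      have "((\<lambda>\<tau>. SS (x \<tau>) (axis k 1)) has_vector_derivative D \<xi>) (at \<tau> within {0..1})"
        unfolding x_def
        by (rule has_vector_derivative_line[where f = "\<lambda>p. SS p (axis k 1)"]) (use D(1) in \<open>simp add: x_def\<close>)
      moreover have "D \<xi> = commutator (TT (x \<tau>) (a \<tau>)) (SS (x \<tau>) (axis k 1))"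
        using D(2)[of "a \<tau>"] a[OF \<tau>] by simp
      ultimately show ?thesis
        unfolding p_def p'_def using bounded_linear.has_vector_derivative[OF bl] by metis
    qed
    show "norm (p' k \<tau>) \<le> C * (\<Sum>j\<in>UNIV. norm (p j \<tau>))" if \<tau>: "\<tau> \<in> {0..1}" for k \<tau>
    proof -
      let ?P = "\<Sum>j\<in>UNIV. norm (p j \<tau>)"
      let ?Sa = "SS (x \<tau>) (a \<tau>)" and ?Ta = "TT (x \<tau>) (a \<tau>)" and ?Sb = "SS (x \<tau>) (axis k 1)"
      let ?lb = "?Sb - \<pi> ?Sb"
      have P0: "?P \<ge> 0" by (simp add: sum_nonneg)
      have "?Sa + ?Ta = Ds y0 (a \<tau>) + Dt y0 (a \<tau>)" by (rule sum_const[OF N_X[OF xN[OF \<tau>]]])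
      then have "?Sa + ?Ta \<in> L" using Ds_y0_L Dt_y0_L subspace_add[OF sub_L] by metis
      then have uL: "(?Sa + ?Ta) - (?Sa - \<pi> ?Sa) \<in> L" using \<pi>(3) by (rule subspace_diff[OF sub_L])
      have eq: "commutator ?Ta ?Sb = commutator ?Ta (\<pi> ?Sb) - commutator (\<pi> ?Sa) ?lb
          + commutator ((?Sa + ?Ta) - (?Sa - \<pi> ?Sa)) ?lb"
        by (simp add: comm_simps)
      have "\<pi> (commutator ((?Sa + ?Ta) - (?Sa - \<pi> ?Sa)) ?lb) = 0"
        unfolding \<pi>(2) by (intro com_L uL \<pi>(3))
      then have "p' k \<tau> = \<pi> (commutator ?Ta (\<pi> ?Sb)) - \<pi> (commutator (\<pi> ?Sa) ?lb)"
        unfolding p'_def by (subst eq) (simp add: linear_add[OF \<pi>(1)] linear_diff[OF \<pi>(1)])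
      then have "norm (p' k \<tau>) \<le> norm (\<pi> (commutator ?Ta (\<pi> ?Sb))) + norm (\<pi> (commutator (\<pi> ?Sa) ?lb))"
        by (simp add: norm_triangle_ineq4)
      also have "\<dots> \<le> norm ?Ta * norm (\<pi> ?Sb) * k2 * k1 + norm (\<pi> ?Sa) * norm ?lb * k2 * k1"
        using k1 k2(2) by (intro add_mono) (meson mult_right_mono order_trans less_imp_le)+
      also have "\<dots> \<le> (2 * norm \<xi> * M') * ?P * k2 * k1 + (2 * norm \<xi> * ?P) * (M + M * k1) * k2 * k1"
      proof (intro add_mono mult_right_mono mult_mono)
        show "norm ?Ta \<le> 2 * norm \<xi> * M'"
          using M'(2)[OF \<tau>, of "a \<tau>"] mult_right_mono[OF na[OF \<tau>] M'(1)] by linarith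
        show "norm (\<pi> ?Sb) \<le> ?P" using sumk[of \<tau> "axis k 1"] by simp
        show "norm (\<pi> ?Sa) \<le> 2 * norm \<xi> * ?P"
          using sumk[of \<tau> "a \<tau>"] mult_right_mono[OF na[OF \<tau>] P0] by linarith
        have "norm ?Sb \<le> M" using M(2)[OF \<tau>, of "axis k 1"] by simp
        moreover have "norm (\<pi> ?Sb) \<le> M * k1"
          using order_trans[OF k1(2) mult_right_mono[OF \<open>norm ?Sb \<le> M\<close> less_imp_le[OF k1(1)]]] .
        ultimately show "norm ?lb \<le> M + M * k1" using norm_triangle_ineq4[of ?Sb "\<pi> ?Sb"] by linarith
      qed (use k1 k2 M M' P0 in auto)
      also have "\<dots> = C * ?P" by (simp add: C_def algebra_simps)
      finally show ?thesis .
    qed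
    show "p k 0 = 0" for k
      by (simp add: p_def x_def \<pi>(2) SS_y0 Ds_y0_L)
    show "C \<ge> 0" using k1 k2 M M' by (simp add: C_def)
  qed auto
  then have "\<pi> (SS y b) = 0"
    using sumk[of 1 b] by (simp add: x_def \<xi>_def)
  then show ?thesis by (simp add: \<pi>(2))
qed

lemma TT_N_L: assumes y: "y \<in> N" shows "TT y b \<in> L"
proof -
  have "TT y b = Ds y0 b + Dt y0 b - SS y b"
    using sum_const[OF N_X[OF y], of b] by (simp add: algebra_simps)
  then show ?thesis
    by (simp add: subspace_add[OF sub_L] subspace_diff[OF sub_L] Ds_y0_L Dt_y0_L SS_N_L[OF y])
qed

lemma s_velocity_L: assumes y: "y \<in> N" shows "matrix_inv (s y) ** Ds y \<xi> \<in> L"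
proof -
  obtain a where "V y a = \<xi>" using V_surj[OF N_X[OF y]] by blast
  then have "matrix_inv (s y) ** Ds y \<xi> = SS y a"
    using lie_S[OF N_X[OF y], of a] inv_s by (simp add: matrix_inv_cancel)
  then show ?thesis using SS_N_L[OF y] by simp
qed

lemma t_velocity_L: assumes y: "y \<in> N" shows "Dt y \<xi> ** matrix_inv (t y) \<in> L"
proof -
  obtain a where "V y a = \<xi>" using V_surj[OF N_X[OF y]] by blast
  then have "Dt y \<xi> ** matrix_inv (t y) = TT y a"
    using lie_T[OF N_X[OF y], of a] inv_t by (simp add: matrix_inv_cancel)
  then show ?thesis using TT_N_L[OF y] by simp
qed

lemma continuous_s: "continuous_on X s" and continuous_t: "continuous_on X t"
  and continuous_Ds: "continuous_on X (\<lambda>x. Ds x \<xi>)" and continuous_Dt: "continuous_on X (\<lambda>x. Dt x \<xi>)"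
  by (intro continuous_at_imp_continuous_on ballI,
      erule has_derivative_continuous[OF s_deriv] has_derivative_continuous[OF t_deriv]
        has_derivative_continuous[OF Ds_deriv] has_derivative_continuous[OF Dt_deriv])+

lemma Ad_t: assumes y: "y \<in> N" and B: "B \<in> L" shows "t y ** B ** matrix_inv (t y) \<in> L"
proof -
  let ?x = "\<lambda>\<tau>. y0 + \<tau> *\<^sub>R (y - y0)"
  have xN: "?x \<tau> \<in> N" if "\<tau> \<in> {0..1}" for \<tau> by (rule segment_N[OF y0_N y that])
  have c: "continuous_on {0..1} ?x" by (intro continuous_intros)
  have im: "?x ` {0..1} \<subseteq> X" using xN N_X by blast
  have "t (?x 1) ** B ** matrix_inv (t (?x 1)) \<in> L"
  proof (rule conjugation_along_curve[OF lie_L, where \<Theta> = "\<lambda>\<tau>. Dt (?x \<tau>) (y - y0) ** matrix_inv (t (?x \<tau>))"])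
    show "((\<lambda>\<tau>. t (?x \<tau>)) has_vector_derivative Dt (?x \<tau>) (y - y0) ** matrix_inv (t (?x \<tau>)) ** t (?x \<tau>)) (at \<tau> within {0..1})"
      if "\<tau> \<in> {0..1}" for \<tau>
      using has_vector_derivative_line[OF t_deriv[OF N_X[OF xN[OF that]]]] by (simp add: matrix_inv_cancel inv_t)
    show "continuous_on {0..1} (\<lambda>\<tau>. Dt (?x \<tau>) (y - y0) ** matrix_inv (t (?x \<tau>)))"
      by (intro continuous_intros continuous_on_matrix_inv inv_t continuous_on_compose2[OF continuous_Dt c im]
          continuous_on_compose2[OF continuous_t c im])
  qed (auto simp: inv_t t_y0 t_velocity_L[OF xN] B)
  then show ?thesis by simp
qed

text \<open>
  The Lie equation of $S$ has its generator on the right of $S_g$. For the inverse of $S_g$ it stands on the left, as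
  \<open>conjugation_along_curve\<close> requires.
\<close>

lemma Ad_inv_s: assumes y: "y \<in> N" and B: "B \<in> L" shows "matrix_inv (s y) ** B ** s y \<in> L"
proof -
  let ?x = "\<lambda>\<tau>. y0 + \<tau> *\<^sub>R (y - y0)"
  have xN: "?x \<tau> \<in> N" if "\<tau> \<in> {0..1}" for \<tau> by (rule segment_N[OF y0_N y that])
  have c: "continuous_on {0..1} ?x" by (intro continuous_intros)
  have im: "?x ` {0..1} \<subseteq> X" using xN N_X by blast
  have "matrix_inv (s (?x 1)) ** B ** matrix_inv (matrix_inv (s (?x 1))) \<in> L"
  proof (rule conjugation_along_curve[OF lie_L, where \<Theta> = "\<lambda>\<tau>. - (matrix_inv (s (?x \<tau>)) ** Ds (?x \<tau>) (y - y0))"])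
    show "((\<lambda>\<tau>. matrix_inv (s (?x \<tau>))) has_vector_derivative
        - (matrix_inv (s (?x \<tau>)) ** Ds (?x \<tau>) (y - y0)) ** matrix_inv (s (?x \<tau>))) (at \<tau> within {0..1})"
      if "\<tau> \<in> {0..1}" for \<tau>
      using has_vector_derivative_matrix_inv[OF has_vector_derivative_line[OF s_deriv[OF N_X[OF xN[OF that]]]] inv_s that]
      by (simp add: mat_simps)
    show "continuous_on {0..1} (\<lambda>\<tau>. - (matrix_inv (s (?x \<tau>)) ** Ds (?x \<tau>) (y - y0)))"
      by (intro continuous_intros continuous_on_matrix_inv inv_s continuous_on_compose2[OF continuous_Ds c im]
          continuous_on_compose2[OF continuous_s c im])
    show "matrix_inv (s (?x 0)) = mat 1" by (simp add: s_y0 matrix_inv_eqI)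
  qed (auto simp: inv_s invertible_matrix_inv s_velocity_L[OF xN] subspace_neg[OF sub_L] B)
  then show ?thesis by (simp add: matrix_inv_matrix_inv inv_s)
qed

lemma Ad_inv_t: "y \<in> N \<Longrightarrow> B \<in> L \<Longrightarrow> matrix_inv (t y) ** B ** t y \<in> L"
  by (rule conjugation_inverse_invariant[OF sub_L inv_t Ad_t])

lemma Ad_s: assumes y: "y \<in> N" and "B \<in> L" shows "s y ** B ** matrix_inv (s y) \<in> L"
  using conjugation_inverse_invariant[OF sub_L invertible_matrix_inv[OF inv_s], of y B] Ad_inv_s[OF y] assms(2)
  by (simp add: matrix_inv_matrix_inv inv_s)

end

section \<open>Generated matrix groups\<close>

lemma GL_simps: "carrier GL = {P. invertible P}" "P \<otimes>\<^bsub>GL\<^esub> Q = P ** Q" "\<one>\<^bsub>GL\<^esub> = mat 1"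
  by (simp_all add: GL_def)

lemma invertible_one: "invertible (mat 1)"
  by (simp add: invertible_def exI[of _ "mat 1"])

lemma group_GL: "group (GL :: ('k::field^'n^'n::finite) monoid)"
proof (rule groupI)
  fix P :: "'k^'n^'n" assume "P \<in> carrier GL"
  then show "\<exists>Q\<in>carrier GL. Q \<otimes>\<^bsub>GL\<^esub> P = \<one>\<^bsub>GL\<^esub>"
    by (auto simp: GL_simps intro!: bexI[of _ "matrix_inv P"] matrix_inv_left invertible_matrix_inv)
qed (auto simp: GL_simps invertible_mult matrix_mul_assoc intro: invertible_one)

lemma m_inv_GL: "invertible (P :: 'k::field^'n^'n::finite) \<Longrightarrow> inv\<^bsub>GL\<^esub> P = matrix_inv P"
  by (rule group.inv_equality[OF group_GL]) (auto simp: GL_simps matrix_inv_left invertible_matrix_inv)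

lemma generate_GL_induct [consumes 2, case_names one incl inv mult]:
  fixes H :: "('k::field^'n^'n::finite) set"
  assumes "P \<in> generate GL H" "H \<subseteq> {h. invertible h}"
    and "Q (mat 1)" "\<And>h. h \<in> H \<Longrightarrow> Q h" "\<And>h. h \<in> H \<Longrightarrow> Q (matrix_inv h)"
    and "\<And>A B. A \<in> generate GL H \<Longrightarrow> Q A \<Longrightarrow> B \<in> generate GL H \<Longrightarrow> Q B \<Longrightarrow> Q (A ** B)"
  shows "Q P"
  using assms(1)
proof (induction rule: generate.induct)
  case one
  then show ?case using assms(3) by (simp add: GL_simps)
next
  case (incl h)
  then show ?case by (rule assms(4))
next
  case (inv h)
  then have "invertible h" using assms(2) by blast
  then show ?case using assms(5)[OF inv] by (simp add: m_inv_GL)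
next
  case (eng h1 h2)
  then show ?case using assms(6) by (simp add: GL_simps)
qed

text \<open>
  The elements are values of words over a countable alphabet.
\<close>

lemma countable_generate_GL:
  fixes H :: "('k::field^'n^'n::finite) set"
  assumes "countable H" and inv: "H \<subseteq> {h. invertible h}"
  shows "countable (generate GL H)"
proof (rule countable_subset)
  define f where "f = (\<lambda>ws :: ('k^'n^'n) list. foldr (**) ws (mat 1))"
  let ?W = "lists (H \<union> matrix_inv ` H)"
  have app: "f (us @ vs) = f us ** f vs" for us vs
    by (induction us) (auto simp: f_def matrix_mul_assoc)
  show "generate GL H \<subseteq> f ` ?W"
  proof
    fix P assume "P \<in> generate GL H"
    from this inv show "P \<in> f ` ?W"
    proof (induction rule: generate_GL_induct)
      case one
      then show ?case by (intro image_eqI[of _ _ "[]"]) (auto simp: f_def)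
    next
      case (incl h)
      then show ?case by (intro image_eqI[of _ _ "[h]"]) (auto simp: f_def)
    next
      case (inv h)
      then show ?case by (intro image_eqI[of _ _ "[matrix_inv h]"]) (auto simp: f_def)
    next
      case (mult A B)
      then obtain us vs where "us \<in> ?W" "A = f us" "vs \<in> ?W" "B = f vs" by blast
      then show ?case by (intro image_eqI[of _ _ "us @ vs"]) (auto simp: app)
    qed
  qed
  show "countable (f ` ?W)" using assms(1) by (intro countable_image countable_lists) auto
qed

context birep_chart
begin

subsection \<open>The group generated near the unit\<close>

definition K :: "('k^'n^'n) set" where "K = generate GL (s ` N \<union> t ` N)"

lemma st_invertible: "s ` Y \<union> t ` Y \<subseteq> {h. invertible h}"
  using inv_s inv_t by auto

lemma subgroup_K: "subgroup K GL"
  unfolding K_def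
  by (rule group.generate_is_subgroup[OF group_GL]) (auto simp: GL_simps inv_s inv_t)

lemma K_invertible: "P \<in> K \<Longrightarrow> invertible P"
  using subgroup.mem_carrier[OF subgroup_K] by (simp add: GL_simps)

lemma K_mult: "P \<in> K \<Longrightarrow> Q \<in> K \<Longrightarrow> P ** Q \<in> K"
  using subgroup.m_closed[OF subgroup_K] by (simp add: GL_simps)

lemma K_inv: "P \<in> K \<Longrightarrow> matrix_inv P \<in> K"
  using subgroup.m_inv_closed[OF subgroup_K] K_invertible by (simp add: m_inv_GL)

lemma K_s: "y \<in> N \<Longrightarrow> s y \<in> K" and K_t: "y \<in> N \<Longrightarrow> t y \<in> K"
  by (auto simp: K_def intro: generate.incl)

lemma K_invariant: "invariant_matrix_group L K"
proof
  show "subspace L" by (rule sub_L)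
  show "mat 1 \<in> K" using subgroup.one_closed[OF subgroup_K] by (simp add: GL_simps)
  fix P B assume P: "P \<in> K" and B: "B \<in> L"
  have "\<forall>B\<in>L. P ** B ** matrix_inv P \<in> L"
    using P[unfolded K_def] st_invertible
  proof (induction rule: generate_GL_induct)
    case one
    then show ?case by (simp add: matrix_inv_eqI)
  next
    case (incl h)
    then show ?case using Ad_s Ad_t by blast
  next
    case (inv h)
    then show ?case using Ad_inv_s Ad_inv_t by (auto simp: matrix_inv_matrix_inv inv_s inv_t)
  next
    case (mult P Q)
    have "invertible P" "invertible Q" using mult K_invertible by (auto simp: K_def)
    then have "P ** Q ** B ** matrix_inv (P ** Q) = P ** (Q ** B ** matrix_inv Q) ** matrix_inv P" for B
      by (simp add: matrix_inv_mult matrix_mul_assoc)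
    then show ?case using mult by auto
  qed
  then show "P ** B ** matrix_inv P \<in> L" using B by blast
qed (fact K_mult K_inv K_invertible)+

interpretation K: invariant_matrix_group L K by (rule K_invariant)

lemma horizontal_s:
  assumes N: "\<And>\<tau>. \<tau> \<in> I \<Longrightarrow> q + \<tau> *\<^sub>R \<xi> \<in> N"
  shows "K.horizontal (\<lambda>\<tau>. s (q + \<tau> *\<^sub>R \<xi>)) (\<lambda>\<tau>. Ds (q + \<tau> *\<^sub>R \<xi>) \<xi>) I"
  unfolding K.horizontal_def
proof (intro conjI ballI)
  show "continuous_on I (\<lambda>\<tau>. Ds (q + \<tau> *\<^sub>R \<xi>) \<xi>)"
    by (rule continuous_on_compose2[OF continuous_Ds]) (auto intro!: continuous_intros N_X N)
  fix \<tau> assume "\<tau> \<in> I"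
  note x = N[OF this]
  show "s (q + \<tau> *\<^sub>R \<xi>) \<in> K" by (rule K_s[OF x])
  show "((\<lambda>\<tau>. s (q + \<tau> *\<^sub>R \<xi>)) has_vector_derivative Ds (q + \<tau> *\<^sub>R \<xi>) \<xi>) (at \<tau> within I)"
    by (rule has_vector_derivative_line[OF s_deriv[OF N_X[OF x]]])
  show "matrix_inv (s (q + \<tau> *\<^sub>R \<xi>)) ** Ds (q + \<tau> *\<^sub>R \<xi>) \<xi> \<in> L" by (rule s_velocity_L[OF x])
qed

lemma horizontal_t:
  assumes N: "\<And>\<tau>. \<tau> \<in> I \<Longrightarrow> q + \<tau> *\<^sub>R \<xi> \<in> N"
  shows "K.horizontal (\<lambda>\<tau>. t (q + \<tau> *\<^sub>R \<xi>)) (\<lambda>\<tau>. Dt (q + \<tau> *\<^sub>R \<xi>) \<xi>) I"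
  unfolding K.horizontal_def
proof (intro conjI ballI)
  show "continuous_on I (\<lambda>\<tau>. Dt (q + \<tau> *\<^sub>R \<xi>) \<xi>)"
    by (rule continuous_on_compose2[OF continuous_Dt]) (auto intro!: continuous_intros N_X N)
  fix \<tau> assume "\<tau> \<in> I"
  note x = N[OF this]
  let ?x = "q + \<tau> *\<^sub>R \<xi>"
  show "t ?x \<in> K" by (rule K_t[OF x])
  show "((\<lambda>\<tau>. t (q + \<tau> *\<^sub>R \<xi>)) has_vector_derivative Dt ?x \<xi>) (at \<tau> within I)"
    by (rule has_vector_derivative_line[OF t_deriv[OF N_X[OF x]]])
  have "matrix_inv (t ?x) ** Dt ?x \<xi> = matrix_inv (t ?x) ** (Dt ?x \<xi> ** matrix_inv (t ?x)) ** t ?x"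
    by (simp add: matrix_mul_assoc matrix_inv_cancel inv_t)
  also have "\<dots> \<in> L" by (rule Ad_inv_t[OF x t_velocity_L[OF x]])
  finally show "matrix_inv (t ?x) ** Dt ?x \<xi> \<in> L" .
qed

lemma Basis_axis: "(Basis :: (real^'r) set) = range (\<lambda>j. axis j 1)"
  by (auto simp: Basis_vec_def)

lemma hull_at:
  assumes x: "x \<in> X"
  shows "birep_lie_algebra e (U, \<phi>) S T (psi x)
    = lie_subalgebra hull derivative_generators e (U, \<phi>) S T (psi x)"
  unfolding birep_lie_algebra_eq[OF x]
  by (rule moufang_relations.lie_hull[OF relations_at[OF x]])
    (simp add: derivative_generators_def dgen_lin Basis_axis image_image)

lemma L_subset_velocities: "L \<subseteq> K.velocities"
proof -
  have line: "y0 + \<tau> *\<^sub>R axis j 1 \<in> N" if "\<tau> \<in> {-\<rho><..<\<rho>}" for \<tau> and j :: 'r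
    using that by (auto simp: N_def dist_norm)
  have "Ds y0 (axis j 1) \<in> K.velocities" for j
    by (rule K.velocitiesI[OF rho_pos horizontal_s[OF line]]) (auto simp: s_y0)
  moreover have "Dt y0 (axis j 1) \<in> K.velocities" for j
    by (rule K.velocitiesI[OF rho_pos horizontal_t[OF line]]) (auto simp: t_y0)
  ultimately have "derivative_generators e (U, \<phi>) S T (psi y0) \<subseteq> K.velocities"
    by (auto simp: derivative_generators_def dgen_lin SS_y0 TT_y0)
  then have "lie_subalgebra hull derivative_generators e (U, \<phi>) S T (psi y0) \<subseteq> K.velocities"
    by (rule hull_minimal) (rule K.lie_subalgebra_velocities)
  then show ?thesis unfolding L_def using hull_at[OF y0_mem] by (simp add: psi_y0)
qed

subsection \<open>A countable dense subgroup\<close>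

text \<open>
  The approximation property that \<open>group_lie_algebra_eq\<close> asks for.
\<close>

definition near :: "('k^'n^'n) set \<Rightarrow> 'k^'n^'n \<Rightarrow> bool" where
  "near D P \<longleftrightarrow> (\<forall>\<epsilon>>0. \<exists>\<eta> \<eta>'. K.horizontal \<eta> \<eta>' {0..1} \<and> \<eta> 0 \<in> D \<and> \<eta> 1 = P \<and>
    (\<forall>\<tau>\<in>{0..1}. dist P (\<eta> \<tau>) < \<epsilon>))"

lemma nearE:
  assumes "near D P" "\<epsilon> > 0"
  obtains \<eta> \<eta>' where "K.horizontal \<eta> \<eta>' {0..1}" "\<eta> 0 \<in> D" "\<eta> 1 = P" "\<And>\<tau>. \<tau> \<in> {0..1} \<Longrightarrow> dist P (\<eta> \<tau>) < \<epsilon>"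
  using assms unfolding near_def by blast

text \<open>
  A point of the ball is joined by a short segment to a point of a countable dense set, and the segment is mapped to a
  horizontal curve.
\<close>

lemma near_letter:
  assumes Q: "\<And>W. open W \<Longrightarrow> W \<noteq> {} \<Longrightarrow> \<exists>q\<in>Q. q \<in> W" and y: "y \<in> N"
    and f: "continuous_on X f"
      "\<And>q. q \<in> N \<Longrightarrow> \<exists>\<eta>'. K.horizontal (\<lambda>\<tau>. f (q + \<tau> *\<^sub>R (y - q))) \<eta>' {0..1}"
  shows "near (f ` (Q \<inter> N)) (f y)"
  unfolding near_def
proof (intro allI impI)
  fix \<epsilon> :: real assume "\<epsilon> > 0"
  have "isCont f y" using f(1) N_X[OF y] continuous_on_eq_continuous_at[OF chart(2)] by blast
  from this[unfolded continuous_at_eps_delta, rule_format, OF \<open>\<epsilon> > 0\<close>]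
  obtain \<delta> where \<delta>: "\<delta> > 0" "\<And>x. dist x y < \<delta> \<Longrightarrow> dist (f x) (f y) < \<epsilon>" by blast
  have "open (ball y \<delta> \<inter> N)" by (auto simp: N_def)
  moreover have "y \<in> ball y \<delta> \<inter> N" using \<delta>(1) y by simp
  ultimately obtain q where "q \<in> Q" "q \<in> ball y \<delta> \<inter> N" using Q[of "ball y \<delta> \<inter> N"] by blast
  then have q: "q \<in> Q" "q \<in> N" "dist y q < \<delta>" by auto
  obtain \<eta>' where h: "K.horizontal (\<lambda>\<tau>. f (q + \<tau> *\<^sub>R (y - q))) \<eta>' {0..1}" using f(2)[OF q(2)] by blast
  have "dist (f y) (f (q + \<tau> *\<^sub>R (y - q))) < \<epsilon>" if \<tau>: "\<tau> \<in> {0..1}" for \<tau>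
  proof -
    have "q + \<tau> *\<^sub>R (y - q) - y = (1 - \<tau>) *\<^sub>R (q - y)" by (simp add: algebra_simps)
    then have "dist (q + \<tau> *\<^sub>R (y - q)) y = (1 - \<tau>) * dist y q"
      using \<tau> by (simp add: dist_norm norm_minus_commute)
    also have "\<dots> \<le> 1 * dist y q" using \<tau> by (intro mult_right_mono) auto
    finally have "dist (q + \<tau> *\<^sub>R (y - q)) y < \<delta>" using q(3) by simp
    from \<delta>(2)[OF this] show ?thesis by (simp add: dist_commute)
  qed
  with h q show "\<exists>\<eta> \<eta>'. K.horizontal \<eta> \<eta>' {0..1} \<and> \<eta> 0 \<in> f ` (Q \<inter> N) \<and> \<eta> 1 = f y \<and>
      (\<forall>\<tau>\<in>{0..1}. dist (f y) (\<eta> \<tau>) < \<epsilon>)"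
    by (intro exI[of _ "\<lambda>\<tau>. f (q + \<tau> *\<^sub>R (y - q))"] exI[of _ \<eta>']) auto
qed

lemma near_mono: "near D P \<Longrightarrow> D \<subseteq> D' \<Longrightarrow> near D' P"
  unfolding near_def by (meson subsetD)

lemma near_inverse:
  assumes P: "near D P" "P \<in> K" and D: "\<And>d. d \<in> D \<Longrightarrow> matrix_inv d \<in> D'"
  shows "near D' (matrix_inv P)"
  unfolding near_def
proof (intro allI impI)
  fix \<epsilon> :: real assume "\<epsilon> > 0"
  have cont: "continuous_on {Q :: 'k^'n^'n. invertible Q} matrix_inv"
    by (rule continuous_on_matrix_inv) auto
  have "P \<in> {Q. invertible Q}" using P(2) K_invertible by simp
  from cont[unfolded continuous_on_iff, rule_format, OF this \<open>\<epsilon> > 0\<close>]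
  obtain \<delta> where \<delta>: "\<delta> > 0"
    "\<forall>Q\<in>{Q. invertible Q}. dist Q P < \<delta> \<longrightarrow> dist (matrix_inv Q) (matrix_inv P) < \<epsilon>"
    by blast
  obtain \<eta> \<eta>' where \<eta>: "K.horizontal \<eta> \<eta>' {0..1}" "\<eta> 0 \<in> D" "\<eta> 1 = P" "\<And>\<tau>. \<tau> \<in> {0..1} \<Longrightarrow> dist P (\<eta> \<tau>) < \<delta>"
    using nearE[OF P(1) \<delta>(1)] by blast
  have "dist (matrix_inv P) (matrix_inv (\<eta> \<tau>)) < \<epsilon>" if "\<tau> \<in> {0..1}" for \<tau>
    using \<delta>(2) \<eta>(4)[OF that] K_invertible[OF K.horizontalD(2)[OF \<eta>(1) that]]
    by (auto simp: dist_commute[of P] dist_commute[of "matrix_inv P"])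
  then show "\<exists>\<eta> \<eta>'. K.horizontal \<eta> \<eta>' {0..1} \<and> \<eta> 0 \<in> D' \<and> \<eta> 1 = matrix_inv P \<and>
      (\<forall>\<tau>\<in>{0..1}. dist (matrix_inv P) (\<eta> \<tau>) < \<epsilon>)"
    using K.horizontal_inverse[OF \<eta>(1)] D[OF \<eta>(2)] \<eta>(3) by blast
qed

lemma near_mult:
  assumes P: "near D P" and Q: "near D Q" and D: "\<And>c d. c \<in> D \<Longrightarrow> d \<in> D \<Longrightarrow> c ** d \<in> D"
  shows "near D (P ** Q)"
  unfolding near_def
proof (intro allI impI)
  fix \<epsilon> :: real assume "\<epsilon> > 0"
  have "isCont (\<lambda>z :: ('k^'n^'n) \<times> ('k^'n^'n). fst z ** snd z) (P, Q)"
    by (intro bounded_bilinear.continuous[OF bounded_bilinear_matrix_mult] continuous_intros)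
  from this[unfolded continuous_at_eps_delta, rule_format, OF \<open>\<epsilon> > 0\<close>]
  obtain \<delta> where \<delta>: "\<delta> > 0" "\<And>z. dist z (P, Q) < \<delta> \<Longrightarrow> dist (fst z ** snd z) (fst (P, Q) ** snd (P, Q)) < \<epsilon>"
    by blast
  have "\<delta>/2 > 0" using \<delta>(1) by simp
  obtain \<eta> \<eta>' where \<eta>: "K.horizontal \<eta> \<eta>' {0..1}" "\<eta> 0 \<in> D" "\<eta> 1 = P" "\<And>\<tau>. \<tau> \<in> {0..1} \<Longrightarrow> dist P (\<eta> \<tau>) < \<delta>/2"
    using nearE[OF P \<open>\<delta>/2 > 0\<close>] by blast
  obtain \<theta> \<theta>' where \<theta>: "K.horizontal \<theta> \<theta>' {0..1}" "\<theta> 0 \<in> D" "\<theta> 1 = Q" "\<And>\<tau>. \<tau> \<in> {0..1} \<Longrightarrow> dist Q (\<theta> \<tau>) < \<delta>/2"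
    using nearE[OF Q \<open>\<delta>/2 > 0\<close>] by blast
  have "dist (P ** Q) (\<eta> \<tau> ** \<theta> \<tau>) < \<epsilon>" if \<tau>: "\<tau> \<in> {0..1}" for \<tau>
  proof -
    have "dist (\<eta> \<tau>, \<theta> \<tau>) (P, Q) \<le> dist (\<eta> \<tau>) P + dist (\<theta> \<tau>) Q"
      unfolding dist_Pair_Pair by (rule sqrt_sum_squares_le_sum) auto
    also have "\<dots> < \<delta>" using \<eta>(4)[OF \<tau>] \<theta>(4)[OF \<tau>] by (simp add: dist_commute)
    finally show ?thesis using \<delta>(2) by (fastforce simp: dist_commute)
  qed
  then show "\<exists>\<eta> \<eta>'. K.horizontal \<eta> \<eta>' {0..1} \<and> \<eta> 0 \<in> D \<and> \<eta> 1 = P ** Q \<and>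
      (\<forall>\<tau>\<in>{0..1}. dist (P ** Q) (\<eta> \<tau>) < \<epsilon>)"
    using K.horizontal_mult[OF \<eta>(1) \<theta>(1)] D[OF \<eta>(2) \<theta>(2)] \<eta>(3) \<theta>(3) by blast
qed

lemma countable_approximation: "\<exists>D. countable D \<and> (\<forall>P\<in>K. near D P)"
proof -
  obtain Q :: "(real^'r) set" where Q: "countable Q" "\<And>W. open W \<Longrightarrow> W \<noteq> {} \<Longrightarrow> \<exists>q\<in>Q. q \<in> W"
    using countable_dense_exists[where 'a = "real^'r"] by metis
  define H where "H = s ` (Q \<inter> N) \<union> t ` (Q \<inter> N)"
  define D where "D = generate GL H"
  have inv: "H \<subseteq> {h. invertible h}" unfolding H_def by (rule st_invertible)
  have "countable H" using Q(1) by (auto simp: H_def)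
  then have "countable D" unfolding D_def using inv by (rule countable_generate_GL)
  have D_mult: "c ** d \<in> D" if "c \<in> D" "d \<in> D" for c d
    using generate.eng[of c GL H d] that by (simp add: D_def GL_simps)
  have D_inv: "matrix_inv h \<in> D" if "h \<in> H" for h
    using generate.inv[OF that, of GL] inv that by (auto simp: D_def m_inv_GL)
  have HD: "H \<subseteq> D" by (auto simp: D_def intro: generate.incl)
  have s_near: "near H (s y)" if y: "y \<in> N" for y
    by (rule near_mono[OF near_letter[OF Q(2) y continuous_s]])
      (auto simp: H_def intro!: exI horizontal_s segment_N[OF _ y])
  have t_near: "near H (t y)" if y: "y \<in> N" for y
    by (rule near_mono[OF near_letter[OF Q(2) y continuous_t]])
      (auto simp: H_def intro!: exI horizontal_t segment_N[OF _ y])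
  have near_H: "near H h" "h \<in> K" if "h \<in> s ` N \<union> t ` N" for h
    using that s_near t_near K_s K_t by auto
  have "near D P" if "P \<in> K" for P
    using that[unfolded K_def] st_invertible
  proof (induction rule: generate_GL_induct)
    case one
    have "mat 1 \<in> D" using generate.one[of GL H] by (simp add: D_def GL_simps)
    then show ?case
      unfolding near_def
      by (intro allI impI exI[of _ "\<lambda>_. mat 1"] exI[of _ "\<lambda>_. 0"]) (simp add: K.horizontal_const K.one_K)
  next
    case (incl h)
    then show ?case using near_mono[OF near_H(1) HD] by blast
  next
    case (inv h)
    then show ?case using near_inverse[OF near_H D_inv] by blast
  next
    case (mult A B)
    then show ?case using near_mult D_mult by blast
  qed
  with \<open>countable D\<close> show ?thesis by blast
qed

lemma group_lie_algebra_K: "group_lie_algebra K = L"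
proof -
  obtain D where D: "countable D" "\<And>P. P \<in> K \<Longrightarrow> near D P"
    using countable_approximation by blast
  show ?thesis
    by (rule K.group_lie_algebra_eq[OF L_subset_velocities D(1)]) (use D(2) in \<open>simp add: near_def\<close>)
qed

subsection \<open>The multiplication group of the component of the unit\<close>

lemma psi_N_open: "open (psi ` N)"
proof -
  have "psi ` N = U \<inter> \<phi> -` N"
  proof
    show "psi ` N \<subseteq> U \<inter> \<phi> -` N" using N_X chart(6,7) by auto
    show "U \<inter> \<phi> -` N \<subseteq> psi ` N" using chart(5) by (metis IntE image_eqI subsetI vimageE)
  qed
  then show ?thesis
    using continuous_open_preimage[OF chart(3,1), of N] by (simp add: N_def)
qed

text \<open>
  The elements whose operators lie in \<open>K\<close> are closed under products and inverses and contain a neighbourhood of the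
  unit. Left translates of that neighbourhood show that they form an open and closed set.
\<close>

lemma K_component:
  assumes "g \<in> connected_component_set UNIV e"
  shows "S g \<in> K" "T g \<in> K"
proof -
  define M where "M = {g. S g \<in> K \<and> T g \<in> K}"
  have nM: "psi ` N \<subseteq> M" using K_s K_t by (auto simp: M_def s_def t_def)
  have closed: "g \<odot> h \<in> M" if "g \<in> M" "h \<in> M" for g h
    using that by (auto simp: M_def S_mult T_mult intro!: K_mult K_inv)
  have inverse: "ginv g \<in> M" if "g \<in> M" for g
    using that by (auto simp: M_def S_inverse T_inverse intro: K_inv)
  have nbhd: "open ((\<lambda>x. ginv g \<odot> x) -` (psi ` N))" "g \<in> (\<lambda>x. ginv g \<odot> x) -` (psi ` N)" for g
  proof -
    show "open ((\<lambda>x. ginv g \<odot> x) -` (psi ` N))" by (rule open_vimage[OF psi_N_open continuous_mult_left])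
    show "g \<in> (\<lambda>x. ginv g \<odot> x) -` (psi ` N)" using y0_N psi_y0 by (auto simp: left_inverse intro: image_eqI[of _ _ y0])
  qed
  have "open M"
  proof (subst open_subopen, intro ballI)
    fix g assume g: "g \<in> M"
    have "x \<in> M" if "ginv g \<odot> x \<in> psi ` N" for x
      using closed[OF g, of "ginv g \<odot> x"] that nM by (auto simp: inverse_cancel_left)
    then show "\<exists>V. open V \<and> g \<in> V \<and> V \<subseteq> M" using nbhd[of g] by blast
  qed
  \<comment> \<open>if $x = gn$ were in \<open>M\<close> with $n$ near the unit, then so would be $g = x n^{-1}$\<close>
  moreover have "open (- M)"
  proof (subst open_subopen, intro ballI)
    fix g assume g: "g \<in> - M"
    have "x \<notin> M" if n: "ginv g \<odot> x \<in> psi ` N" for x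
    proof
      assume "x \<in> M"
      then have "x \<odot> ginv (ginv g \<odot> x) \<in> M" using closed inverse n nM by blast
      moreover have "x \<odot> ginv (ginv g \<odot> x) = g"
        using cancel_right_inverse[of g "ginv g \<odot> x"] by (simp add: inverse_cancel_left)
      ultimately show False using g by simp
    qed
    then show "\<exists>V. open V \<and> g \<in> V \<and> V \<subseteq> - M" using nbhd[of g] by blast
  qed
  moreover have "e \<in> M" using nM y0_N psi_y0 by force
  ultimately have "connected_component_set UNIV e \<subseteq> M"
    using connectedD[OF connected_connected_component, of M "- M" UNIV e] connected_component_refl[of e UNIV]
    by blast
  then show "S g \<in> K" "T g \<in> K" using assms by (auto simp: M_def)
qed

lemma mult_group_component: "mult_group S T (connected_component_set UNIV e) = K"
proof
  let ?C = "connected_component_set UNIV e"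
  show "mult_group S T ?C \<subseteq> K"
    unfolding mult_group_def
    by (rule group.generate_subgroup_incl[OF group_GL _ subgroup_K]) (use K_component in blast)
  have "continuous_on N psi" by (rule continuous_on_subset[OF chart(4)]) (use N_X in blast)
  then have "connected (psi ` N)" by (rule connected_continuous_image) (simp add: N_def)
  moreover have "e \<in> psi ` N" using y0_N psi_y0 by force
  ultimately have "psi ` N \<subseteq> ?C" by (intro connected_component_maximal) auto
  then have "s ` N \<union> t ` N \<subseteq> S ` ?C \<union> T ` ?C" by (auto simp: s_def t_def)
  then show "K \<subseteq> mult_group S T ?C"
    unfolding mult_group_def K_def by (rule group.mono_generate[OF group_GL])
qed

end

theorem mainTheorem3:
  fixes m :: "'g::{t2_space, second_countable_topology} \<Rightarrow> 'g \<Rightarrow> 'g" and e :: 'g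
    and A :: "('g, real^'r::finite) chart set"
    and S T :: "'g \<Rightarrow> 'k::{real_normed_field, euclidean_space}^'n^'n::finite"
    and U :: "'g set" and \<phi> :: "'g \<Rightarrow> real^'r"
  assumes loop: "analytic_moufang_loop m e A"
    and birep: "birepresentation m e S T"
    and smooth_S: "smooth_function A S"
    and smooth_T: "smooth_function A T"
    and chart: "(U, \<phi>) \<in> A" "e \<in> U"
  shows
    "(\<forall>g\<in>U.
        let Sg = lin_S e (U, \<phi>) S T g;
            Tg = lin_T e (U, \<phi>) S T g;
            Y = yamagutian e (U, \<phi>) S T g;
            br = loop_bracket m e (U, \<phi>) g;
            ybr = yamaguti_bracket m e (U, \<phi>) g;
            relations = (\<forall>x y.
              commutator (Sg x) (Sg y)
                = 2 *\<^sub>R Y x y + (1/3) *\<^sub>R Sg (br x y) + (2/3) *\<^sub>R Tg (br x y) \<and>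
              commutator (Sg x) (Tg y)
                = - Y x y + (1/3) *\<^sub>R Sg (br x y) - (1/3) *\<^sub>R Tg (br x y) \<and>
              commutator (Tg x) (Tg y)
                = 2 *\<^sub>R Y x y - (2/3) *\<^sub>R Sg (br x y) - (1/3) *\<^sub>R Tg (br x y));
            L = birep_lie_algebra e (U, \<phi>) S T g
        in
          generalized_lie_equations m e (U, \<phi>) S T g \<and>
          (integrability_conditions m e (U, \<phi>) S T g \<longleftrightarrow> relations) \<and>
          relations \<and>
          (\<forall>x y z. 6 *\<^sub>R commutator (Y x y) (Sg z) = Sg (ybr x y z)) \<and>
          (\<forall>x y z. 6 *\<^sub>R commutator (Y x y) (Tg z) = Tg (ybr x y z)) \<and>
          (\<forall>x y z w. 6 *\<^sub>R commutator (Y x y) (Y z w) = Y (ybr x y z) w + Y z (ybr x y w)) \<and>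
          lie_subalgebra L \<and>
          L = lie_subalgebra hull derivative_generators e (U, \<phi>) S T g \<and>
          dim L \<le> 2 * CARD('r) + CARD('r) * (CARD('r) - 1) div 2) \<and>
     group_lie_algebra (mult_group S T (connected_component_set UNIV e))
       = birep_lie_algebra e (U, \<phi>) S T e \<and>
     (connected (UNIV :: 'g set) \<longrightarrow>
       group_lie_algebra (mult_group S T UNIV) = birep_lie_algebra e (U, \<phi>) S T e)"
proof -
  interpret birep_chart m e A S T U \<phi>
    using assms
    by (intro birep_chart.intro moufang_birepresentation.intro birep_chart_axioms.intro)
      (auto simp: analytic_moufang_loop_def)
  have component: "group_lie_algebra (mult_group S T (connected_component_set UNIV e))
       = birep_lie_algebra e (U, \<phi>) S T e"
    using group_lie_algebra_K by (simp add: mult_group_component L_def)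
  have whole: "group_lie_algebra (mult_group S T UNIV) = birep_lie_algebra e (U, \<phi>) S T e"
    if "connected (UNIV :: 'g set)"
  proof -
    have "connected_component_set UNIV e = UNIV"
      using connected_component_maximal[OF UNIV_I that subset_UNIV, of e] by auto
    then show ?thesis using component by simp
  qed
  show ?thesis
  proof (intro conjI ballI impI, goal_cases)
    case (1 g)
    then have g: "g \<in> U" .
    have x: "\<phi> g \<in> X" and gx: "psi (\<phi> g) = g" using g chart_mem birep_chart.chart(5)[OF birep_chart_axioms] by auto
    interpret rel: moufang_relations "lin_S e (U, \<phi>) S T g" "lin_T e (U, \<phi>) S T g" "loop_bracket m e (U, \<phi>) g"
      using relations_at[OF x] by (simp add: gx)
    have Y: "yamagutian e (U, \<phi>) S T g x y = rel.yam x y" for x y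
      by (simp add: yamagutian_def rel.yam_def Let_def)
    have ybr: "yamaguti_bracket m e (U, \<phi>) g x y z = rel.ybr x y z" for x y z
      by (simp add: yamaguti_bracket_def rel.ybr_def Let_def)
    have L: "birep_lie_algebra e (U, \<phi>) S T g = rel.lie"
      using birep_lie_algebra_eq[OF x] by (simp add: gx)
    have hull: "rel.lie = lie_subalgebra hull derivative_generators e (U, \<phi>) S T g"
      using hull_at[OF x] by (simp add: gx L)
    show ?case
      unfolding Let_def Y ybr L
      using lie_equations_at[OF g] integrability_at[OF g] rel.relation_ss rel.relation_st rel.relation_tt
        rel.reductivity_s rel.reductivity_t rel.yam_derivation rel.lie_subalgebra_lie hull rel.dim_lie
      by (intro conjI allI iffI) (assumption | simp)+
  qed (use component whole in auto)
qed

end
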